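(* Let $t\geq 1$ and $k\geq 3$ be integers and let $n=t(k-1)+2$. For all integers $i\geq 0$ and all $j\geq t+2$, \[ \beta_{i,i+j}(I(\mathrm{GA}(t,k)'))=\begin{cases}1 & \text{if } i+j=n \text{ and } j=t+2,\\ 0 & \text{otherwise.}\end{cases}\] In particular, $\operatorname{reg}(I(\mathrm{GA}(t,k)'))=t+2$.
   Context: For integers $t\ge 1$, $k\ge 2$, put $n=t(k-1)+2$. $\mathrm{GA}(t,k)'$ is the simple graph with vertex set $\mathbb Z_n$ in which $a$ and $b$ are adjacent iff $b-a\in\{1+jt \mid j\in\{1,2,\dots,k-2\}\}$ modulo $n$. (This set is closed under negation modulo $n$. Equivalently, for integers $0\le i<j<n$, $\{i,j\}$ is an edge iff $j-i\equiv 1 \pmod t$ and $j-i\notin\{1,n-1\}$.) It is the Generalized Andrásfai graph $\mathrm{GA}(t,k)$, i.e. the Cayley graph of $\mathbb Z_n$ with connection set $\{1+jt\mid 0\le j\le k-1\}$, with the edges $\{i,i+1\}$, $i\in\mathbb Z_n$, removed. Let $\mathbb K$ be an arbitrary field. For a graph $G$ with vertices $x_1,\dots,x_n$, the edge ideal is $I(G)=\langle x_ix_j \mid \{x_i,x_j\}\in E(G)\rangle\subseteq R=\mathbb K[x_1,\dots,x_n]$. $\beta_{i,j}(I(G))$ denotes the graded Betti number of the ideal $I(G)$ (not of $R/I(G)$): the number of generators of degree $j$ in the $i$-th free module of the minimal graded free resolution $\cdots\to F_1\to F_0\to I(G)\to 0$. The regularity is $\operatorname{reg}(I(G))=\max\{j\mid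 \beta_{i,i+j}(I(G))\neq 0 \text{ for some } i\}$. *)

theory Defs
  imports
    "HOL-Library.Poly_Mapping"
    "HOL-Number_Theory.Cong"
    "Jordan_Normal_Form.Matrix"
begin

type_synonym ('v, 'k) mpoly = "('v \<Rightarrow>\<^sub>0 nat) \<Rightarrow>\<^sub>0 'k"

text \<open>The type of multivariate polynomials has a variable for every element of \<open>'v\<close>;
  the ring \<open>K[x\<^sub>v | v \<in> V]\<close> is the following subset, and all coefficients below are taken from it.\<close>

definition polys :: "'v set \<Rightarrow> ('v, 'k::comm_ring_1) mpoly set" where
  "polys V = {p. \<forall>m\<in>Poly_Mapping.keys p. Poly_Mapping.keys m \<subseteq> V}"

definition var :: "'v \<Rightarrow> ('v, 'k::comm_ring_1) mpoly" where
  "var v = Poly_Mapping.single (Poly_Mapping.single v 1) 1"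

definition monom_deg :: "('v \<Rightarrow>\<^sub>0 nat) \<Rightarrow> nat" where
  "monom_deg m = (\<Sum>v\<in>Poly_Mapping.keys m. Poly_Mapping.lookup m v)"

text \<open>The zero polynomial is homogeneous of every degree, and it is the only homogeneous polynomial
  of negative degree.\<close>

definition homogeneous :: "int \<Rightarrow> ('v, 'k::comm_ring_1) mpoly \<Rightarrow> bool" where
  "homogeneous d p \<longleftrightarrow> (\<forall>m\<in>Poly_Mapping.keys p. int (monom_deg m) = d)"

definition ideal_gen :: "'v set \<Rightarrow> ('v, 'k::comm_ring_1) mpoly set \<Rightarrow> ('v, 'k) mpoly set" where
  "ideal_gen V S = {\<Sum>f\<in>A. c f * f | A c. finite A \<and> A \<subseteq> S \<and> (\<forall>f\<in>A. c f \<in> polys V)}"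

definition free_module :: "'v set \<Rightarrow> nat \<Rightarrow> ('v, 'k::comm_ring_1) mpoly vec set" where
  "free_module V r = {u \<in> carrier_vec r. \<forall>s<r. u $ s \<in> polys V}"

text \<open>A resolution \<open>\<dots> \<rightarrow> F\<^sub>1 \<rightarrow> F\<^sub>0 \<rightarrow> I \<rightarrow> 0\<close> over \<open>R = K[x\<^sub>v | v \<in> V]\<close> is given by the following data:
  \<open>F\<^sub>i\<close> is free of rank \<open>r i\<close>, its basis elements \<open>0, \<dots>, r i - 1\<close> have degrees
  \<open>deg i 0, \<dots>, deg i (r i - 1)\<close>, that is \<open>F\<^sub>i\<close> is the direct sum of the shifts \<open>R(-deg i s)\<close>;
  the map \<open>F\<^sub>0 \<rightarrow> I\<close> sends basis element \<open>s\<close> to \<open>g $ s\<close>; and \<open>D i\<close> is the matrix of \<open>F\<^sub>i\<^sub>+\<^sub>1 \<rightarrow> F\<^sub>i\<close>.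
  All maps preserve degrees. The last condition is minimality: \<open>F\<^sub>i\<^sub>+\<^sub>1\<close> is mapped into \<open>\<mm> F\<^sub>i\<close>, where
  \<open>\<mm>\<close> is the ideal of polynomials without constant term.\<close>

definition minimal_graded_free_resolution ::
  "'v set \<Rightarrow> ('v, 'k::field) mpoly set \<Rightarrow> (nat \<Rightarrow> nat) \<Rightarrow> (nat \<Rightarrow> nat \<Rightarrow> int) \<Rightarrow>
   ('v, 'k) mpoly vec \<Rightarrow> (nat \<Rightarrow> ('v, 'k) mpoly mat) \<Rightarrow> bool" where
  "minimal_graded_free_resolution V I r deg g D \<longleftrightarrow>
     g \<in> free_module V (r 0) \<and>
     (\<forall>s<r 0. homogeneous (deg 0 s) (g $ s)) \<and>
     (\<forall>i. D i \<in> carrier_mat (r i) (r (Suc i))) \<and>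
     (\<forall>i. \<forall>q<r i. \<forall>s<r (Suc i).
        D i $$ (q, s) \<in> polys V \<and> homogeneous (deg (Suc i) s - deg i q) (D i $$ (q, s))) \<and>
     (\<lambda>u. g \<bullet> u) ` free_module V (r 0) = I \<and>
     {u \<in> free_module V (r 0). g \<bullet> u = 0} = (\<lambda>w. D 0 *\<^sub>v w) ` free_module V (r 1) \<and>
     (\<forall>i. {u \<in> free_module V (r (Suc i)). D i *\<^sub>v u = 0\<^sub>v (r i)} =
        (\<lambda>w. D (Suc i) *\<^sub>v w) ` free_module V (r (Suc (Suc i)))) \<and>
     (\<forall>i. \<forall>q<r i. \<forall>s<r (Suc i). Poly_Mapping.lookup (D i $$ (q, s)) 0 = 0)"

text \<open>For finite \<open>V\<close> and a homogeneous ideal \<open>I\<close>, a minimal graded free resolution exists, and the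
  number below does not depend on its choice.\<close>

definition graded_betti :: "'v set \<Rightarrow> ('v, 'k::field) mpoly set \<Rightarrow> nat \<Rightarrow> int \<Rightarrow> nat" where
  "graded_betti V I i j = (THE b. \<exists>r deg g D.
     minimal_graded_free_resolution V I r deg g D \<and> b = card {s. s < r i \<and> deg i s = j})"

definition regularity :: "'v set \<Rightarrow> ('v, 'k::field) mpoly set \<Rightarrow> int" where
  "regularity V I = (GREATEST j. \<exists>i. graded_betti V I i (int i + j) \<noteq> 0)"

text \<open>A simple graph is given by its vertex set \<open>V\<close> and its set \<open>E\<close> of two-element subsets of \<open>V\<close>.\<close>

definition edge_ideal :: "'v set \<Rightarrow> 'v set set \<Rightarrow> ('v, 'k::field) mpoly set" where
  "edge_ideal V E = ideal_gen V {var a * var b | a b. {a, b} \<in> E}"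

text \<open>\<open>\<int>\<^sub>n\<close> is represented by \<open>{0..<n}\<close>.\<close>

definition GA_order :: "nat \<Rightarrow> nat \<Rightarrow> nat" where
  "GA_order t k = t * (k - 1) + 2"

definition GA'_verts :: "nat \<Rightarrow> nat \<Rightarrow> nat set" where
  "GA'_verts t k = {0..<GA_order t k}"

definition GA'_edges :: "nat \<Rightarrow> nat \<Rightarrow> nat set set" where
  "GA'_edges t k = {{a, b} | a b. a \<in> GA'_verts t k \<and> b \<in> GA'_verts t k \<and>
     (\<exists>j\<in>{1..k - 2}. [int b - int a = 1 + int j * int t] (mod int (GA_order t k)))}"

end

theory Submission
  imports Defs "HOL-Library.Function_Algebras"
begin

text \<open>All modules that occur are squarefree: they are determined by their components in the squarefree
  multidegrees \<open>U \<subseteq> V\<close>, so a minimal free resolution of the edge ideal is built from finite-dimensional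
  linear algebra, one set \<open>U\<close> at a time. Dimension shifting in the Koszul complex gives Hochster's formula:
  the number of generators of degree \<open>U\<close> in step \<open>i\<close> is the dimension of a Koszul cohomology group of
  the ideal, which is the reduced homology of the independence complex of the graph on \<open>U\<close> in dimension
  \<open>j - 2\<close>, where \<open>card U = i + j\<close>. Two minimal graded resolutions are isomorphic, hence these
  numbers are the graded Betti numbers.

  If \<open>U\<close> is a proper subset of \<open>\<int>\<^sub>n\<close>, the graph on \<open>U\<close> is a union of \<open>t\<close> chain graphs, and deleting a vertex
  that is adjacent to every non-isolated vertex on the opposite side of one of them shows by induction that
  the homology vanishes in dimensions \<open>\<ge> t\<close>. On the whole vertex set, passing to links \<open>t\<close> times, with
  acyclic deletions, shows that the independence complex is a homology \<open>t\<close>-sphere.\<close>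

section \<open>Koszul complexes of squarefree modules\<close>

text \<open>In squarefree degree \<open>U\<close> the Koszul complex of the ideal consists of the
  cochains on the simplex with vertex set \<open>U\<close> that vanish on independent sets. In the
  range \<open>q \<ge> t + 2\<close> its cohomology has dimension at most 1, so the Boolean of
  \<open>cohom\<close> replaces a dimension theory. Squarefree modules, rather than graphs, are the
  setting because both inductions leave the graphs: links turn neighbours into loops, and dimension
  shifting passes from the ideal to its syzygies.

  The constant \<open>t + 2\<close> comes from residue classes. Cutting the cycle at a missing
  vertex makes every edge run from a position in class r to a later one in class r + 1 mod t, which
  gives one chain graph for each of the \<open>t\<close> values of r. Each class can push cohomology
  up by at most one degree, and what is left without edges, a set of loops, has it in degree 1. On
  the full vertex set no such cut exists; the extra degree there comes from one more link, that of
  the vertex \<open>n - 1\<close>.\<close>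

type_synonym 'k sqf = "nat set \<Rightarrow> (nat \<Rightarrow> 'k) set"

abbreviation lookup :: "('a \<Rightarrow>\<^sub>0 'b::zero) \<Rightarrow> 'a \<Rightarrow> 'b" where
  "lookup \<equiv> Poly_Mapping.lookup"

abbreviation keys :: "('a \<Rightarrow>\<^sub>0 'b::zero) \<Rightarrow> 'a set" where
  "keys \<equiv> Poly_Mapping.keys"

definition eps :: "nat \<Rightarrow> nat set \<Rightarrow> 'k::field" where
  "eps x T = (-1) ^ card {y\<in>T. y < x}"

lemma eps_square [simp]: "eps x T * eps x T = (1::'k::field)"
  by (simp add: eps_def flip: power_mult_distrib)

text \<open>Removing the smaller of the two elements lowers the position of the larger by one, while
  removing the larger leaves the position of the smaller alone; so exactly one sign flips.\<close>

lemma eps_swap: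
  assumes "finite T" "x \<in> T" "y \<in> T" "x \<noteq> y"
  shows "eps x T * eps y (T - {x}) = - (eps y T * eps x (T - {y}) :: 'k::field)"
proof -
  have drop: "eps b (T - {a}) = (eps b T :: 'k)" if "b < a" for a b
  proof -
    have "{z \<in> T - {a}. z < b} = {z \<in> T. z < b}"
      using that by auto
    then show ?thesis
      by (simp add: eps_def)
  qed
  have flip: "eps b (T - {a}) = - (eps b T :: 'k)" if "a < b" "a \<in> T" for a b
  proof -
    have "{z \<in> T. z < b} = insert a {z \<in> T - {a}. z < b}"
      using that by auto
    moreover have "finite {z \<in> T - {a}. z < b}"
      using assms(1) by auto
    ultimately have "card {z \<in> T. z < b} = Suc (card {z \<in> T - {a}. z < b})"
      by simp
    then show ?thesis
      by (simp add: eps_def)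
  qed
  show ?thesis
    using assms drop flip by (cases "x < y") (auto simp: not_less le_less)
qed

text \<open>Coordinate vectors of all ranks share the type of functions on \<open>nat\<close>; a
  rank is expressed by the vanishing of all coordinates from some index on.\<close>

definition smul :: "'k::field \<Rightarrow> (nat \<Rightarrow> 'k) \<Rightarrow> nat \<Rightarrow> 'k" where
  "smul c u = (\<lambda>s. c * u s)"

lemma smul_apply [simp]: "smul c u s = c * u s"
  by (simp add: smul_def)

lemma smul_simps [simp]:
  "smul 1 u = u" "smul c 0 = 0" "smul 0 u = 0" "smul c (smul d u) = smul (c * d) u"
  by (auto simp: fun_eq_iff)

lemma smul_distribs:
  "smul c (u + v) = smul c u + smul c v" "smul c (u - v) = smul c u - smul c v"
  "smul (c + d) u = smul c u + smul d u" "smul c (- u) = - smul c u" "smul (- c) u = - smul c u"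
  "smul (c - d) u = smul c u - smul d u"
  by (auto simp: fun_eq_iff algebra_simps)

lemma sum_apply: "(\<Sum>x\<in>A. f x) s = (\<Sum>x\<in>A. f x s)"
  for f :: "'a \<Rightarrow> 'b \<Rightarrow> 'c::comm_monoid_add"
  by (induction A rule: infinite_finite_induct) auto

lemma smul_sum: "smul c (\<Sum>x\<in>A. f x) = (\<Sum>x\<in>A. smul c (f x))"
  by (auto simp: fun_eq_iff sum_apply sum_distrib_left)

definition scal :: "'k::field \<Rightarrow> (nat set \<Rightarrow> nat \<Rightarrow> 'k) \<Rightarrow> nat set \<Rightarrow> nat \<Rightarrow> 'k" where
  "scal c f = (\<lambda>T. smul c (f T))"

lemma scal_apply [simp]: "scal c f T = smul c (f T)"
  by (simp add: scal_def)

definition subspace :: "(nat \<Rightarrow> 'k::field) set \<Rightarrow> bool" where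
  "subspace A \<longleftrightarrow> 0 \<in> A \<and> (\<forall>u\<in>A. \<forall>v\<in>A. u + v \<in> A) \<and> (\<forall>c. \<forall>u\<in>A. smul c u \<in> A)"

lemma subspaceD:
  assumes "subspace A"
  shows "0 \<in> A" "u \<in> A \<Longrightarrow> v \<in> A \<Longrightarrow> u + v \<in> A" "u \<in> A \<Longrightarrow> smul c u \<in> A"
    "u \<in> A \<Longrightarrow> - u \<in> A" "u \<in> A \<Longrightarrow> v \<in> A \<Longrightarrow> u - v \<in> A"
proof -
  show "0 \<in> A" and add: "\<And>u v. u \<in> A \<Longrightarrow> v \<in> A \<Longrightarrow> u + v \<in> A"
    and scale: "\<And>u c. u \<in> A \<Longrightarrow> smul c u \<in> A"
    using assms by (auto simp: subspace_def)
  have neg: "- u \<in> A" if "u \<in> A" for u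
    using scale[OF that, of "-1"] by (simp add: smul_distribs)
  show "u \<in> A \<Longrightarrow> - u \<in> A" "u \<in> A \<Longrightarrow> v \<in> A \<Longrightarrow> u - v \<in> A"
    using neg add[of u "- v"] by auto
qed

lemma subspace_sum:
  assumes "subspace A" "\<And>x. x \<in> X \<Longrightarrow> f x \<in> A"
  shows "(\<Sum>x\<in>X. f x) \<in> A"
  using assms by (induction X rule: infinite_finite_induct) (auto intro: subspaceD)

text \<open>A squarefree \<open>\<nat>\<^sup>n\<close>-graded submodule of a free module, recorded by its components in the
  squarefree degrees; multiplication by variables becomes inclusion.\<close>

definition sqf_module :: "(('k::field) sqf) \<Rightarrow> bool" where
  "sqf_module M \<longleftrightarrow> (\<forall>T. subspace (M T)) \<and> (\<forall>T T'. T \<subseteq> T' \<longrightarrow> M T \<subseteq> M T')"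

lemma sqf_moduleD:
  assumes "sqf_module M"
  shows "subspace (M T)" "T \<subseteq> T' \<Longrightarrow> M T \<subseteq> M T'"
  using assms by (auto simp: sqf_module_def)

definition shift :: "nat \<Rightarrow> (('k::field) sqf) \<Rightarrow> 'k sqf" where
  "shift v M = (\<lambda>T. M (insert v T))"

lemma sqf_module_shift:
  assumes "sqf_module M"
  shows "sqf_module (shift v M)"
  using assms unfolding sqf_module_def shift_def by (meson insert_mono)

text \<open>The degree \<open>U\<close> part of the Koszul complex of \<open>M\<close>: the term \<open>M\<^sub>T\<close> stands for
  \<open>M\<^sub>T \<otimes> e\<^bsub>U - T\<^esub>\<close>, so cohomological degree \<open>q\<close> is Koszul degree \<open>card U - q\<close>.\<close>

definition dif :: "nat set \<Rightarrow> (nat set \<Rightarrow> nat \<Rightarrow> 'k::field) \<Rightarrow> nat set \<Rightarrow> nat \<Rightarrow> 'k" where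
  "dif U f = (\<lambda>T. if T \<subseteq> U then \<Sum>x\<in>T. smul (eps x T) (f (T - {x})) else 0)"

text \<open>Values off the relevant sets are forced to be 0, so that equality of chains is equality
  of functions. Degrees are integers, so that \<open>q - 1\<close> still makes sense at
  \<open>q = 0\<close>, where the group below is zero.\<close>

definition chains ::
  "(('k::field) sqf) \<Rightarrow> nat set \<Rightarrow> int \<Rightarrow> (nat set \<Rightarrow> nat \<Rightarrow> 'k) set" where
  "chains M U q = {f. \<forall>T. if T \<subseteq> U \<and> int (card T) = q then f T \<in> M T else f T = 0}"

definition cycles ::
  "(('k::field) sqf) \<Rightarrow> nat set \<Rightarrow> int \<Rightarrow> (nat set \<Rightarrow> nat \<Rightarrow> 'k) set" where
  "cycles M U q = {f \<in> chains M U q. dif U f = 0}"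

definition bounds ::
  "(('k::field) sqf) \<Rightarrow> nat set \<Rightarrow> int \<Rightarrow> (nat set \<Rightarrow> nat \<Rightarrow> 'k) set" where
  "bounds M U q = dif U ` chains M U (q - 1)"

text \<open>\<open>cohom M U q b\<close> says that the cohomology in degree \<open>q\<close> has dimension one if \<open>b\<close> holds, and
  zero otherwise.\<close>

definition cohom ::
  "(('k::field) sqf) \<Rightarrow> nat set \<Rightarrow> int \<Rightarrow> bool \<Rightarrow> bool" where
  "cohom M U q b \<longleftrightarrow>
     (if b then \<exists>z\<in>cycles M U q - bounds M U q. \<forall>f\<in>cycles M U q. \<exists>c. f - scal c z \<in> bounds M U q
      else cycles M U q \<subseteq> bounds M U q)"

abbreviation exact :: "(('k::field) sqf) \<Rightarrow> nat set \<Rightarrow> int \<Rightarrow> bool" where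
  "exact M U q \<equiv> cohom M U q False"

lemma dif_minus: "dif U (f - g) = dif U f - dif U g"
  and dif_scal: "dif U (scal c f) = scal c (dif U f)"
  and dif_neg: "dif U (- f) = - dif U f"
  and dif_zero [simp]: "dif U 0 = 0"
  by (auto simp: fun_eq_iff dif_def sum_apply algebra_simps sum.distrib sum_subtractf sum_negf sum_distrib_left)

lemma chainsD:
  assumes "f \<in> chains M U q"
  shows "T \<subseteq> U \<Longrightarrow> int (card T) = q \<Longrightarrow> f T \<in> M T" "\<not> T \<subseteq> U \<Longrightarrow> f T = 0" "int (card T) \<noteq> q \<Longrightarrow> f T = 0"
  using assms by (auto simp: chains_def split: if_splits)

lemma chains_linear:
  assumes "sqf_module M"
  shows "0 \<in> chains M U q" "f \<in> chains M U q \<Longrightarrow> g \<in> chains M U q \<Longrightarrow> f + g \<in> chains M U q"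
    "f \<in> chains M U q \<Longrightarrow> scal c f \<in> chains M U q" "f \<in> chains M U q \<Longrightarrow> - f \<in> chains M U q"
    "f \<in> chains M U q \<Longrightarrow> g \<in> chains M U q \<Longrightarrow> f - g \<in> chains M U q"
  using assms by (auto simp: chains_def sqf_module_def intro: subspaceD)

lemma chains_mono:
  assumes "\<And>T. T \<subseteq> U \<Longrightarrow> M T \<subseteq> M' T"
  shows "chains M U q \<subseteq> chains M' U q"
  using assms unfolding chains_def by (smt (verit, best) Collect_mono subsetD)

lemma cohom_cong:
  assumes "\<And>T. T \<subseteq> U \<Longrightarrow> M T = M' T"
  shows "cohom M U q b \<longleftrightarrow> cohom M' U q b"
proof -
  have "chains M U q = chains M' U q" for q
    using chains_mono[of U M M'] chains_mono[of U M' M] assms by blast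
  then show ?thesis
    by (simp add: cohom_def cycles_def bounds_def)
qed

lemma dif_chains:
  assumes "finite U" "sqf_module M" "f \<in> chains M U q"
  shows "dif U f \<in> chains M U (q + 1)"
proof -
  have "dif U f T \<in> M T" if "T \<subseteq> U" for T
  proof -
    have "f (T - {x}) \<in> M T" for x
    proof (cases "int (card (T - {x})) = q")
      case True
      with that have "f (T - {x}) \<in> M (T - {x})"
        by (intro chainsD(1)[OF assms(3)]) auto
      then show ?thesis
        using sqf_moduleD(2)[OF assms(2), of "T - {x}" T] by blast
    next
      case False
      then show ?thesis
        using chainsD(3)[OF assms(3) False] subspaceD(1)[OF sqf_moduleD(1)[OF assms(2)]] by simp
    qed
    then show ?thesis
      using that sqf_moduleD(1)[OF assms(2)] by (auto simp: dif_def intro!: subspace_sum subspaceD)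
  qed
  moreover have "dif U f T = 0" if "T \<subseteq> U" "int (card T) \<noteq> q + 1" for T
  proof -
    have "f (T - {x}) = 0" if "x \<in> T" for x
    proof -
      have "finite T" using \<open>T \<subseteq> U\<close> assms(1) finite_subset by blast
      then have "int (card (T - {x})) \<noteq> q"
        using that \<open>int (card T) \<noteq> q + 1\<close> card_Suc_Diff1[of T x] by linarith
      then show ?thesis
        by (rule chainsD(3)[OF assms(3)])
    qed
    then show ?thesis
      by (auto simp: dif_def)
  qed
  ultimately show ?thesis
    by (auto simp: chains_def dif_def)
qed

text \<open>For \<open>v \<in> U\<close>, the complex of \<open>M\<close> over \<open>U\<close> is the mapping cone of the inclusion of \<open>M\<close> into
  \<open>shift v M\<close> over \<open>U - {v}\<close>; \<open>comb v a b\<close> is the element of the cone with components \<open>a\<close> and \<open>b\<close>.\<close>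

definition comb :: "nat \<Rightarrow> (nat set \<Rightarrow> nat \<Rightarrow> 'k::field) \<Rightarrow> (nat set \<Rightarrow> nat \<Rightarrow> 'k) \<Rightarrow> nat set \<Rightarrow> nat \<Rightarrow> 'k"
  where "comb v a b = (\<lambda>T. if v \<in> T then smul (eps v T) (a (T - {v})) else b T)"

lemma comb_linear:
  "comb v a b + comb v a' b' = comb v (a + a') (b + b')"
  "comb v a b - comb v a' b' = comb v (a - a') (b - b')"
  "scal c (comb v a b) = comb v (scal c a) (scal c b)"
  "comb v 0 0 = 0"
  by (rule ext; simp add: comb_def smul_distribs mult.commute)+

text \<open>At a set containing \<open>v\<close>, dropping \<open>v\<close> contributes
  \<open>b\<close>, and dropping another element contributes a term of \<open>- dif a\<close>, the
  minus sign being that of \<open>eps_swap\<close>. The sign in \<open>comb\<close> is chosen to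
  give exactly this differential of a mapping cone.\<close>

lemma dif_comb:
  fixes a b :: "nat set \<Rightarrow> nat \<Rightarrow> 'k::field"
  assumes "finite U" "v \<in> U"
    and "\<And>T. \<not> T \<subseteq> U - {v} \<Longrightarrow> a T = 0" "\<And>T. \<not> T \<subseteq> U - {v} \<Longrightarrow> b T = 0"
  shows "dif U (comb v a b) = comb v (b - dif (U - {v}) a) (dif (U - {v}) b)"
proof
  fix T
  consider "\<not> T \<subseteq> U" | "T \<subseteq> U" "v \<notin> T" | "T \<subseteq> U" "v \<in> T" by blast
  then show "dif U (comb v a b) T = comb v (b - dif (U - {v}) a) (dif (U - {v}) b) T"
  proof cases
    case 1
    then have "\<not> T - {v} \<subseteq> U - {v}" using assms(2) by blast
    then have "b (T - {v}) = 0" "\<not> T \<subseteq> U - {v}"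
      using 1 assms(4)[of "T - {v}"] by blast+
    then show ?thesis
      using 1 \<open>\<not> T - {v} \<subseteq> U - {v}\<close> by (simp add: dif_def comb_def)
  next
    case 2
    then have "T \<subseteq> U - {v}" by blast
    then show ?thesis
      using 2 by (simp add: dif_def comb_def)
  next
    case 3
    define R where "R = T - {v}"
    have R: "R \<subseteq> U - {v}" "v \<notin> R" "T = insert v R" "finite R"
      using 3 assms(1) finite_subset by (auto simp: R_def)
    have "dif U (comb v a b) T = smul (eps v T) (b R) + (\<Sum>x\<in>R. smul (eps x T) (comb v a b (T - {x})))"
    proof -
      have "dif U (comb v a b) T = (\<Sum>x\<in>insert v R. smul (eps x T) (comb v a b (T - {x})))"
        using 3(1) R(3) by (simp add: dif_def)
      also have "\<dots> = smul (eps v T) (comb v a b (T - {v})) + (\<Sum>x\<in>R. smul (eps x T) (comb v a b (T - {x})))"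
        using R(4,2) by (rule sum.insert)
      also have "comb v a b (T - {v}) = b R"
        by (simp add: comb_def R_def)
      finally show ?thesis .
    qed
    also have "(\<Sum>x\<in>R. smul (eps x T) (comb v a b (T - {x}))) =
        (\<Sum>x\<in>R. - smul (eps v T) (smul (eps x R) (a (R - {x}))))"
    proof (rule sum.cong[OF refl])
      fix x assume "x \<in> R"
      then have "x \<noteq> v" "x \<in> T" "finite T" using R by auto
      have "smul (eps x T) (comb v a b (T - {x})) = smul (eps x T * eps v (T - {x})) (a (R - {x}))"
      proof -
        have "T - {x} - {v} = R - {x}" "v \<in> T - {x}"
          using \<open>x \<noteq> v\<close> 3 by (auto simp: R_def)
        then show ?thesis
          by (simp add: comb_def)
      qed
      also have "eps x T * eps v (T - {x}) = - (eps v T * eps x R :: 'k)"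
        unfolding R_def using \<open>finite T\<close> \<open>x \<in> T\<close> 3(2) \<open>x \<noteq> v\<close> by (rule eps_swap)
      finally show "smul (eps x T) (comb v a b (T - {x})) = - smul (eps v T) (smul (eps x R) (a (R - {x})))"
        unfolding smul_distribs(5) smul_simps(4) .
    qed
    also have "\<dots> = - smul (eps v T) (dif (U - {v}) a R)"
      using R(1) unfolding dif_def by (simp only: smul_sum sum_negf if_True)
    finally have "dif U (comb v a b) T = smul (eps v T) (b R) - smul (eps v T) (dif (U - {v}) a R)"
      unfolding add_uminus_conv_diff .
    moreover have "comb v (b - dif (U - {v}) a) (dif (U - {v}) b) T =
        smul (eps v T) (b R) - smul (eps v T) (dif (U - {v}) a R)"
      unfolding comb_def R_def minus_apply smul_distribs using 3(2) by (rule if_P)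
    ultimately show ?thesis by (rule trans[OF _ sym])
  qed
qed

lemma comb_inject:
  assumes "comb v a b = comb v a' b'"
    and "\<And>T. v \<in> T \<Longrightarrow> a T = 0 \<and> a' T = 0 \<and> b T = 0 \<and> b' T = 0"
  shows "a = a'" "b = b'"
proof -
  have "a T = a' T" for T
  proof (cases "v \<in> T")
    case False
    then have "smul (eps v (insert v T)) (a T) = smul (eps v (insert v T)) (a' T)"
      using fun_cong[OF assms(1), of "insert v T"] by (simp add: comb_def)
    then have "smul (eps v (insert v T)) (smul (eps v (insert v T)) (a T)) =
      smul (eps v (insert v T)) (smul (eps v (insert v T)) (a' T))"
      by simp
    then show ?thesis by simp
  qed (use assms(2) in auto)
  moreover have "b T = b' T" for T
    using fun_cong[OF assms(1), of T] assms(2) by (cases "v \<in> T") (auto simp: comb_def)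
  ultimately show "a = a'" "b = b'" by auto
qed

lemma comb_chains:
  assumes "finite U" "v \<in> U" "sqf_module M"
    and "a \<in> chains (shift v M) (U - {v}) (q - 1)" "b \<in> chains M (U - {v}) q"
  shows "comb v a b \<in> chains M U q"
proof -
  have "comb v a b T \<in> M T" if "T \<subseteq> U" "int (card T) = q" for T
  proof (cases "v \<in> T")
    case True
    have "finite T" using that assms(1) finite_subset by blast
    then have "int (card (T - {v})) = q - 1"
      using that True card_Suc_Diff1[of T v] by linarith
    then have "a (T - {v}) \<in> shift v M (T - {v})"
      using that by (intro chainsD(1)[OF assms(4)]) auto
    then show ?thesis
      using True sqf_moduleD(1)[OF assms(3)] by (auto simp: comb_def shift_def insert_absorb intro: subspaceD)
  next
    case False
    then show ?thesis
      using that chainsD(1)[OF assms(5)] by (auto simp: comb_def)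
  qed
  moreover have "comb v a b T = 0" if "\<not> (T \<subseteq> U \<and> int (card T) = q)" for T
  proof (cases "v \<in> T")
    case True
    show ?thesis
    proof (cases "T \<subseteq> U")
      case sub: True
      then have "finite T" using assms(1) finite_subset by blast
      then have "Suc (card (T - {v})) = card T" "int (card T) \<noteq> q"
        using True sub that card_Suc_Diff1[of T v] by blast+
      then have "int (card (T - {v})) \<noteq> q - 1"
        by linarith
      then have "a (T - {v}) = 0" by (rule chainsD(3)[OF assms(4)])
      then show ?thesis using True by (simp add: comb_def)
    next
      case False
      then have "a (T - {v}) = 0" using assms(2) by (intro chainsD(2)[OF assms(4)]) auto
      then show ?thesis using True by (simp add: comb_def)
    qed
  next
    case False
    then have "b T = 0"
      using that chainsD(2,3)[OF assms(5), of T] False by blast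
    then show ?thesis using False by (simp add: comb_def)
  qed
  ultimately show ?thesis by (auto simp: chains_def)
qed

lemma chains_combE:
  assumes "finite U" "v \<in> U" "sqf_module M" "f \<in> chains M U q"
  obtains a b where "a \<in> chains (shift v M) (U - {v}) (q - 1)" "b \<in> chains M (U - {v}) q" "f = comb v a b"
proof
  \<comment> \<open>The sign is its own inverse, so multiplying by it once more undoes
    \<open>comb\<close>.\<close>
  let ?a = "\<lambda>T. if T \<subseteq> U - {v} then smul (eps v (insert v T)) (f (insert v T)) else 0"
  let ?b = "\<lambda>T. if T \<subseteq> U - {v} then f T else 0"
  show "?b \<in> chains M (U - {v}) q"
    using chainsD[OF assms(4)] by (auto simp: chains_def)
  show "?a \<in> chains (shift v M) (U - {v}) (q - 1)"
  proof -
    have "?a T \<in> M (insert v T)" if "T \<subseteq> U - {v}" "int (card T) = q - 1" for T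
    proof -
      have "finite T" "v \<notin> T" using that assms(1) finite_subset by (blast, blast)
      then have "int (card (insert v T)) = q" using that by simp
      then have "f (insert v T) \<in> M (insert v T)"
        using that assms(2) by (intro chainsD(1)[OF assms(4)]) auto
      then show ?thesis using that sqf_moduleD(1)[OF assms(3)] by (auto intro: subspaceD)
    qed
    moreover have "?a T = 0" if "T \<subseteq> U - {v}" "int (card T) \<noteq> q - 1" for T
    proof -
      have "finite T" "v \<notin> T" using that assms(1) finite_subset by (blast, blast)
      then have "int (card (insert v T)) \<noteq> q" using that by simp
      then show ?thesis using chainsD(3)[OF assms(4)] by simp
    qed
    ultimately show ?thesis unfolding chains_def shift_def by auto
  qed
  show "f = comb v ?a ?b"
  proof
    fix T
    consider "\<not> T \<subseteq> U" | "T \<subseteq> U" "v \<in> T" | "T \<subseteq> U" "v \<notin> T" by blast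
    then show "f T = comb v ?a ?b T"
    proof cases
      case 1
      then show ?thesis using assms(2) chainsD(2)[OF assms(4)] by (auto simp: comb_def)
    next
      case 2
      then have "T - {v} \<subseteq> U - {v}" by blast
      then show ?thesis using 2 by (simp add: comb_def insert_absorb)
    next
      case 3
      then have "T \<subseteq> U - {v}" by blast
      then show ?thesis using 3 by (auto simp: comb_def)
    qed
  qed
qed

text \<open>Induction on \<open>U\<close> through the cone replaces the usual cancellation in a
  double sum: the second component of the square is \<open>dif (dif b)\<close>, the first is
  \<open>dif b - dif b + dif (dif a)\<close>. The module must vary, since \<open>a\<close> lives
  over \<open>shift v M\<close>.\<close>

lemma dif_dif:
  assumes "finite U" "sqf_module M" "f \<in> chains M U q"
  shows "dif U (dif U f) = 0"
  using assms
proof (induction U arbitrary: M f q rule: finite_induct)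
  case empty
  show ?case by (auto simp: fun_eq_iff dif_def)
next
  case (insert v U)
  have U: "insert v U - {v} = U" "finite (insert v U)" "v \<in> insert v U"
    using insert by auto
  obtain a b where "a \<in> chains (shift v M) (insert v U - {v}) (q - 1)"
    "b \<in> chains M (insert v U - {v}) q" and f: "f = comb v a b"
    by (rule chains_combE[OF U(2,3) insert.prems])
  then have ab: "a \<in> chains (shift v M) U (q - 1)" "b \<in> chains M U q"
    unfolding U(1) by blast+
  have supp: "\<not> T \<subseteq> U \<Longrightarrow> a T = 0" "\<not> T \<subseteq> U \<Longrightarrow> b T = 0" for T
    using chainsD(2)[OF ab(1)] chainsD(2)[OF ab(2)] by blast+
  have supp': "\<not> T \<subseteq> U \<Longrightarrow> (b - dif U a) T = 0" "\<not> T \<subseteq> U \<Longrightarrow> dif U b T = 0" for T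
    using supp by (simp_all add: dif_def)
  have "dif (insert v U) (dif (insert v U) f) = dif (insert v U) (comb v (b - dif U a) (dif U b))"
    unfolding f by (subst dif_comb[OF U(2,3), of a b, unfolded U(1), OF supp]) (assumption, rule refl)
  also have "\<dots> = comb v (dif U b - dif U (b - dif U a)) (dif U (dif U b))"
    by (rule dif_comb[OF U(2,3), of "b - dif U a" "dif U b", unfolded U(1), OF supp'])
  also have "\<dots> = comb v 0 0"
    unfolding dif_minus insert.IH[OF sqf_module_shift[OF insert.prems(1)] ab(1)]
      insert.IH[OF insert.prems(1) ab(2)] by simp
  finally show ?case unfolding comb_linear .
qed

lemma boundsI:
  assumes "g \<in> chains M U (q - 1)" "f = dif U g"
  shows "f \<in> bounds M U q"
  using assms by (auto simp: bounds_def)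

lemma exactD:
  assumes "exact M U q" "f \<in> chains M U q" "dif U f = 0"
  obtains g where "g \<in> chains M U (q - 1)" "f = dif U g"
proof -
  have "f \<in> bounds M U q"
    using assms unfolding cohom_def cycles_def by auto
  then show ?thesis
    using that unfolding bounds_def by blast
qed

lemma exactI:
  assumes "\<And>f. f \<in> chains M U q \<Longrightarrow> dif U f = 0 \<Longrightarrow> \<exists>g\<in>chains M U (q - 1). f = dif U g"
  shows "exact M U q"
  using assms unfolding cohom_def cycles_def bounds_def by auto

lemma cohomD:
  assumes "cohom M U q True"
  obtains z where "z \<in> chains M U q" "dif U z = 0" "\<And>g. g \<in> chains M U (q - 1) \<Longrightarrow> z \<noteq> dif U g"
    "\<And>f. f \<in> chains M U q \<Longrightarrow> dif U f = 0 \<Longrightarrow> \<exists>c. \<exists>g\<in>chains M U (q - 1). f - scal c z = dif U g"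
proof -
  obtain z where "z \<in> cycles M U q - bounds M U q"
    "\<forall>f\<in>cycles M U q. \<exists>c. f - scal c z \<in> bounds M U q"
    using assms unfolding cohom_def by auto
  then show ?thesis
    using that[of z] unfolding cycles_def bounds_def by blast
qed

lemma cohomI:
  assumes "z \<in> chains M U q" "dif U z = 0" "\<And>g. g \<in> chains M U (q - 1) \<Longrightarrow> z \<noteq> dif U g"
    "\<And>f. f \<in> chains M U q \<Longrightarrow> dif U f = 0 \<Longrightarrow> \<exists>c. \<exists>g\<in>chains M U (q - 1). f - scal c z = dif U g"
  shows "cohom M U q True"
proof -
  have "z \<in> cycles M U q - bounds M U q"
    using assms(1-3) unfolding cycles_def bounds_def by blast
  moreover have "\<forall>f\<in>cycles M U q. \<exists>c. f - scal c z \<in> bounds M U q"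
    using assms(4) unfolding cycles_def bounds_def by blast
  ultimately show ?thesis
    unfolding cohom_def by auto
qed

context
  fixes U :: "nat set" and v :: nat and M :: "('k::field) sqf"
  assumes U: "finite U" "v \<in> U" and M: "sqf_module M"
begin

lemmas lin = chains_linear[OF M] chains_linear[OF sqf_module_shift[OF M, of v]]

lemma chains_shift: "a \<in> chains M (U - {v}) q \<Longrightarrow> a \<in> chains (shift v M) (U - {v}) q"
proof -
  have "M T \<subseteq> shift v M T" for T
    unfolding shift_def by (rule sqf_moduleD(2)[OF M]) blast
  then show "a \<in> chains M (U - {v}) q \<Longrightarrow> a \<in> chains (shift v M) (U - {v}) q"
    using chains_mono[of "U - {v}" M "shift v M" q] by blast
qed

lemma dif_cone:
  assumes "a \<in> chains (shift v M) (U - {v}) p" "b \<in> chains M (U - {v}) q"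
  shows "dif U (comb v a b) = comb v (b - dif (U - {v}) a) (dif (U - {v}) b)"
  by (rule dif_comb[OF U chainsD(2)[OF assms(1)] chainsD(2)[OF assms(2)]])

lemma comb_eq:
  assumes "comb v a b = comb v a' b'"
    and "\<And>T. \<not> T \<subseteq> U - {v} \<Longrightarrow> a T = 0" "\<And>T. \<not> T \<subseteq> U - {v} \<Longrightarrow> a' T = 0"
    and "\<And>T. \<not> T \<subseteq> U - {v} \<Longrightarrow> b T = 0" "\<And>T. \<not> T \<subseteq> U - {v} \<Longrightarrow> b' T = 0"
  shows "a = a'" "b = b'"
proof -
  have out: "\<not> T \<subseteq> U - {v}" if "v \<in> T" for T using that by blast
  have "\<And>T. v \<in> T \<Longrightarrow> a T = 0 \<and> a' T = 0 \<and> b T = 0 \<and> b' T = 0"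
    using assms(2-5)[OF out] by blast
  then show "a = a'" "b = b'"
    using comb_inject[OF assms(1)] by blast+
qed

lemma cone_cycleE:
  assumes "f \<in> chains M U q" "dif U f = 0"
  obtains a b where "a \<in> chains (shift v M) (U - {v}) (q - 1)" "b \<in> chains M (U - {v}) q"
    "f = comb v a b" "b = dif (U - {v}) a" "dif (U - {v}) b = 0"
proof -
  obtain a b where ab: "a \<in> chains (shift v M) (U - {v}) (q - 1)" "b \<in> chains M (U - {v}) q" "f = comb v a b"
    using chains_combE[OF U M assms(1)] .
  have "comb v (b - dif (U - {v}) a) (dif (U - {v}) b) = comb v 0 0"
    using assms(2) dif_cone[OF ab(1,2)] unfolding ab(3) comb_linear(4) by (rule trans[OF sym, rotated])
  moreover have "\<not> T \<subseteq> U - {v} \<Longrightarrow> (b - dif (U - {v}) a) T = 0"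
    "\<not> T \<subseteq> U - {v} \<Longrightarrow> dif (U - {v}) b T = 0" "\<not> T \<subseteq> U - {v} \<Longrightarrow> 0 T = (0 :: nat \<Rightarrow> 'k)" for T
    using chainsD(2)[OF ab(2), of T] by (simp_all add: dif_def)
  ultimately have "b - dif (U - {v}) a = 0" "dif (U - {v}) b = 0"
    using comb_eq[of "b - dif (U - {v}) a" "dif (U - {v}) b" 0 0] by blast+
  then show ?thesis
    using that[OF ab] unfolding right_minus_eq by blast
qed

lemma cone_boundary:
  assumes "a \<in> chains (shift v M) (U - {v}) (q - 2)" "b \<in> chains M (U - {v}) (q - 1)"
  shows "\<exists>g\<in>chains M U (q - 1). comb v (b - dif (U - {v}) a) (dif (U - {v}) b) = dif U g"
proof
  show "comb v (b - dif (U - {v}) a) (dif (U - {v}) b) = dif U (comb v a b)"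
    by (rule dif_cone[OF assms, symmetric])
  show "comb v a b \<in> chains M U (q - 1)"
    using assms by (intro comb_chains[OF U M]) auto
qed

lemma cone_boundaryE:
  assumes "g \<in> chains M U (q - 1)" "comb v a b = dif U g"
    and "\<And>T. \<not> T \<subseteq> U - {v} \<Longrightarrow> a T = 0" "\<And>T. \<not> T \<subseteq> U - {v} \<Longrightarrow> b T = 0"
  obtains a' b' where "a' \<in> chains (shift v M) (U - {v}) (q - 2)" "b' \<in> chains M (U - {v}) (q - 1)"
    "a = b' - dif (U - {v}) a'" "b = dif (U - {v}) b'"
proof -
  obtain a' b' where ab: "a' \<in> chains (shift v M) (U - {v}) (q - 1 - 1)" "b' \<in> chains M (U - {v}) (q - 1)"
    "g = comb v a' b'"
    using chains_combE[OF U M assms(1)] .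
  have 1: "comb v a b = comb v (b' - dif (U - {v}) a') (dif (U - {v}) b')"
    using assms(2) dif_cone[OF ab(1,2)] unfolding ab(3) by (rule trans)
  have "\<not> T \<subseteq> U - {v} \<Longrightarrow> (b' - dif (U - {v}) a') T = 0"
    "\<not> T \<subseteq> U - {v} \<Longrightarrow> dif (U - {v}) b' T = 0" for T
    using chainsD(2)[OF ab(2), of T] by (simp_all add: dif_def)
  with 1 assms(3,4) have "a = b' - dif (U - {v}) a'" "b = dif (U - {v}) b'"
    using comb_eq[OF 1] by blast+
  then show ?thesis using that[of a' b'] ab(1,2) by simp
qed

text \<open>In terms of the simplicial complex of a graph, the complex over \<open>U - {v}\<close> belongs to the
  deletion of \<open>v\<close> and the complex of \<open>shift v M\<close> to the link of \<open>v\<close>.\<close>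

lemma exact_deletion_link:
  assumes del: "exact M (U - {v}) q" and lk: "exact (shift v M) (U - {v}) (q - 1)"
  shows "exact M U q"
proof (rule exactI)
  fix f assume "f \<in> chains M U q" "dif U f = 0"
  then obtain a b where ab: "a \<in> chains (shift v M) (U - {v}) (q - 1)" "b \<in> chains M (U - {v}) q"
    "f = comb v a b" "b = dif (U - {v}) a" "dif (U - {v}) b = 0"
    by (rule cone_cycleE)
  obtain b' where b': "b' \<in> chains M (U - {v}) (q - 1)" "b = dif (U - {v}) b'"
    using exactD[OF del ab(2,5)] .
  \<comment> \<open>Both \<open>a\<close> and \<open>b'\<close> have differential \<open>b\<close>,
    so their difference is a cycle over the link.\<close>
  have "dif (U - {v}) (a - b') = 0"
    unfolding dif_minus right_minus_eq using ab(4) b'(2) by (rule trans[OF sym])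
  then obtain g where g: "g \<in> chains (shift v M) (U - {v}) (q - 1 - 1)" "a - b' = dif (U - {v}) g"
    using exactD[OF lk, of "a - b'"] lin(10)[OF ab(1) chains_shift[OF b'(1)]] by blast
  \<comment> \<open>In the cone, the boundary of \<open>(- g, b')\<close> is
    \<open>(b' + dif g, dif b')\<close>, that is \<open>(a, b)\<close>.\<close>
  have "\<exists>h\<in>chains M U (q - 1). comb v (b' - dif (U - {v}) (- g)) (dif (U - {v}) b') = dif U h"
    using g(1) b'(1) by (intro cone_boundary lin) simp_all
  moreover have "b' - dif (U - {v}) (- g) = a"
    unfolding dif_neg g(2)[symmetric] by simp
  ultimately show "\<exists>g\<in>chains M U (q - 1). f = dif U g"
    unfolding ab(3) b'(2)[symmetric] by (simp only:)
qed

text \<open>The mapping cone of an identity map is contractible: a cycle \<open>(a, dif a)\<close>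
  is the boundary of \<open>(0, a)\<close>. For simplicial complexes the hypothesis says that the
  complex is a cone with apex \<open>v\<close>.\<close>

lemma exact_cone:
  assumes "\<And>T. T \<subseteq> U - {v} \<Longrightarrow> M (insert v T) = M T"
  shows "exact M U q"
proof (rule exactI)
  fix f assume "f \<in> chains M U q" "dif U f = 0"
  then obtain a b where ab: "a \<in> chains (shift v M) (U - {v}) (q - 1)" "b \<in> chains M (U - {v}) q"
    "f = comb v a b" "b = dif (U - {v}) a"
    by (rule cone_cycleE)
  have "a \<in> chains M (U - {v}) (q - 1)"
    using ab(1) chains_mono[of "U - {v}" "shift v M" M] assms by (auto simp: shift_def)
  then have "\<exists>h\<in>chains M U (q - 1). comb v (a - dif (U - {v}) 0) (dif (U - {v}) a) = dif U h"
    by (intro cone_boundary lin)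
  then show "\<exists>g\<in>chains M U (q - 1). f = dif U g"
    unfolding ab(3) ab(4)[symmetric] by simp
qed

text \<open>If the deletion is acyclic, the complex behaves like the suspension of the link: sending
  \<open>z\<close> to \<open>(z, 0)\<close> is an isomorphism on cohomology that raises the degree
  by one.\<close>

lemma cohom_deletion_exact:
  assumes del: "\<And>q. exact M (U - {v}) q" and lk: "cohom (shift v M) (U - {v}) (q - 1) b"
  shows "cohom M U q b"
proof (cases b)
  case False
  then show ?thesis using exact_deletion_link[OF del] lk by simp
next
  case True
  with lk have lk': "cohom (shift v M) (U - {v}) (q - 1) True" by simp
  let ?d = "dif (U - {v})"
  obtain z where z: "z \<in> chains (shift v M) (U - {v}) (q - 1)" "?d z = 0"
    "\<And>g. g \<in> chains (shift v M) (U - {v}) (q - 1 - 1) \<Longrightarrow> z \<noteq> ?d g"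
    "\<And>f. f \<in> chains (shift v M) (U - {v}) (q - 1) \<Longrightarrow> ?d f = 0 \<Longrightarrow>
       \<exists>c. \<exists>g\<in>chains (shift v M) (U - {v}) (q - 1 - 1). f - scal c z = ?d g"
    by (rule cohomD[OF lk']) blast
  have "cohom M U q True"
  proof (rule cohomI)
    show "comb v z 0 \<in> chains M U q"
      using z(1) by (intro comb_chains[OF U M] lin)
    have "dif U (comb v z 0) = comb v (0 - ?d z) (?d 0)"
      using z(1) lin(1) by (rule dif_cone)
    then show "dif U (comb v z 0) = 0"
      unfolding z(2) dif_zero diff_zero comb_linear(4) .
  next
    fix g assume g: "g \<in> chains M U (q - 1)"
    show "comb v z 0 \<noteq> dif U g"
    proof
      assume eq: "comb v z 0 = dif U g"
      obtain a' b' where ab: "a' \<in> chains (shift v M) (U - {v}) (q - 2)" "b' \<in> chains M (U - {v}) (q - 1)"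
        "z = b' - ?d a'" "0 = ?d b'"
        by (rule cone_boundaryE[OF g eq chainsD(2)[OF z(1)]]) auto
      \<comment> \<open>The component \<open>b'\<close> is a boundary over the acyclic deletion;
        absorbing it would make \<open>z\<close> a boundary over the link.\<close>
      obtain e where e: "e \<in> chains M (U - {v}) (q - 1 - 1)" "b' = ?d e"
        using exactD[OF del ab(2) ab(4)[symmetric]] .
      have "z = ?d (e - a')"
        unfolding dif_minus e(2)[symmetric] by (rule ab(3))
      then show False
        using z(3)[of "e - a'"] lin(10)[OF chains_shift[OF e(1)], of a'] ab(1) by simp
    qed
  next
    fix f assume "f \<in> chains M U q" "dif U f = 0"
    then obtain a b where ab: "a \<in> chains (shift v M) (U - {v}) (q - 1)" "b \<in> chains M (U - {v}) q"
      "f = comb v a b" "b = ?d a" "?d b = 0"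
      by (rule cone_cycleE)
    obtain e where e: "e \<in> chains M (U - {v}) (q - 1)" "b = ?d e"
      using exactD[OF del ab(2,5)] .
    have "?d (a - e) = 0"
      unfolding dif_minus right_minus_eq using ab(4) e(2) by (rule trans[OF sym])
    then obtain c g where g: "g \<in> chains (shift v M) (U - {v}) (q - 1 - 1)" "a - e - scal c z = ?d g"
      using z(4)[of "a - e"] lin(10)[OF ab(1) chains_shift[OF e(1)]] by blast
    have "\<exists>h\<in>chains M U (q - 1). comb v (e - ?d (- g)) (?d e) = dif U h"
      using g(1) e(1) by (intro cone_boundary lin) simp_all
    moreover have "f - scal c (comb v z 0) = comb v (a - scal c z) b"
      unfolding ab(3) comb_linear by (simp add: scal_def fun_eq_iff comb_def)
    moreover have "e - ?d (- g) = a - scal c z"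
      unfolding dif_neg g(2)[symmetric] by simp
    ultimately have "\<exists>h\<in>chains M U (q - 1). f - scal c (comb v z 0) = dif U h"
      unfolding e(2)[symmetric] by (simp only:)
    then show "\<exists>c. \<exists>g\<in>chains M U (q - 1). f - scal c (comb v z 0) = dif U g" by blast
  qed
  then show ?thesis using True by simp
qed

text \<open>If the link is acyclic, restriction to the deletion is an isomorphism on cohomology: a
  cycle \<open>z\<close> of the deletion bounds some \<open>y\<close> over the link and extends to
  the cycle \<open>(y, z)\<close>.\<close>

lemma cohom_link_exact:
  assumes lk: "\<And>q. exact (shift v M) (U - {v}) q" and del: "cohom M (U - {v}) q b"
  shows "cohom M U q b"
proof (cases b)
  case False
  then show ?thesis using exact_deletion_link[OF _ lk] del by simp
next
  case True
  with del have del': "cohom M (U - {v}) q True" by simp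
  let ?d = "dif (U - {v})"
  obtain z where z: "z \<in> chains M (U - {v}) q" "?d z = 0"
    "\<And>g. g \<in> chains M (U - {v}) (q - 1) \<Longrightarrow> z \<noteq> ?d g"
    "\<And>f. f \<in> chains M (U - {v}) q \<Longrightarrow> ?d f = 0 \<Longrightarrow> \<exists>c. \<exists>g\<in>chains M (U - {v}) (q - 1). f - scal c z = ?d g"
    by (rule cohomD[OF del']) blast
  obtain y where y: "y \<in> chains (shift v M) (U - {v}) (q - 1)" "z = ?d y"
    using exactD[OF lk chains_shift[OF z(1)] z(2)] .
  have "cohom M U q True"
  proof (rule cohomI)
    show "comb v y z \<in> chains M U q"
      using z(1) y(1) by (intro comb_chains[OF U M])
    have "dif U (comb v y z) = comb v (z - ?d y) (?d z)"
      using y(1) z(1) by (rule dif_cone)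
    then show "dif U (comb v y z) = 0"
      unfolding z(2) y(2)[symmetric] diff_self comb_linear(4) .
  next
    fix g assume g: "g \<in> chains M U (q - 1)"
    show "comb v y z \<noteq> dif U g"
    proof
      assume eq: "comb v y z = dif U g"
      obtain a' b' where "b' \<in> chains M (U - {v}) (q - 1)" "z = ?d b'"
        by (rule cone_boundaryE[OF g eq chainsD(2)[OF y(1)] chainsD(2)[OF z(1)]])
      then show False using z(3) by blast
    qed
  next
    fix f assume "f \<in> chains M U q" "dif U f = 0"
    then obtain a b where ab: "a \<in> chains (shift v M) (U - {v}) (q - 1)" "b \<in> chains M (U - {v}) q"
      "f = comb v a b" "b = ?d a" "?d b = 0"
      by (rule cone_cycleE)
    obtain c e where e: "e \<in> chains M (U - {v}) (q - 1)" "b - scal c z = ?d e"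
      using z(4)[OF ab(2,5)] by blast
    have "?d (a - scal c y - e) = 0"
      unfolding dif_minus dif_scal ab(4)[symmetric] y(2)[symmetric] e(2)[symmetric] by (rule diff_self)
    moreover have "a - scal c y - e \<in> chains (shift v M) (U - {v}) (q - 1)"
      using ab(1) y(1) chains_shift[OF e(1)] by (intro lin)
    ultimately obtain g where g: "g \<in> chains (shift v M) (U - {v}) (q - 1 - 1)" "a - scal c y - e = ?d g"
      using exactD[OF lk] by blast
    have "\<exists>h\<in>chains M U (q - 1). comb v (e - ?d (- g)) (?d e) = dif U h"
      using g(1) e(1) by (intro cone_boundary lin) simp_all
    moreover have "e - ?d (- g) = a - scal c y"
      unfolding dif_neg g(2)[symmetric] by simp
    ultimately have "\<exists>h\<in>chains M U (q - 1). f - scal c (comb v y z) = dif U h"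
      unfolding ab(3) comb_linear e(2)[symmetric] by (simp only:)
    then show "\<exists>c. \<exists>g\<in>chains M U (q - 1). f - scal c (comb v y z) = dif U g" by blast
  qed
  then show ?thesis using True by simp
qed

end

section \<open>Unions of chain graphs\<close>

definition up_closed :: "nat set set \<Rightarrow> bool" where
  "up_closed N \<longleftrightarrow> (\<forall>T\<in>N. \<forall>T'. T \<subseteq> T' \<longrightarrow> T' \<in> N)"

text \<open>The squarefree monomial ideal spanned by the monomials with support in \<open>N\<close>, as a submodule of
  the free module of rank one with basis element \<open>0\<close>.\<close>

definition nonfaces :: "nat set set \<Rightarrow> ('k::field) sqf" where
  "nonfaces N T = {u. \<forall>s. u s \<noteq> 0 \<longrightarrow> s = 0 \<and> T \<in> N}"

lemma nonfaces_outside: "T \<notin> N \<Longrightarrow> u \<in> nonfaces N T \<Longrightarrow> u = 0"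
  by (auto simp: nonfaces_def fun_eq_iff)

lemma sqf_module_nonfaces:
  assumes "up_closed N"
  shows "sqf_module (nonfaces N)"
proof -
  have "subspace (nonfaces N T :: (nat \<Rightarrow> 'k::field) set)" for T
  proof (cases "T \<in> N")
    case True
    then have "nonfaces N T = {u :: nat \<Rightarrow> 'k. \<forall>s. s \<noteq> 0 \<longrightarrow> u s = 0}"
      by (auto simp: nonfaces_def)
    then show ?thesis by (simp add: subspace_def)
  next
    case False
    then have "nonfaces N T = {0 :: nat \<Rightarrow> 'k}"
      by (auto simp: nonfaces_def fun_eq_iff)
    then show ?thesis by (simp add: subspace_def)
  qed
  then show ?thesis
    using assms unfolding sqf_module_def up_closed_def nonfaces_def by blast
qed

lemma shift_nonfaces: "shift v (nonfaces N) = nonfaces {T. insert v T \<in> N}"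
  by (auto simp: shift_def nonfaces_def)

lemma up_closed_insert: "up_closed N \<Longrightarrow> up_closed {T. insert v T \<in> N}"
  unfolding up_closed_def by (metis insert_mono mem_Collect_eq)

lemma nonfaces_cong:
  "(T \<in> N \<longleftrightarrow> T' \<in> N') \<Longrightarrow> nonfaces N T = nonfaces N' T'"
  by (simp add: nonfaces_def)

section \<open>Elementary acyclic complexes, loops, and the boundary of a simplex\<close>

lemma exact_large:
  assumes "finite U" "int (card U) < q" "sqf_module M"
  shows "exact M U q"
proof (rule exactI)
  fix f assume f: "f \<in> chains M U q"
  have "f T = 0" for T
  proof (cases "T \<subseteq> U")
    case True
    then have "card T \<le> card U" using assms(1) card_mono by blast
    then show ?thesis using assms(2) by (intro chainsD(3)[OF f]) auto
  next
    case False
    then show ?thesis by (rule chainsD(2)[OF f])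
  qed
  then have "f = dif U 0" by (auto simp: fun_eq_iff)
  then show "\<exists>g\<in>chains M U (q - 1). f = dif U g"
    using chains_linear(1)[OF assms(3)] by blast
qed

lemma exact_nonfaces_empty:
  assumes "up_closed N" "\<And>T. T \<subseteq> U \<Longrightarrow> T \<notin> N"
  shows "exact (nonfaces N :: ('k::field) sqf) U q"
proof (rule exactI)
  fix f :: "nat set \<Rightarrow> nat \<Rightarrow> 'k" assume f: "f \<in> chains (nonfaces N) U q"
  have "f T = 0" for T
    using chainsD(1,2)[OF f, of T] chainsD(3)[OF f, of T] nonfaces_outside[OF assms(2)] by blast
  then have "f = dif U 0" by (auto simp: fun_eq_iff)
  then show "\<exists>g\<in>chains (nonfaces N) U (q - 1). f = dif U g"
    using chains_linear(1)[OF sqf_module_nonfaces[OF assms(1)]] by blast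
qed

text \<open>This is the Koszul complex of the whole ring, which any vertex contracts. For
  \<open>U = {}\<close> it would have cohomology in degree 0.\<close>

lemma exact_nonfaces_full:
  assumes "up_closed N" "finite U" "U \<noteq> {}" "\<And>T. T \<subseteq> U \<Longrightarrow> T \<in> N"
  shows "exact (nonfaces N) U q"
proof -
  obtain v where v: "v \<in> U" using assms(3) by blast
  show ?thesis
  proof (rule exact_cone[OF assms(2) v sqf_module_nonfaces[OF assms(1)]])
    fix T assume "T \<subseteq> U - {v}"
    then have "T \<subseteq> U" "insert v T \<subseteq> U" using v by blast+
    then show "nonfaces N (insert v T) = nonfaces N T"
      using assms(4) by (intro nonfaces_cong) blast
  qed
qed

text \<open>A vertex with a loop lies in no face, so every set is a nonface of its link, and that
  link is acyclic as long as another vertex remains. The loops can thus be deleted one at a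
  time.\<close>

lemma cohom_nonfaces_loops:
  fixes N :: "nat set set"
  defines "M \<equiv> (nonfaces N :: ('k::field) sqf)"
  assumes "finite X" "up_closed N" "finite U" "U - X \<noteq> {}"
    and "\<And>T. T \<subseteq> U \<Longrightarrow> T \<inter> X \<noteq> {} \<Longrightarrow> T \<in> N"
    and "cohom M (U - X) q b"
  shows "cohom M U q b"
  using assms(2-)
proof (induction X arbitrary: U rule: finite_induct)
  case empty
  then show ?case by simp
next
  case (insert x X)
  have eq: "U - insert x X = (U - {x}) - X" by blast
  have del: "cohom M (U - {x}) q b"
  proof (rule insert.IH)
    show "cohom M (U - {x} - X) q b" "U - {x} - X \<noteq> {}"
      using insert.prems(3,5) unfolding eq by blast+
    show "\<And>T. T \<subseteq> U - {x} \<Longrightarrow> T \<inter> X \<noteq> {} \<Longrightarrow> T \<in> N"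
      using insert.prems(4) by blast
  qed (use insert.prems(1,2) in auto)
  show ?case
  proof (cases "x \<in> U")
    case True
    have "exact (nonfaces {T. insert x T \<in> N} :: 'k sqf) (U - {x}) q" for q
    proof (rule exact_nonfaces_full[OF up_closed_insert[OF insert.prems(1)]])
      show "finite (U - {x})" "U - {x} \<noteq> {}" using insert.prems(2,3) by auto
      fix T assume "T \<subseteq> U - {x}"
      then show "T \<in> {T. insert x T \<in> N}"
        using insert.prems(4)[of "insert x T"] True by blast
    qed
    then show ?thesis
      using cohom_link_exact[OF insert.prems(2) True sqf_module_nonfaces[OF insert.prems(1)] _ del[unfolded M_def]]
      unfolding M_def shift_nonfaces by blast
  next
    case False
    then show ?thesis using del by simp
  qed
qed

text \<open>The faces form the boundary of the simplex \<open>P\<close>, and \<open>P\<close> itself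
  is the only nonface in it. Its indicator \<open>z\<close> spans the whole complex.\<close>

lemma cohom_nonfaces_minimal:
  assumes "finite P" "up_closed N" "P \<in> N" "\<And>T. T \<subset> P \<Longrightarrow> T \<notin> N"
  shows "cohom (nonfaces N :: ('k::field) sqf) P (int (card P)) True"
proof -
  define z :: "nat set \<Rightarrow> nat \<Rightarrow> 'k" where "z = (\<lambda>T s. if T = P \<and> s = 0 then 1 else 0)"
  have z_out: "z T = 0" if "T \<noteq> P" for T
    using that by (simp add: z_def fun_eq_iff)
  have z_P: "z P \<in> nonfaces N P"
    using assms(3) by (simp add: nonfaces_def z_def)
  have top: "T = P" if "T \<subseteq> P" "int (card T) = int (card P)" for T
    using that assms(1) card_subset_eq by auto
  have vanish: "f T = 0" if f: "f \<in> chains (nonfaces N) P q" and "T \<noteq> P"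
    for f :: "nat set \<Rightarrow> nat \<Rightarrow> 'k" and T q
  proof (cases "T \<subseteq> P \<and> int (card T) = q")
    case True
    then have "f T \<in> nonfaces N T" using chainsD(1)[OF f] by blast
    moreover have "T \<notin> N" using True that(2) assms(4)[of T] by blast
    ultimately show ?thesis by (intro nonfaces_outside)
  next
    case False
    then show ?thesis using chainsD(2,3)[OF f, of T] by blast
  qed
  show ?thesis
  proof (rule cohomI)
    have "if T \<subseteq> P \<and> int (card T) = int (card P) then z T \<in> nonfaces N T else z T = 0" for T
      using z_out[of T] z_P top[of T] by (cases "T = P") auto
    then show "z \<in> chains (nonfaces N) P (int (card P))"
      unfolding chains_def by blast
    show "dif P z = 0"
    proof
      fix T
      have "z (T - {x}) = 0" if "T \<subseteq> P" "x \<in> T" for x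
        by (rule z_out) (use that in blast)
      then show "dif P z T = 0 T" by (simp add: dif_def)
    qed
  next
    fix g :: "nat set \<Rightarrow> nat \<Rightarrow> 'k" assume g: "g \<in> chains (nonfaces N) P (int (card P) - 1)"
    have "g (P - {x}) = 0" if "x \<in> P" for x
      by (rule vanish[OF g]) (use that in blast)
    then have "dif P g P = 0" by (simp add: dif_def)
    then have "dif P g P 0 = 0" by simp
    moreover have "z P 0 = 1" by (simp add: z_def)
    ultimately show "z \<noteq> dif P g" by force
  next
    fix f :: "nat set \<Rightarrow> nat \<Rightarrow> 'k" assume f: "f \<in> chains (nonfaces N) P (int (card P))"
    have "(f - scal (f P 0) z) T s = dif P 0 T s" for T s
    proof (cases "T = P")
      case True
      have "f P \<in> nonfaces N P" using chainsD(1)[OF f] by blast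
      then have "f P s = 0" if "s \<noteq> 0" using that by (auto simp: nonfaces_def)
      then show ?thesis unfolding True by (auto simp: z_def)
    next
      case False
      show ?thesis using vanish[OF f False] z_out[OF False] by simp
    qed
    then have "f - scal (f P 0) z = dif P 0" by blast
    then show "\<exists>c. \<exists>g\<in>chains (nonfaces N) P (int (card P) - 1). f - scal c z = dif P g"
      using chains_linear(1)[OF sqf_module_nonfaces[OF assms(2)]] by blast
  qed
qed

text \<open>The loops \<open>L\<close> are needed because the neighbours of \<open>v\<close> become loops in the link of \<open>v\<close>.\<close>

definition clutter :: "('r \<Rightarrow> nat \<Rightarrow> nat \<Rightarrow> bool) \<Rightarrow> nat set \<Rightarrow> 'r set \<Rightarrow> nat set set" where
  "clutter E L R = {T. T \<inter> L \<noteq> {} \<or> (\<exists>r\<in>R. \<exists>x\<in>T. \<exists>y\<in>T. E r x y)}"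

lemma up_closed_clutter: "up_closed (clutter E L R)"
  unfolding up_closed_def clutter_def by blast

text \<open>By \<open>chain\<close>, the neighbourhoods of the upper ends of a class grow with
  \<open>pos\<close>. The difference \<open>q - card R\<close> never drops in the induction: a
  deletion keeps both numbers, and a link lowers \<open>q\<close> by one while using up a class. The
  offset 2 is due to the loops, as a nonempty set consisting only of loops has cohomology in degree
  1.\<close>

lemma exact_union_of_chain_graphs:
  fixes pos :: "nat \<Rightarrow> nat" and q :: int
  assumes chain: "\<And>r x y x' y'. E r x y \<Longrightarrow> E r x' y' \<Longrightarrow> pos y \<le> pos y' \<Longrightarrow> E r x y'"
    and irrefl: "\<And>r x. \<not> E r x x"
    and "finite U" "finite R" "q \<ge> int (card R) + 2"
  shows "exact (nonfaces (clutter E L R) :: ('k::field) sqf) U q"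
  using assms(3-5)
proof (induction U arbitrary: L R q rule: finite_psubset_induct)
  case (psubset U)
  let ?N = "clutter E L R"
  note mod = sqf_module_nonfaces[OF up_closed_clutter[of E L R]]
  consider "L \<inter> U \<noteq> {}" | "L \<inter> U = {}" "\<exists>r\<in>R. \<exists>x\<in>U. \<exists>y\<in>U. E r x y"
    | "L \<inter> U = {}" "\<not> (\<exists>r\<in>R. \<exists>x\<in>U. \<exists>y\<in>U. E r x y)"
    by blast
  then show ?case
  proof cases
    case 1
    then obtain u where u: "u \<in> U" "u \<in> L" by blast
    have "exact (nonfaces ?N :: 'k sqf) (U - {u}) q"
      using u psubset.prems by (intro psubset.IH) auto
    moreover have "exact (shift u (nonfaces ?N :: 'k sqf)) (U - {u}) (q - 1)"
    proof (cases "U - {u} = {}")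
      case True
      \<comment> \<open>Here \<open>U = {u}\<close>, and \<open>q - 1 \<ge> 1\<close> lies above the
        top degree 0 of the empty set.\<close>
      show ?thesis
        unfolding True using psubset.prems by (intro exact_large sqf_module_shift mod) auto
    next
      case False
      show ?thesis
        unfolding shift_nonfaces
        using u False psubset.hyps
        by (intro exact_nonfaces_full up_closed_insert up_closed_clutter) (auto simp: clutter_def)
    qed
    ultimately show ?thesis
      by (rule exact_deletion_link[OF psubset.hyps u(1) mod])
  next
    case 2
    then obtain r x\<^sub>1 y\<^sub>1 where r: "r \<in> R" "x\<^sub>1 \<in> U" "y\<^sub>1 \<in> U" "E r x\<^sub>1 y\<^sub>1" by blast
    \<comment> \<open>The upper end \<open>v\<close> of maximal position is adjacent to all lower ends in class \<open>r\<close>, so in the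
      link of \<open>v\<close> the loops make the whole class \<open>r\<close> redundant.\<close>
    define Y where "Y = {y \<in> U. \<exists>x\<in>U. E r x y}"
    have "finite Y" "Y \<noteq> {}" using r psubset.hyps by (auto simp: Y_def)
    then obtain v where v: "v \<in> Y" "Max (pos ` Y) = pos v"
      using Max_in[of "pos ` Y"] by blast
    then have max: "pos y \<le> pos v" if "y \<in> Y" for y
      using Max_ge[of "pos ` Y" "pos y"] \<open>finite Y\<close> that by auto
    then obtain x0 where x0: "x0 \<in> U" "E r x0 v" and vU: "v \<in> U" using v by (auto simp: Y_def)
    define L' where "L' = L \<union> {x. \<exists>r\<in>R. E r x v \<or> E r v x}"
    have "exact (nonfaces ?N :: 'k sqf) (U - {v}) q"
      using vU psubset.prems by (intro psubset.IH) auto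
    moreover have "exact (shift v (nonfaces ?N :: 'k sqf)) (U - {v}) (q - 1)"
    proof -
      have "card R > 0" using r psubset.prems(1) by (auto simp: card_gt_0_iff)
      then have "int (card (R - {r})) + 2 \<le> q - 1"
        using r psubset.prems by (simp add: card_Diff_singleton)
      then have "exact (nonfaces (clutter E L' (R - {r})) :: 'k sqf) (U - {v}) (q - 1)"
        using vU psubset.prems by (intro psubset.IH) auto
      moreover
      have agree: "T \<in> {T. insert v T \<in> ?N} \<longleftrightarrow> T \<in> clutter E L' (R - {r})" if T: "T \<subseteq> U - {v}" for T
      proof
        assume "T \<in> {T. insert v T \<in> ?N}"
        then obtain r' x y where xy: "r' \<in> R" "x \<in> insert v T" "y \<in> insert v T" "E r' x y"
          using 2(1) T vU unfolding clutter_def by blast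
        show "T \<in> clutter E L' (R - {r})"
        proof (cases "x = v \<or> y = v")
          case True
          then show ?thesis using xy irrefl unfolding clutter_def L'_def by blast
        next
          case False
          then have in_T: "x \<in> T" "y \<in> T" using xy by blast+
          show ?thesis
          proof (cases "r' = r")
            case True
            then have "y \<in> Y" using in_T xy T by (auto simp: Y_def)
            then have "E r x v" using chain[of r x y x0 v] xy(4) True x0 max by blast
            then show ?thesis using in_T r(1) unfolding clutter_def L'_def by blast
          next
            case False
            then show ?thesis using in_T xy unfolding clutter_def by blast
          qed
        qed
      next
        assume "T \<in> clutter E L' (R - {r})"
        then show "T \<in> {T. insert v T \<in> ?N}"
          unfolding clutter_def L'_def by blast
      qed
      have "cohom (nonfaces {T. insert v T \<in> ?N} :: 'k sqf) (U - {v}) (q - 1) False =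
          cohom (nonfaces (clutter E L' (R - {r})) :: 'k sqf) (U - {v}) (q - 1) False"
        by (intro cohom_cong nonfaces_cong agree)
      ultimately show ?thesis
        unfolding shift_nonfaces by blast
    qed
    ultimately show ?thesis
      by (rule exact_deletion_link[OF psubset.hyps vU mod])
  next
    case 3
    show ?thesis
    proof (rule exact_nonfaces_empty[OF up_closed_clutter])
      fix T assume "T \<subseteq> U"
      then show "T \<notin> ?N" using 3 unfolding clutter_def by blast
    qed
  qed
qed

section \<open>The graph \<open>GA(t,k)'\<close>\<close>

text \<open>Adjacency oriented from the smaller to the larger vertex and without reduction modulo n.
  As the connection set is closed under negation, this captures all edges
  (\<open>GA'_edges_iff\<close>).\<close>

definition adj :: "nat \<Rightarrow> nat \<Rightarrow> nat \<Rightarrow> nat \<Rightarrow> bool" where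
  "adj t k a b \<longleftrightarrow> (\<exists>j\<in>{1..k - 2}. b = a + 1 + j * t)"

definition dependent_sets :: "nat \<Rightarrow> nat \<Rightarrow> nat set set" where
  "dependent_sets t k = {T. \<exists>a\<in>T. \<exists>b\<in>T. adj t k a b}"

lemma up_closed_dependent_sets: "up_closed (dependent_sets t k)"
  unfolding up_closed_def dependent_sets_def by blast

lemma dependent_setsI: "a \<in> T \<Longrightarrow> b \<in> T \<Longrightarrow> adj t k a b \<Longrightarrow> T \<in> dependent_sets t k"
  unfolding dependent_sets_def by blast

lemma dependent_setsE:
  assumes "T \<in> dependent_sets t k"
  obtains a b where "a \<in> T" "b \<in> T" "adj t k a b"
  using assms unfolding dependent_sets_def by blast

lemma dependent_sets_insert_iff:
  assumes "\<And>b. b \<in> insert v T \<Longrightarrow> \<not> adj t k v b" "\<And>a. a \<in> insert v T \<Longrightarrow> \<not> adj t k a v"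
  shows "insert v T \<in> dependent_sets t k \<longleftrightarrow> T \<in> dependent_sets t k"
proof
  assume "insert v T \<in> dependent_sets t k"
  then obtain a b where ab: "a \<in> insert v T" "b \<in> insert v T" "adj t k a b"
    by (rule dependent_setsE)
  then have "a \<noteq> v" "b \<noteq> v" using assms by blast+
  then show "T \<in> dependent_sets t k" using ab by (intro dependent_setsI[of a T b]) auto
next
  show "T \<in> dependent_sets t k \<Longrightarrow> insert v T \<in> dependent_sets t k"
    by (erule dependent_setsE) (auto intro: dependent_setsI)
qed

text \<open>The two excluded members of the progression are \<open>D = 1\<close>, ruled out on the
  right, and \<open>D = 1 + (k - 1) * t = n - 1\<close>, ruled out by the bound on \<open>D\<close>.
  They are the edges removed from the Andrasfai graph.\<close>

lemma adj_iff_mod: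
  fixes t k a D :: nat
  assumes "0 < D" "D \<le> t * (k - 1)" "t \<ge> 1" "k \<ge> 3"
  shows "adj t k a (a + D) \<longleftrightarrow> 1 < D \<and> t dvd D - 1"
proof
  assume "adj t k a (a + D)"
  then obtain j where "j \<ge> 1" "D = 1 + j * t" unfolding adj_def by auto
  then show "1 < D \<and> t dvd D - 1" using assms(3) by simp
next
  assume D: "1 < D \<and> t dvd D - 1"
  then obtain j where j: "D - 1 = t * j" unfolding dvd_def by blast
  then have "j \<ge> 1" using D by (cases j) auto
  moreover have "t * j < t * (k - 1)" using assms(2) D j by linarith
  then have "j \<le> k - 2" using assms(3) by simp
  ultimately show "adj t k a (a + D)"
    unfolding adj_def using j D by (intro bexI[of _ j]) (auto simp: mult.commute)
qed

text \<open>If a vertex \<open>w\<close> is missing, the cyclic order becomes linear with positions \<open>pos n w\<close>, and the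
  graph is the union of \<open>t\<close> chain graphs: the neighbourhoods in the class \<open>r + 1\<close> mod \<open>t\<close> of the
  vertices at positions \<open>r\<close> mod \<open>t\<close> are nested.\<close>

definition pos :: "nat \<Rightarrow> nat \<Rightarrow> nat \<Rightarrow> nat" where
  "pos n w x = (if w < x then x - w - 1 else x + n - w - 1)"

text \<open>The lower end \<open>x\<close> has class \<open>r\<close>, and the strict inequality
  with \<open>+ 1\<close> keeps out consecutive positions.\<close>

definition chain_edge :: "nat \<Rightarrow> nat \<Rightarrow> nat \<Rightarrow> nat \<Rightarrow> nat \<Rightarrow> nat \<Rightarrow> bool" where
  "chain_edge t n w r x y \<longleftrightarrow> pos n w x mod t = r \<and> pos n w x + 1 < pos n w y \<and>
     (pos n w x + 1) mod t = pos n w y mod t"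

lemma ex_chain_edge:
  assumes "t \<ge> 1" "k \<ge> 3" "pos n w x \<le> pos n w y" "pos n w y - pos n w x \<le> t * (k - 1)"
  shows "(\<exists>r\<in>{..<t}. chain_edge t n w r x y) \<longleftrightarrow> adj t k 0 (pos n w y - pos n w x)"
proof (cases "pos n w x = pos n w y")
  case True
  then show ?thesis by (auto simp: chain_edge_def adj_def)
next
  case False
  define p D where "p = pos n w x" and "D = pos n w y - pos n w x"
  have D: "pos n w y = p + D" "0 < D" "D \<le> t * (k - 1)"
    using False assms(3,4) by (auto simp: p_def D_def)
  have "(\<exists>r\<in>{..<t}. chain_edge t n w r x y) \<longleftrightarrow> p + 1 < p + D \<and> (p + 1) mod t = (p + D) mod t"
    unfolding chain_edge_def D(1) p_def[symmetric] using assms(1) by auto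
  also have "\<dots> \<longleftrightarrow> 1 < D \<and> t dvd D - 1"
  proof -
    have "(p + D) mod t = (p + 1) mod t \<longleftrightarrow> t dvd (p + D) - (p + 1)"
      by (rule mod_eq_dvd_iff_nat) (use D(2) in simp)
    moreover have "(p + D) - (p + 1) = D - 1" by simp
    ultimately show ?thesis by auto
  qed
  also have "\<dots> \<longleftrightarrow> adj t k 0 D"
    using adj_iff_mod[OF D(2,3) assms(1,2), of 0] by simp
  finally show ?thesis unfolding D_def .
qed

lemma mult_split: "j \<le> m \<Longrightarrow> m * t = j * t + (m - j) * t" for j m t :: nat
  by (metis add_mult_distrib le_add_diff_inverse)

text \<open>Negation modulo \<open>n\<close> acts on the connection set by exchanging
  \<open>j\<close> and \<open>k - 1 - j\<close>.\<close>

lemma adj_complement: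
  assumes "n = t * (k - 1) + 2" "k \<ge> 3" "D \<le> n"
  shows "adj t k 0 (n - D) \<longleftrightarrow> adj t k 0 D"
proof -
  have "adj t k 0 (n - D)" if adj: "adj t k 0 D" for D
  proof -
    obtain j where j: "1 \<le> j" "j \<le> k - 2" "D = 1 + j * t"
      using adj by (auto simp: adj_def)
    have "t * (k - 1) = j * t + (k - 1 - j) * t"
      using mult_split[of j "k - 1" t] j(2) assms(2) by (simp add: mult.commute)
    then have "n - D = 0 + 1 + (k - 1 - j) * t"
      using assms(1) j(3) by simp
    then show ?thesis
      unfolding adj_def using j(1,2) assms(2) by (intro bexI[of _ "k - 1 - j"]) auto
  qed
  from this[of D] this[of "n - D"] show ?thesis
    using assms(3) by auto
qed

lemma adj_shift: "a \<le> b \<Longrightarrow> adj t k a b \<longleftrightarrow> adj t k 0 (b - a)"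
  unfolding adj_def by (intro bex_cong) auto

lemma adj_less: "adj t k a b \<Longrightarrow> a < b"
  unfolding adj_def by auto

text \<open>If the cut \<open>w\<close> lies between \<open>a\<close> and \<open>b\<close>, their
  order is reversed and the distance becomes \<open>n - (b - a)\<close>, which
  \<open>adj_complement\<close> repairs; otherwise the distance is unchanged. There are only
  \<open>n - 1\<close> positions, so distances stay within the bound
  \<open>t * (k - 1) = n - 2\<close>.\<close>

lemma adj_iff_chain_edge:
  assumes n: "n = t * (k - 1) + 2" and tk: "t \<ge> 1" "k \<ge> 3"
    and ab: "a < b" "b < n" "w < n" "a \<noteq> w" "b \<noteq> w"
  shows "adj t k a b \<longleftrightarrow> (\<exists>r\<in>{..<t}. chain_edge t n w r a b \<or> chain_edge t n w r b a)"
proof (cases "a < w \<and> w < b")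
  case True
  then have "pos n w b \<le> pos n w a" "pos n w a - pos n w b = n - (b - a)"
    "pos n w a - pos n w b \<le> t * (k - 1)"
    using ab n by (auto simp: pos_def)
  then have "(\<exists>r\<in>{..<t}. chain_edge t n w r b a) \<longleftrightarrow> adj t k 0 (b - a)"
    using ex_chain_edge[OF tk, of n w b a] adj_complement[OF n tk(2), of "b - a"] ab by simp
  moreover have "\<not> chain_edge t n w r a b" for r
    using \<open>pos n w b \<le> pos n w a\<close> by (auto simp: chain_edge_def)
  ultimately show ?thesis using adj_shift[of a b] ab by auto
next
  case False
  then have "pos n w a \<le> pos n w b" "pos n w b - pos n w a = b - a"
    "pos n w b - pos n w a \<le> t * (k - 1)"
    using ab n by (auto simp: pos_def)
  then have "(\<exists>r\<in>{..<t}. chain_edge t n w r a b) \<longleftrightarrow> adj t k 0 (b - a)"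
    using ex_chain_edge[OF tk, of n w a b] by simp
  moreover have "\<not> chain_edge t n w r b a" for r
    using \<open>pos n w a \<le> pos n w b\<close> by (auto simp: chain_edge_def)
  ultimately show ?thesis using adj_shift[of a b] ab by auto
qed

lemma exact_proper_subset:
  assumes n: "n = t * (k - 1) + 2" and tk: "t \<ge> 1" "k \<ge> 3"
    and U: "U \<subseteq> {0..<n}" "U \<noteq> {0..<n}" and q: "q \<ge> int t + 2"
  shows "exact (nonfaces (dependent_sets t k) :: ('k::field) sqf) U q"
proof -
  have "\<exists>w\<in>{0..<n}. w \<notin> U" using U by blast
  then obtain w where w: "w < n" "w \<notin> U" by auto
  let ?N = "clutter (chain_edge t n w) {} {..<t}"
  have "exact (nonfaces ?N :: 'k sqf) U q"
  proof (rule exact_union_of_chain_graphs[where pos = "pos n w"])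
    show "finite U" using U finite_subset by blast
    show "int (card {..<t}) + 2 \<le> q" using q by simp
    show "chain_edge t n w r x y'"
      if "chain_edge t n w r x y" "chain_edge t n w r x' y'" "pos n w y \<le> pos n w y'" for r x y x' y'
    proof -
      \<comment> \<open>Since \<open>x\<close> and \<open>x'\<close> are both in class
        \<open>r\<close>, the vertex \<open>y'\<close> has the right residue for \<open>x\<close>,
        and it lies no earlier than \<open>y\<close>.\<close>
      have "(pos n w x + 1) mod t = (pos n w x' + 1) mod t"
        using that(1,2) unfolding chain_edge_def by (metis mod_add_left_eq)
      then show ?thesis using that unfolding chain_edge_def by simp
    qed
  qed (auto simp: chain_edge_def)
  moreover have agree: "T \<in> dependent_sets t k \<longleftrightarrow> T \<in> ?N" if T: "T \<subseteq> U" for T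
  proof -
    have *: "adj t k a b \<longleftrightarrow> (\<exists>r\<in>{..<t}. chain_edge t n w r a b \<or> chain_edge t n w r b a)"
      if "a \<in> T" "b \<in> T" "a < b" for a b
    proof (rule adj_iff_chain_edge[OF n tk])
      show "a < b" "b < n" "w < n" "a \<noteq> w" "b \<noteq> w"
        using that T U w by auto
    qed
    show ?thesis
    proof
      assume "T \<in> dependent_sets t k"
      then obtain a b where ab: "a \<in> T" "b \<in> T" "adj t k a b"
        unfolding dependent_sets_def by blast
      then show "T \<in> ?N"
        using *[OF ab(1,2) adj_less[OF ab(3)]] unfolding clutter_def by blast
    next
      assume "T \<in> ?N"
      then obtain r a b where ab: "r \<in> {..<t}" "a \<in> T" "b \<in> T" "chain_edge t n w r a b"
        unfolding clutter_def by blast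
      then have "a \<noteq> b" by (auto simp: chain_edge_def)
      then show "T \<in> dependent_sets t k"
        using *[of a b] *[of b a] ab unfolding dependent_sets_def by (cases "a < b") auto
    qed
  qed
  moreover have "cohom (nonfaces (dependent_sets t k) :: 'k sqf) U q False =
      cohom (nonfaces ?N :: 'k sqf) U q False"
    by (intro cohom_cong nonfaces_cong agree)
  ultimately show ?thesis by blast
qed

text \<open>The case \<open>s = 0\<close> is the deletion of the vertex \<open>n - 1\<close> from
  the full vertex set. It must be acyclic in every degree, whereas
  \<open>exact_proper_subset\<close> only covers large degrees.\<close>

lemma exact_interval:
  fixes t k s :: nat
  assumes tk: "t \<ge> 1" "k \<ge> 3" and s: "s \<le> t * (k - 1)"
  shows "exact (nonfaces (dependent_sets t k) :: ('k::field) sqf) {s..t * (k - 1)} q"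
  using s
proof (induction "t * (k - 1) - s" arbitrary: s q rule: less_induct)
  case less
  let ?N = "dependent_sets t k" and ?m = "t * (k - 1)"
  let ?M = "nonfaces ?N :: 'k sqf"
  note mod = sqf_module_nonfaces[OF up_closed_dependent_sets[of t k]]
  show ?case
  proof (cases "s + t > ?m")
    case True
    show ?thesis
    proof (rule exact_nonfaces_empty[OF up_closed_dependent_sets])
      fix T assume T: "T \<subseteq> {s..?m}"
      have False if ab: "a \<in> T" "b \<in> T" "adj t k a b" for a b
      proof -
        obtain j where "1 \<le> j" "b = a + 1 + j * t" using ab(3) by (auto simp: adj_def)
        then have "b \<ge> a + 1 + t" by (cases j) auto
        moreover have "s \<le> a" "b \<le> ?m" using ab T by auto
        ultimately show False using True by linarith
      qed
      then show "T \<notin> ?N" unfolding dependent_sets_def by blast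
    qed
  next
    case False
    \<comment> \<open>All neighbours of \<open>s + t\<close> are neighbours of \<open>s\<close>, so the link of \<open>s\<close> is a cone with apex \<open>s + t\<close>.\<close>
    have s: "s \<in> {s..?m}" "{s..?m} - {s} = {Suc s..?m}" "s + t \<in> {Suc s..?m}"
      using less.prems False tk(1) by auto
    have "exact ?M {Suc s..?m} q"
      using less.hyps[of "Suc s" q] less.prems False tk(1) by auto
    moreover have "exact (shift s ?M) {Suc s..?m} (q - 1)"
    proof (rule exact_cone[OF _ s(3) sqf_module_shift[OF mod]])
      fix T assume T: "T \<subseteq> {Suc s..?m} - {s + t}"
      have "insert s T \<in> ?N" if dep: "insert s (insert (s + t) T) \<in> ?N"
      proof -
        obtain a b where ab: "a \<in> insert s (insert (s + t) T)" "b \<in> insert s (insert (s + t) T)" "adj t k a b"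
          using dep by (rule dependent_setsE)
        obtain j where j: "1 \<le> j" "j \<le> k - 2" "b = a + 1 + j * t" using ab(3) by (auto simp: adj_def)
        have jt: "j * t \<ge> t" using j(1) by (cases j) auto
        have range: "s \<le> a" "b \<le> ?m" using ab T s(3) less.prems by auto
        then have "b \<noteq> s + t" using j jt by linarith
        show ?thesis
        proof (cases "a = s + t")
          case True
          \<comment> \<open>Seen from \<open>s\<close>, the neighbour \<open>b\<close> of
            \<open>s + t\<close> is one step further along the progression; that this step is still
            allowed follows from \<open>b \<le> ?m\<close>.\<close>
          have "b = s + 1 + (j + 1) * t" using j True by simp
          moreover from this have "(j + 1) * t < (k - 1) * t"
            using range(2) by (simp add: mult.commute)
          then have "j + 1 \<le> k - 2" unfolding mult_less_cancel2 by linarith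
          ultimately have "adj t k s b"
            unfolding adj_def by (intro bexI[of _ "j + 1"]) auto
          then show ?thesis
            using ab(2) \<open>b \<noteq> s + t\<close> by (intro dependent_setsI[of s _ b]) auto
        next
          case False
          then show ?thesis
            using ab \<open>b \<noteq> s + t\<close> by (intro dependent_setsI[of a _ b]) auto
        qed
      qed
      moreover have "insert s (insert (s + t) T) \<in> ?N" if "insert s T \<in> ?N"
        using that up_closed_dependent_sets unfolding up_closed_def by (meson insert_mono subset_insertI)
      ultimately show "shift s ?M (insert (s + t) T) = shift s ?M T"
        unfolding shift_def by (intro nonfaces_cong) blast
    qed auto
    ultimately show ?thesis
      using exact_deletion_link[OF _ s(1) mod, of q] unfolding s(2) by blast
  qed
qed

text \<open>Up to loops, \<open>link_verts t k 0\<close> is the link of the vertex \<open>n - 1\<close>, and \<open>link_verts t k (Suc i)\<close> is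
  the link of \<open>i\<close> in \<open>link_verts t k i\<close>, where the deletion of \<open>i\<close> is a cone with apex \<open>i + 1 + (k - 2) t\<close>.
  The last one, \<open>i = t - 1\<close>, is a single edge, that is a 0-sphere.\<close>

definition link_verts :: "nat \<Rightarrow> nat \<Rightarrow> nat \<Rightarrow> nat set" where
  "link_verts t k i = {i, t * (k - 1)} \<union> {x. x < t * (k - 1) \<and> i < x mod t}"

text \<open>Each link lowers the degree by one, from \<open>t + 1\<close> for \<open>i = 0\<close>
  down to 2 for the single edge at \<open>i = t - 1\<close>. In other words, the complex on
  \<open>link_verts t k i\<close> is a homology sphere of dimension
  \<open>t - 1 - i\<close>.\<close>

lemma cohom_link_verts:
  fixes t k i :: nat
  assumes t: "t \<ge> 1" and k: "k \<ge> 3" and i: "i < t"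
  shows "cohom (nonfaces (dependent_sets t k) :: ('k::field) sqf) (link_verts t k i)
    (int t + 1 - int i) True"
  using i
proof (induction "t - i" arbitrary: i rule: less_induct)
  case less
  let ?N = "dependent_sets t k" and ?m = "t * (k - 1)"
  let ?M = "nonfaces ?N :: 'k sqf"
  note mod = sqf_module_nonfaces[OF up_closed_dependent_sets[of t k]]
  have m: "?m = t + (k - 2) * t" "?m \<ge> 2 * t"
  proof -
    have "k - 1 = Suc (k - 2)" using k by simp
    then show "?m = t + (k - 2) * t" by simp
    moreover have "(k - 2) * t \<ge> 1 * t" using k by (intro mult_le_mono1) simp
    ultimately show "?m \<ge> 2 * t" by simp
  qed
  show ?case
  proof (cases "Suc i = t")
    case True
    have P: "link_verts t k i = {i, ?m}"
    proof -
      have "\<not> i < x mod t" for x using mod_less_divisor[of t x] True t by linarith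
      then show ?thesis by (auto simp: link_verts_def)
    qed
    have ne: "i < ?m" using m less.prems by linarith
    have "cohom ?M {i, ?m} (int (card {i, ?m})) True"
    proof (rule cohom_nonfaces_minimal[OF _ up_closed_dependent_sets])
      have "adj t k i ?m"
        unfolding adj_def using k True m(1) by (intro bexI[of _ "k - 2"]) auto
      then show "{i, ?m} \<in> ?N" unfolding dependent_sets_def by blast
      fix T assume T: "T \<subset> {i, ?m}"
      have "\<not> adj t k a b" if "a \<in> T" "b \<in> T" for a b
      proof
        assume "adj t k a b"
        then have "a < b" by (rule adj_less)
        moreover have "a \<in> {i, ?m}" "b \<in> {i, ?m}" using that T by blast+
        ultimately have "a = i" "b = ?m" using ne by auto
        then show False using T that by blast
      qed
      then show "T \<notin> ?N" unfolding dependent_sets_def by blast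
    qed simp
    moreover have "int (card {i, ?m}) = int t + 1 - int i" using ne True by simp
    ultimately show ?thesis unfolding P by simp
  next
    case False
    then have it: "Suc i < t" using less.prems by simp
    let ?U = "link_verts t k i - {i}"
    let ?p = "i + 1 + (k - 2) * t"
    have fin: "finite (link_verts t k i)" by (simp add: link_verts_def)
    have iU: "i \<in> link_verts t k i" by (simp add: link_verts_def)
    have im: "i < ?m" using m less.prems by linarith
    have mem: "x \<in> ?U \<longleftrightarrow> x = ?m \<or> (x < ?m \<and> i < x mod t)" for x
      using im less.prems by (auto simp: link_verts_def)
    have p_mod: "?p mod t = i + 1" using it by simp
    have pU: "?p \<in> ?U" unfolding mem using p_mod m(1) it by simp
    have "exact ?M ?U q" for q
    proof (rule exact_cone[OF _ pU mod])
      fix T assume T: "T \<subseteq> ?U - {?p}"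
      \<comment> \<open>The vertex \<open>?p\<close> is isolated in \<open>?U\<close>: its upper
        neighbours would exceed \<open>?m\<close>, and its lower neighbours have residue
        \<open>i\<close>, so apart from \<open>i\<close> itself they were removed earlier.\<close>
      have no_adj: False if ab: "a \<in> insert ?p T" "b \<in> insert ?p T" "adj t k a b" and "a = ?p \<or> b = ?p" for a b
      proof -
        obtain j where j: "1 \<le> j" "j \<le> k - 2" "b = a + 1 + j * t" using ab(3) by (auto simp: adj_def)
        have jt: "j * t \<ge> t" using j(1) by (cases j) auto
        have aU: "a \<in> ?U" "b \<in> ?U" using ab pU T by auto
        have "b \<le> ?m" using aU(2) unfolding mem by linarith
        then have "a \<noteq> ?p" using j jt m(1) by linarith
        then have "b = ?p" using that(4) by blast
        have "(k - 2) * t = j * t + (k - 2 - j) * t" using j(2) by (rule mult_split)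
        then have "a = i + (k - 2 - j) * t" using j(3) \<open>b = ?p\<close> by linarith
        then have "a mod t = i" using less.prems by simp
        moreover have "a \<noteq> ?m" using \<open>b = ?p\<close> j(3) \<open>b \<le> ?m\<close> by linarith
        ultimately show False using aU(1) unfolding mem by simp
      qed
      have "insert ?p T \<in> ?N \<longleftrightarrow> T \<in> ?N"
        by (rule dependent_sets_insert_iff) (use no_adj in blast)+
      then show "?M (insert ?p T) = ?M T" by (rule nonfaces_cong)
    qed (use fin in auto)
    moreover have "cohom (shift i ?M) ?U (int t + 1 - int i - 1) True"
    proof -
      let ?N' = "{T. insert i T \<in> ?N}"
      \<comment> \<open>These are the neighbours of \<open>i\<close>, hence the loops of its link.
        They make up the residue class \<open>i + 1\<close> below \<open>?m\<close> except for its
        first vertex \<open>Suc i\<close>.\<close>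
      let ?X = "(\<lambda>j. i + 1 + j * t) ` {1..k - 2}"
      have diff: "?U - ?X = link_verts t k (Suc i)"
      proof (rule Set.set_eqI)
        fix x
        have X_mod: "y mod t = Suc i" if "y \<in> ?X" for y using that it by auto
        have "x \<in> ?X \<or> x = Suc i" if "x mod t = Suc i" "x < ?m"
        proof -
          have "x = Suc i + (x div t) * t"
            using that(1) div_mult_mod_eq[of x t] by linarith
          then obtain a where a: "x = Suc i + a * t" by blast
          have "a * t < (k - 1) * t" using that(2) a mult.commute[of t "k - 1"] by linarith
          then have "a \<le> k - 2" unfolding mult_less_cancel2 by linarith
          then show ?thesis using a by (cases "a = 0") auto
        qed
        then have near: "x = Suc i" if "x mod t = Suc i" "x < ?m" "x \<notin> ?X"
          using that by blast
        have 1: "Suc i \<notin> ?X" using t by auto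
        have 2: "Suc i < ?m" "Suc i mod t = Suc i" using it m by (linarith, simp)
        have 3: "?m mod t = 0" by simp
        have 5: "x \<in> link_verts t k (Suc i) \<longleftrightarrow> x = Suc i \<or> x = ?m \<or> (x < ?m \<and> Suc i < x mod t)"
          by (simp add: link_verts_def)
        show "x \<in> ?U - ?X \<longleftrightarrow> x \<in> link_verts t k (Suc i)"
        proof
          assume x: "x \<in> ?U - ?X"
          then consider "x = ?m" | "x < ?m" "i < x mod t" using mem by blast
          then show "x \<in> link_verts t k (Suc i)"
          proof cases
            case 1
            then show ?thesis using 5 by blast
          next
            case 2
            have "x mod t = Suc i \<Longrightarrow> x = Suc i" using near 2(1) x by blast
            moreover have "x mod t = Suc i \<or> Suc i < x mod t" using 2(2) by linarith
            ultimately show ?thesis using 5 2(1) by blast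
          qed
        next
          assume "x \<in> link_verts t k (Suc i)"
          then consider "x = Suc i" | "x = ?m" | "x < ?m" "Suc i < x mod t" using 5 by blast
          then show "x \<in> ?U - ?X"
          proof cases
            case c: 1
            have "i < Suc i mod t" using 2(2) by linarith
            then have "Suc i \<in> ?U" using mem 2(1) by blast
            then show ?thesis unfolding c using 1 by blast
          next
            case c: 2
            then have "x \<notin> ?X" using X_mod[of x] 3 by fastforce
            moreover have "x \<in> ?U" using mem c by blast
            ultimately show ?thesis by blast
          next
            case c: 3
            then have "x \<notin> ?X" "i < x mod t" using X_mod[of x] by linarith+
            moreover from this have "x \<in> ?U" using mem c by blast
            ultimately show ?thesis by blast
          qed
        qed
      qed
      have "cohom (nonfaces ?N' :: 'k sqf) (?U - ?X) (int t + 1 - int (Suc i)) True"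
      proof -
        have "cohom ?M (?U - ?X) (int t + 1 - int (Suc i)) True"
          unfolding diff using less.hyps[of "Suc i"] it by auto
        moreover have agree: "T \<in> ?N' \<longleftrightarrow> T \<in> ?N" if T: "T \<subseteq> ?U - ?X" for T
        proof -
          have no_up: "\<not> adj t k i b" if "b \<in> insert i T" for b
          proof
            assume "adj t k i b"
            then have "b \<in> ?X" by (auto simp: adj_def)
            moreover have "b \<noteq> i" using \<open>adj t k i b\<close> adj_less by blast
            ultimately show False using that T by blast
          qed
          have no_down: "\<not> adj t k a i" if "a \<in> insert i T" for a
          proof
            assume "adj t k a i"
            then have "a < i" by (rule adj_less)
            moreover have "a \<in> ?U" using that T \<open>a < i\<close> by blast
            ultimately show False unfolding mem using im \<open>a < i\<close> mod_less_eq_dividend[of a t] by linarith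
          qed
          show ?thesis
            unfolding mem_Collect_eq using no_up no_down by (rule dependent_sets_insert_iff)
        qed
        have "cohom (nonfaces ?N' :: 'k sqf) (?U - ?X) (int t + 1 - int (Suc i)) True =
            cohom ?M (?U - ?X) (int t + 1 - int (Suc i)) True"
          by (intro cohom_cong nonfaces_cong agree)
        ultimately show ?thesis by blast
      qed
      then have "cohom (nonfaces ?N' :: 'k sqf) ?U (int t + 1 - int (Suc i)) True"
      proof (rule cohom_nonfaces_loops[rotated -1])
        show "?U - ?X \<noteq> {}" unfolding diff by (auto simp: link_verts_def)
        show "up_closed ?N'" by (rule up_closed_insert[OF up_closed_dependent_sets])
        fix T assume "T \<inter> ?X \<noteq> {}"
        then obtain j where "j \<in> {1..k - 2}" "i + 1 + j * t \<in> T" by blast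
        then have "adj t k i (i + 1 + j * t)" unfolding adj_def by blast
        then show "T \<in> ?N'"
          using \<open>i + 1 + j * t \<in> T\<close> by (simp add: dependent_setsI[of i _ "i + 1 + j * t"])
      qed (use fin in auto)
      then show ?thesis unfolding shift_nonfaces by (simp add: algebra_simps)
    qed
    ultimately show ?thesis
      by (rule cohom_deletion_exact[OF fin iU mod])
  qed
qed

text \<open>The deletion of \<open>?v = n - 1\<close> is an interval and so acyclic by
  \<open>exact_interval\<close>. The loops in its link are the positive multiples of
  \<open>t\<close> below \<open>t * (k - 1)\<close>.\<close>

lemma cohom_link_to_full:
  fixes t k n :: nat
  assumes n: "n = t * (k - 1) + 2" and t: "t \<ge> 1" and k: "k \<ge> 3"
    and lk: "cohom (nonfaces (dependent_sets t k) :: ('k::field) sqf) (link_verts t k 0) (q - 1) b"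
  shows "cohom (nonfaces (dependent_sets t k) :: 'k sqf) {0..<n} q b"
proof -
  let ?N = "dependent_sets t k" and ?m = "t * (k - 1)"
  let ?M = "nonfaces ?N :: 'k sqf"
  let ?v = "?m + 1"
  let ?N' = "{T. insert ?v T \<in> ?N}"
  let ?X = "(\<lambda>j. j * t) ` {1..k - 2}"
  note mod = sqf_module_nonfaces[OF up_closed_dependent_sets[of t k]]
  have v: "?v \<in> {0..<n}" "{0..<n} - {?v} = {0..?m}" using n by auto
  have adj_v: "adj t k a ?v \<longleftrightarrow> a \<in> ?X" for a
  proof
    assume "adj t k a ?v"
    then obtain j where j: "1 \<le> j" "j \<le> k - 2" "?m = a + j * t" by (auto simp: adj_def)
    have "?m = j * t + (k - 1 - j) * t" using mult_split[of j "k - 1" t] j(2) k by (simp add: mult.commute)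
    then have "a = (k - 1 - j) * t" using j(3) by linarith
    then show "a \<in> ?X" using j by (intro image_eqI[of _ _ "k - 1 - j"]) auto
  next
    assume "a \<in> ?X"
    then obtain j where j: "1 \<le> j" "j \<le> k - 2" "a = j * t" by auto
    have "?m = j * t + (k - 1 - j) * t" using mult_split[of j "k - 1" t] j(2) k by (simp add: mult.commute)
    then show "adj t k a ?v"
      unfolding adj_def using j k by (intro bexI[of _ "k - 1 - j"]) auto
  qed
  have diff: "{0..?m} - ?X = link_verts t k 0"
  proof (rule Set.set_eqI)
    fix x
    have "x \<in> ?X \<or> x = 0" if "x mod t = 0" "x < ?m"
    proof -
      have "x = (x div t) * t" using that(1) div_mult_mod_eq[of x t] by linarith
      then obtain a where a: "x = a * t" by blast
      have "a * t < (k - 1) * t" using that(2) a mult.commute[of t "k - 1"] by linarith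
      then have "a \<le> k - 2" unfolding mult_less_cancel2 by linarith
      then show ?thesis using a by (cases "a = 0") auto
    qed
    moreover have "x mod t = 0 \<and> x < ?m \<and> 0 < x" if "x \<in> ?X"
    proof -
      obtain j where j: "1 \<le> j" "j \<le> k - 2" "x = j * t" using \<open>x \<in> ?X\<close> by auto
      then have "j < k - 1" using k by linarith
      then have "j * t < (k - 1) * t" using t by simp
      then show ?thesis using j t by (simp add: mult.commute)
    qed
    moreover have "x mod t = 0 \<or> 0 < x mod t" by linarith
    ultimately show "x \<in> {0..?m} - ?X \<longleftrightarrow> x \<in> link_verts t k 0"
      unfolding link_verts_def by auto
  qed
  have "cohom (nonfaces ?N' :: 'k sqf) ({0..?m} - ?X) (q - 1) b"
  proof -
    have agree: "T \<in> ?N' \<longleftrightarrow> T \<in> ?N" if T: "T \<subseteq> {0..?m} - ?X" for T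
    proof -
      have "\<not> adj t k a ?v" if "a \<in> insert ?v T" for a
      proof
        assume adj: "adj t k a ?v"
        then have "a \<in> ?X" "a \<noteq> ?v" using adj_v[of a] adj_less[OF adj] by blast+
        then show False using that T by blast
      qed
      moreover have "\<not> adj t k ?v b" if "b \<in> insert ?v T" for b
        using that T adj_less[of t k ?v b] by auto
      ultimately show ?thesis
        unfolding mem_Collect_eq by (intro dependent_sets_insert_iff)
    qed
    have "cohom (nonfaces ?N' :: 'k sqf) ({0..?m} - ?X) (q - 1) b =
        cohom ?M ({0..?m} - ?X) (q - 1) b"
      by (intro cohom_cong nonfaces_cong agree)
    then show ?thesis using lk unfolding diff by blast
  qed
  then have "cohom (nonfaces ?N' :: 'k sqf) {0..?m} (q - 1) b"
  proof (rule cohom_nonfaces_loops[rotated -1])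
    show "{0..?m} - ?X \<noteq> {}" unfolding diff by (auto simp: link_verts_def)
    show "up_closed ?N'" by (rule up_closed_insert[OF up_closed_dependent_sets])
    fix T assume "T \<inter> ?X \<noteq> {}"
    then obtain a where "a \<in> T" "adj t k a ?v" using adj_v by blast
    then show "T \<in> ?N'" by (simp add: dependent_setsI[of a _ ?v])
  qed auto
  moreover have "exact ?M {0..?m} q" for q
    using exact_interval[OF t k, of 0 q] by simp
  ultimately show ?thesis
    using cohom_deletion_exact[OF _ v(1) mod, of q b] unfolding v(2) shift_nonfaces by blast
qed

theorem cohom_dependent_sets:
  fixes t k n :: nat and q :: int
  assumes n: "n = t * (k - 1) + 2" and t: "t \<ge> 1" and k: "k \<ge> 3"
    and U: "U \<subseteq> {0..<n}" and q: "q \<ge> int t + 2"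
  shows "cohom (nonfaces (dependent_sets t k) :: ('k::field) sqf) U q
    (U = {0..<n} \<and> q = int t + 2)"
proof (cases "U = {0..<n}")
  case False
  then show ?thesis using exact_proper_subset[OF n t k U False q] by simp
next
  case True
  have "cohom (nonfaces (dependent_sets t k) :: 'k sqf) (link_verts t k 0) (q - 1)
    (q = int t + 2)"
  proof (cases "q = int t + 2")
    case True
    then show ?thesis using cohom_link_verts[OF t k, of 0] t by (simp add: add.commute)
  next
    case False
    \<comment> \<open>Now \<open>q - 1 \<ge> t + 2\<close>, and the link avoids the vertex
      \<open>n - 1\<close>, so the vanishing for proper subsets applies to it.\<close>
    have "link_verts t k 0 \<subseteq> {0..<n}" "n - 1 \<notin> link_verts t k 0" "n - 1 \<in> {0..<n}"
      unfolding link_verts_def n by auto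
    then have "link_verts t k 0 \<subseteq> {0..<n}" "link_verts t k 0 \<noteq> {0..<n}" by blast+
    then show ?thesis
      using exact_proper_subset[OF n t k, of "link_verts t k 0" "q - 1"] False q by auto
  qed
  then show ?thesis
    using cohom_link_to_full[OF n t k] True by simp
qed

section \<open>Minimal covers and dimension shifting\<close>

text \<open>The squarefree degree \<open>T\<close> of a free module with basis degrees
  \<open>W s\<close>: the coordinate \<open>u s\<close> stands for \<open>u s\<close> times the
  monomial of \<open>T - W s\<close> times the basis element \<open>s\<close>.\<close>

definition free_part :: "nat \<Rightarrow> (nat \<Rightarrow> nat set) \<Rightarrow> ('k::field) sqf" where
  "free_part r W T = {u. \<forall>s. u s \<noteq> 0 \<longrightarrow> s < r \<and> W s \<subseteq> T}"

definition lin :: "nat \<Rightarrow> (nat \<Rightarrow> nat \<Rightarrow> 'k::field) \<Rightarrow> (nat \<Rightarrow> 'k) \<Rightarrow> nat \<Rightarrow> 'k" where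
  "lin r c u = (\<Sum>s<r. smul (u s) (c s))"

definition ker_part ::
  "nat \<Rightarrow> (nat \<Rightarrow> nat set) \<Rightarrow> (nat \<Rightarrow> nat \<Rightarrow> 'k::field) \<Rightarrow> 'k sqf" where
  "ker_part r W c T = {u \<in> free_part r W T. lin r c u = 0}"

text \<open>Generator \<open>s\<close> has squarefree degree \<open>W s\<close> and value \<open>c s\<close>. The last condition is minimality: a
  relation of degree \<open>U\<close> does not involve the generators of degree \<open>U\<close>.\<close>

definition min_cover ::
  "nat set \<Rightarrow> (('k::field) sqf) \<Rightarrow> nat \<Rightarrow> (nat \<Rightarrow> nat set) \<Rightarrow> (nat \<Rightarrow> nat \<Rightarrow> 'k) \<Rightarrow> bool"
  where "min_cover V Z r W c \<longleftrightarrow>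
    (\<forall>s<r. W s \<subseteq> V) \<and>
    (\<forall>U\<subseteq>V. lin r c ` free_part r W U = Z U) \<and>
    (\<forall>U\<subseteq>V. \<forall>u\<in>ker_part r W c U. \<forall>s. W s = U \<longrightarrow> u s = 0)"

lemma free_partD:
  assumes "u \<in> free_part r W T"
  shows "s \<ge> r \<Longrightarrow> u s = 0" "\<not> W s \<subseteq> T \<Longrightarrow> u s = 0"
  using assms by (auto simp: free_part_def)

lemma lin_linear:
  "lin r c (u + v) = lin r c u + lin r c v" "lin r c (u - v) = lin r c u - lin r c v"
  "lin r c (smul a u) = smul a (lin r c u)" "lin r c 0 = 0"
  by (simp_all add: lin_def smul_distribs sum.distrib sum_subtractf smul_sum)

lemma lin_sum: "lin r c (\<Sum>x\<in>X. f x) = (\<Sum>x\<in>X. lin r c (f x))"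
  by (induction X rule: infinite_finite_induct) (simp_all only: sum.infinite sum.empty sum.insert lin_linear not_False_eq_True)

lemma subspace_free_part: "subspace (free_part r W T :: (nat \<Rightarrow> 'k::field) set)"
proof -
  have "free_part r W T = {u :: nat \<Rightarrow> 'k. \<forall>s. \<not> (s < r \<and> W s \<subseteq> T) \<longrightarrow> u s = 0}"
    by (auto simp: free_part_def)
  then show ?thesis by (simp add: subspace_def)
qed

lemma free_part_mono: "T \<subseteq> T' \<Longrightarrow> free_part r W T \<subseteq> free_part r W T'"
  unfolding free_part_def by blast

lemma sqf_module_free_part: "sqf_module (free_part r W)"
  unfolding sqf_module_def using subspace_free_part free_part_mono by blast

lemma sqf_module_ker_part: "sqf_module (ker_part r W c)"
proof -
  have "subspace (ker_part r W c T)" for T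
    using subspace_free_part[of r W T] unfolding subspace_def ker_part_def mem_Collect_eq
    by (auto simp: lin_linear)
  moreover have "T \<subseteq> T' \<Longrightarrow> ker_part r W c T \<subseteq> ker_part r W c T'" for T T'
    using free_part_mono[of T T' r W] unfolding ker_part_def by blast
  ultimately show ?thesis unfolding sqf_module_def by blast
qed

text \<open>Each coordinate with \<open>W s \<noteq> U\<close> is contracted by a vertex of \<open>U - W s\<close>.\<close>

lemma free_part_acyclic:
  fixes f :: "nat set \<Rightarrow> nat \<Rightarrow> 'k::field"
  assumes U: "finite U" and f: "f \<in> chains (free_part r W) U q" "dif U f = 0"
    and top: "\<And>s. W s = U \<Longrightarrow> f U s = 0"
  shows "\<exists>g\<in>chains (free_part r W) U (q - 1). f = dif U g"
proof -
  define v where "v s = (SOME x. x \<in> U - W s)" for s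
  define A where "A = {s. W s \<subset> U}"
  have v: "v s \<in> U" "v s \<notin> W s" if "s \<in> A" for s
  proof -
    have "\<exists>x. x \<in> U - W s" using that by (auto simp: A_def)
    then have "v s \<in> U - W s" unfolding v_def by (rule someI_ex)
    then show "v s \<in> U" "v s \<notin> W s" by blast+
  qed
  have supp: "W s \<subseteq> T" "T \<subseteq> U" "s < r" "int (card T) = q" if "f T s \<noteq> 0" for T s
  proof -
    have "f T \<noteq> 0" using that by auto
    then have "T \<subseteq> U" "int (card T) = q" using chainsD(2,3)[OF f(1)] by blast+
    moreover from this have "f T \<in> free_part r W T" using chainsD(1)[OF f(1)] by blast
    ultimately show "W s \<subseteq> T" "T \<subseteq> U" "s < r" "int (card T) = q"
      using that by (auto simp: free_part_def)
  qed
  have out: "f T s = 0" if "s \<notin> A" for T s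
  proof (rule ccontr)
    assume nz: "f T s \<noteq> 0"
    then have "W s = U" "T = U" using supp[OF nz] that by (auto simp: A_def)
    then show False using nz top by blast
  qed
  \<comment> \<open>The contracting homotopy of a simplex, separately in each coordinate. As
    \<open>v s\<close> is not in \<open>W s\<close>, removing it from a set keeps the coordinate
    \<open>s\<close> admissible.\<close>
  define g where "g T s = (if s \<in> A \<and> v s \<notin> T then eps (v s) (insert (v s) T) * f (insert (v s) T) s else 0)" for T s
  have g_supp: "W s \<subseteq> T" "T \<subseteq> U" "s < r" "int (card T) = q - 1" if "g T s \<noteq> 0" for T s
  proof -
    have s: "s \<in> A" "v s \<notin> T" "f (insert (v s) T) s \<noteq> 0"
      using that by (auto simp: g_def split: if_splits)
    note * = supp[OF s(3)]
    show "W s \<subseteq> T" "T \<subseteq> U" "s < r" using * v[OF s(1)] by blast+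
    have "finite T" using *(2) U by (meson finite_insert finite_subset)
    then show "int (card T) = q - 1" using *(4) s(2) by simp
  qed
  have "g \<in> chains (free_part r W) U (q - 1)"
  proof -
    have "g T \<in> free_part r W T" for T
      using g_supp[of T] by (auto simp: free_part_def)
    moreover have "g T = 0" if "\<not> (T \<subseteq> U \<and> int (card T) = q - 1)" for T
    proof
      show "g T s = 0 s" for s using g_supp(2,4)[of T s] that by auto
    qed
    ultimately show ?thesis unfolding chains_def by auto
  qed
  moreover have "f T s = dif U g T s" for T s
  proof (cases "T \<subseteq> U")
    case False
    then have "f T s = 0" using supp(2) by blast
    then show ?thesis using False by (simp add: dif_def)
  next
    case T: True
    then have fin: "finite T" using U finite_subset by blast
    have dif_g: "dif U g T s = (\<Sum>x\<in>T. eps x T * g (T - {x}) s)"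
      using T by (simp add: dif_def sum_apply)
    show ?thesis
    proof (cases "s \<in> A")
      case False
      then have "dif U g T s = 0" unfolding dif_g by (simp add: g_def)
      then show ?thesis using out[OF False] by simp
    next
      case s: True
      show ?thesis
      proof (cases "v s \<in> T")
        case True
        have "dif U g T s = eps (v s) T * g (T - {v s}) s + (\<Sum>x\<in>T - {v s}. eps x T * g (T - {x}) s)"
          unfolding dif_g using fin True by (rule sum.remove)
        also have "(\<Sum>x\<in>T - {v s}. eps x T * g (T - {x}) s) = 0"
          using True by (intro sum.neutral) (auto simp: g_def)
        also have "g (T - {v s}) s = eps (v s) T * f T s"
          using s True by (simp add: g_def insert_absorb)
        finally show ?thesis by (simp flip: mult.assoc)
      next
        case False
        define S where "S = insert (v s) T"
        have S: "S \<subseteq> U" "finite S" "v s \<in> S" "S - {v s} = T"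
          using T v(1)[OF s] fin False by (auto simp: S_def)
        have "0 = dif U f S s" using f(2) by simp
        also have "\<dots> = (\<Sum>x\<in>S. eps x S * f (S - {x}) s)"
          using S(1) by (simp add: dif_def sum_apply)
        also have "\<dots> = eps (v s) S * f (S - {v s}) s + (\<Sum>x\<in>S - {v s}. eps x S * f (S - {x}) s)"
          using S(2,3) by (rule sum.remove)
        \<comment> \<open>The cycle condition at \<open>S = insert (v s) T\<close> expresses
          \<open>f T s\<close> through the faces of \<open>S\<close> that contain
          \<open>v s\<close>, and these are exactly the values used by \<open>g\<close>.\<close>
        finally have rel: "(\<Sum>x\<in>T. eps x S * f (S - {x}) s) = - eps (v s) S * f T s"
          unfolding S(4) by (simp add: eq_neg_iff_add_eq_0 add.commute)
        have "dif U g T s = (\<Sum>x\<in>T. - eps (v s) S * (eps x S * f (S - {x}) s))"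
          unfolding dif_g
        proof (rule sum.cong[OF refl])
          fix x assume x: "x \<in> T"
          then have "x \<noteq> v s" "x \<in> S" using False by (auto simp: S_def)
          have ins: "insert (v s) (T - {x}) = S - {x}" using \<open>x \<noteq> v s\<close> by (auto simp: S_def)
          have swap: "eps x S * eps (v s) (S - {x}) = - (eps (v s) S * eps x T :: 'k)"
            using eps_swap[OF S(2) \<open>x \<in> S\<close> S(3) \<open>x \<noteq> v s\<close>] unfolding S(4) .
          have "eps x T * eps (v s) (S - {x}) =
              (eps (v s) S * eps (v s) S) * (eps x S * eps x S) * (eps x T * eps (v s) (S - {x}) :: 'k)"
            by simp
          also have "\<dots> = (eps (v s) S * eps x T) * eps (v s) S * eps x S * (eps x S * eps (v s) (S - {x}))"
            by (simp only: mult_ac)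
          also have "\<dots> = - (eps (v s) S * eps x S) * ((eps (v s) S * eps x T) * (eps (v s) S * eps x T))"
            unfolding swap by (simp only: mult_ac mult_minus_right mult_minus_left)
          also have "(eps (v s) S * eps x T) * (eps (v s) S * eps x T) =
              (eps (v s) S * eps (v s) S) * (eps x T * eps x T :: 'k)"
            by (simp only: mult_ac)
          finally have sign: "eps x T * eps (v s) (S - {x}) = - (eps (v s) S * eps x S :: 'k)"
            by simp
          have "g (T - {x}) s = eps (v s) (S - {x}) * f (S - {x}) s"
            using s False by (simp add: g_def ins)
          then have "eps x T * g (T - {x}) s = (eps x T * eps (v s) (S - {x})) * f (S - {x}) s"
            by (simp only: mult.assoc)
          then show "eps x T * g (T - {x}) s = - eps (v s) S * (eps x S * f (S - {x}) s)"
            unfolding sign by (simp only: mult.assoc mult_minus_left)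
        qed
        also have "\<dots> = - eps (v s) S * (\<Sum>x\<in>T. eps x S * f (S - {x}) s)"
          by (rule sum_distrib_left[symmetric])
        also have "\<dots> = (eps (v s) S * eps (v s) S) * f T s"
          unfolding rel by (simp only: mult.assoc mult_minus_left mult_minus_right minus_minus)
        finally show ?thesis by simp
      qed
    qed
  qed
  then have "f = dif U g" by blast
  ultimately show ?thesis by blast
qed

lemma dif_lin: "dif U (\<lambda>T. lin r c (y T)) T = lin r c (dif U y T)"
  by (simp only: dif_def lin_sum lin_linear if_distrib[of "lin r c"])

lemma min_coverD:
  assumes "min_cover V Z r W c"
  shows "s < r \<Longrightarrow> W s \<subseteq> V" "T \<subseteq> V \<Longrightarrow> lin r c ` free_part r W T = Z T"
    "u \<in> ker_part r W c (W s) \<Longrightarrow> W s \<subseteq> V \<Longrightarrow> u s = 0"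
  using assms by (simp_all add: min_cover_def)

context
  fixes V U :: "nat set" and Z :: "('k::field) sqf"
    and r :: nat and W :: "nat \<Rightarrow> nat set" and c :: "nat \<Rightarrow> nat \<Rightarrow> 'k"
  assumes cover: "min_cover V Z r W c" and fin: "finite U" and UV: "U \<subseteq> V"
begin

lemma cover_image: "T \<subseteq> U \<Longrightarrow> lin r c ` free_part r W T = Z T"
  using min_coverD(2)[OF cover, of T] UV by blast

lemma cover_min: "u \<in> ker_part r W c U \<Longrightarrow> W s = U \<Longrightarrow> u s = 0"
  using min_coverD(3)[OF cover, of u s] UV by simp

lemma chains_lin:
  assumes "y \<in> chains (free_part r W) U q"
  shows "(\<lambda>T. lin r c (y T)) \<in> chains Z U q"
proof -
  have "if T \<subseteq> U \<and> int (card T) = q then lin r c (y T) \<in> Z T else lin r c (y T) = 0" for T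
  proof (cases "T \<subseteq> U \<and> int (card T) = q")
    case True
    then have "y T \<in> free_part r W T" using chainsD(1)[OF assms] by blast
    then have "lin r c (y T) \<in> Z T" using cover_image[of T] True by blast
    then show ?thesis using True by simp
  next
    case False
    then have "y T = 0" using chainsD(2,3)[OF assms, of T] by blast
    then have "lin r c (y T) = 0" by (simp only: lin_linear)
    then show ?thesis by (simp only: if_not_P[OF False])
  qed
  then show ?thesis unfolding chains_def by blast
qed

lemma lift_chain:
  assumes "z \<in> chains Z U q"
  obtains y where "y \<in> chains (free_part r W) U q" "\<And>T. lin r c (y T) = z T"
proof -
  have "\<exists>u. lin r c u = z T \<and> (if T \<subseteq> U \<and> int (card T) = q then u \<in> free_part r W T else u = 0)" for T
  proof (cases "T \<subseteq> U \<and> int (card T) = q")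
    case True
    then have "z T \<in> lin r c ` free_part r W T"
      using chainsD(1)[OF assms] cover_image[of T] by blast
    then show ?thesis using True by auto
  next
    case False
    then have "z T = 0" using chainsD(2,3)[OF assms] by blast
    then show ?thesis using False lin_linear(4) by auto
  qed
  then obtain y where "\<And>T. lin r c (y T) = z T \<and>
      (if T \<subseteq> U \<and> int (card T) = q then y T \<in> free_part r W T else y T = 0)"
    by metis
  then show ?thesis using that[of y] unfolding chains_def by blast
qed

lemma ker_chainsI:
  assumes "y \<in> chains (free_part r W) U q" "\<And>T. lin r c (y T) = 0"
  shows "y \<in> chains (ker_part r W c) U q"
  using assms unfolding chains_def ker_part_def by auto

lemma ker_chainsD:
  assumes "y \<in> chains (ker_part r W c) U q"
  shows "y \<in> chains (free_part r W) U q" "lin r c (y T) = 0"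
proof -
  have "ker_part r W c T \<subseteq> free_part r W T" for T unfolding ker_part_def by blast
  then show "y \<in> chains (free_part r W) U q"
    using chains_mono[of U "ker_part r W c" "free_part r W" q] assms by blast
  show "lin r c (y T) = 0"
  proof (cases "T \<subseteq> U \<and> int (card T) = q")
    case True
    then show ?thesis using chainsD(1)[OF assms, of T] by (simp add: ker_part_def)
  next
    case False
    then have "y T = 0" using chainsD(2,3)[OF assms, of T] by blast
    then show ?thesis by (simp only: lin_linear)
  qed
qed

lemmas flin = chains_linear[OF sqf_module_free_part[of r W]]

text \<open>Dimension shifting along \<open>0 \<rightarrow> ker \<rightarrow> F \<rightarrow> Z \<rightarrow> 0\<close>. For \<open>q = card U\<close>, minimality makes the connecting
  homomorphism surjective.\<close>

lemma kernel_cycle_lift: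
  assumes f: "f \<in> chains (ker_part r W c) U q" "dif U f = 0"
  obtains y where "y \<in> chains (free_part r W) U (q - 1)" "f = dif U y"
    "(\<lambda>T. lin r c (y T)) \<in> chains Z U (q - 1)" "dif U (\<lambda>T. lin r c (y T)) = 0"
proof -
  have top: "f U s = 0" if "W s = U" for s
  proof (cases "int (card U) = q")
    case True
    then have "f U \<in> ker_part r W c U" using chainsD(1)[OF f(1)] by blast
    then show ?thesis using cover_min that by blast
  next
    case False
    then have "f U = 0" using chainsD(3)[OF f(1)] by blast
    then show ?thesis by simp
  qed
  obtain y where y: "y \<in> chains (free_part r W) U (q - 1)" "f = dif U y"
    using free_part_acyclic[OF fin ker_chainsD(1)[OF f(1)] f(2) top] by blast
  have "dif U (\<lambda>T. lin r c (y T)) = 0"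
    unfolding fun_eq_iff[of "dif U (\<lambda>T. lin r c (y T))"] dif_lin y(2)[symmetric] ker_chainsD(2)[OF f(1)] by simp
  then show ?thesis using that[OF y chains_lin[OF y(1)]] by blast
qed

text \<open>Subtracting the differential of a lift of \<open>w\<close> moves \<open>y\<close> into
  the kernel without changing \<open>dif U y\<close>. Hence the connecting homomorphism sends
  boundaries to boundaries.\<close>

lemma lift_boundary:
  assumes y: "y \<in> chains (free_part r W) U q"
    and w: "w \<in> chains Z U (q - 1)" "(\<lambda>T. lin r c (y T)) = dif U w"
  shows "\<exists>h\<in>chains (ker_part r W c) U q. dif U y = dif U h"
proof -
  obtain v where v: "v \<in> chains (free_part r W) U (q - 1)" "\<And>T. lin r c (v T) = w T"
    by (rule lift_chain[OF w(1)]) blast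
  have dv: "dif U v \<in> chains (free_part r W) U q"
    using dif_chains[OF fin sqf_module_free_part v(1)] by simp
  have "y - dif U v \<in> chains (ker_part r W c) U q"
  proof (rule ker_chainsI)
    show "y - dif U v \<in> chains (free_part r W) U q" using y dv by (rule flin(5))
    fix T
    have "lin r c (dif U v T) = dif U w T"
      using dif_lin[of U r c v T] unfolding v(2) by simp
    then show "lin r c ((y - dif U v) T) = 0"
      using fun_cong[OF w(2), of T] by (simp add: lin_linear)
  qed
  moreover have "dif U (y - dif U v) = dif U y"
    unfolding dif_minus dif_dif[OF fin sqf_module_free_part v(1)] by simp
  ultimately show ?thesis by metis
qed

text \<open>The connecting homomorphism, which lifts a cycle of \<open>Z\<close> to the free part
  and takes the differential, is bijective here. The bound on \<open>q\<close> is for injectivity: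
  it puts \<open>q - 1\<close> below \<open>card U\<close>, where the free part is acyclic.\<close>

lemma cohom_kernel:
  assumes q: "q \<le> int (card U)" and Z: "cohom Z U (q - 1) b"
  shows "cohom (ker_part r W c) U q b"
proof (cases b)
  case False
  have "exact (ker_part r W c) U q"
  proof (rule exactI)
    fix f assume "f \<in> chains (ker_part r W c) U q" "dif U f = 0"
    then obtain y where y: "y \<in> chains (free_part r W) U (q - 1)" "f = dif U y"
      "(\<lambda>T. lin r c (y T)) \<in> chains Z U (q - 1)" "dif U (\<lambda>T. lin r c (y T)) = 0"
      by (rule kernel_cycle_lift)
    obtain w where w: "w \<in> chains Z U (q - 1 - 1)" "(\<lambda>T. lin r c (y T)) = dif U w"
      using exactD[OF _ y(3,4)] Z False by auto
    show "\<exists>g\<in>chains (ker_part r W c) U (q - 1). f = dif U g"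
      using lift_boundary[OF y(1) w] unfolding y(2) .
  qed
  then show ?thesis using False by simp
next
  case True
  with Z have Z': "cohom Z U (q - 1) True" by simp
  obtain z where z: "z \<in> chains Z U (q - 1)" "dif U z = 0"
    "\<And>g. g \<in> chains Z U (q - 1 - 1) \<Longrightarrow> z \<noteq> dif U g"
    "\<And>f. f \<in> chains Z U (q - 1) \<Longrightarrow> dif U f = 0 \<Longrightarrow> \<exists>a. \<exists>g\<in>chains Z U (q - 1 - 1). f - scal a z = dif U g"
    by (rule cohomD[OF Z']) blast
  obtain y0 where y0: "y0 \<in> chains (free_part r W) U (q - 1)" "\<And>T. lin r c (y0 T) = z T"
    by (rule lift_chain[OF z(1)]) blast
  have "cohom (ker_part r W c) U q True"
  proof (rule cohomI)
    show "dif U y0 \<in> chains (ker_part r W c) U q"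
    proof (rule ker_chainsI)
      show "dif U y0 \<in> chains (free_part r W) U q"
        using dif_chains[OF fin sqf_module_free_part y0(1)] by simp
      show "lin r c (dif U y0 T) = 0" for T
        using dif_lin[of U r c y0 T] z(2) unfolding y0(2) by simp
    qed
    show "dif U (dif U y0) = 0" by (rule dif_dif[OF fin sqf_module_free_part y0(1)])
  next
    fix g assume g: "g \<in> chains (ker_part r W c) U (q - 1)"
    show "dif U y0 \<noteq> dif U g"
    proof
      assume eq: "dif U y0 = dif U g"
      have "y0 - g \<in> chains (free_part r W) U (q - 1)"
        using y0(1) ker_chainsD(1)[OF g] by (rule flin(5))
      \<comment> \<open>The degree \<open>q - 1\<close> is less than \<open>card U\<close>, so the
        chain has no value at \<open>U\<close> that could obstruct acyclicity.\<close>
      moreover from this have "(y0 - g) U s = 0" for s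
        using chainsD(3)[of "y0 - g" "free_part r W" U "q - 1" U] q by simp
      moreover have "dif U (y0 - g) = 0" unfolding dif_minus eq by simp
      ultimately obtain v where v: "v \<in> chains (free_part r W) U (q - 1 - 1)" "y0 - g = dif U v"
        using free_part_acyclic[OF fin, of "y0 - g" r W "q - 1"] by blast
      have "z T = dif U (\<lambda>T. lin r c (v T)) T" for T
      proof -
        have "z T = lin r c ((y0 - g) T)"
          using ker_chainsD(2)[OF g, of T] y0(2)[of T] by (simp add: lin_linear)
        then show ?thesis unfolding v(2) dif_lin .
      qed
      then have "z = dif U (\<lambda>T. lin r c (v T))" by blast
      then show False using z(3)[OF chains_lin[OF v(1)]] by blast
    qed
  next
    fix f assume "f \<in> chains (ker_part r W c) U q" "dif U f = 0"
    then obtain y where y: "y \<in> chains (free_part r W) U (q - 1)" "f = dif U y"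
      "(\<lambda>T. lin r c (y T)) \<in> chains Z U (q - 1)" "dif U (\<lambda>T. lin r c (y T)) = 0"
      by (rule kernel_cycle_lift)
    obtain a w where w: "w \<in> chains Z U (q - 1 - 1)" "(\<lambda>T. lin r c (y T)) - scal a z = dif U w"
      using z(4)[OF y(3,4)] by blast
    have "(\<lambda>T. lin r c ((y - scal a y0) T)) = dif U w"
      unfolding w(2)[symmetric] by (rule ext) (simp add: lin_linear y0(2))
    moreover have "y - scal a y0 \<in> chains (free_part r W) U (q - 1)"
      using y(1) y0(1) by (intro flin)
    ultimately have "\<exists>h\<in>chains (ker_part r W c) U (q - 1). dif U (y - scal a y0) = dif U h"
      using w(1) by (intro lift_boundary)
    then show "\<exists>a. \<exists>g\<in>chains (ker_part r W c) U (q - 1). f - scal a (dif U y0) = dif U g"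
      unfolding dif_minus dif_scal y(2) by blast
  qed
  then show ?thesis using True by simp
qed

end

section \<open>Generators of a minimal cover and cohomology in top degree\<close>

definition unit_fun :: "nat \<Rightarrow> nat \<Rightarrow> 'k::field" where
  "unit_fun s = (\<lambda>x. if x = s then 1 else 0)"

lemma unit_fun_apply [simp]: "unit_fun s s = 1" "x \<noteq> s \<Longrightarrow> unit_fun s x = 0"
  by (simp_all add: unit_fun_def)

lemma unit_fun_free_part: "s < r \<Longrightarrow> W s \<subseteq> T \<Longrightarrow> unit_fun s \<in> free_part r W T"
  by (simp add: free_part_def unit_fun_def)

lemma lin_unit_fun:
  assumes "s < r"
  shows "lin r c (unit_fun s) = c s"
proof -
  have "lin r c (unit_fun s) = (\<Sum>x<r. if s = x then c x else 0)"
    unfolding lin_def by (rule sum.cong) (auto simp: unit_fun_def)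
  also have "\<dots> = c s" using assms by simp
  finally show ?thesis .
qed

lemma cover_value:
  assumes "min_cover V Z r W c" "s < r"
  shows "c s \<in> Z (W s)"
proof -
  have "lin r c (unit_fun s) \<in> lin r c ` free_part r W (W s)"
    using unit_fun_free_part[of s r W "W s"] assms(2) by blast
  then show ?thesis
    using min_coverD(2)[OF assms(1) min_coverD(1)[OF assms]] lin_unit_fun[OF assms(2), of c] by simp
qed

text \<open>In degree \<open>card U\<close> a chain is a single element of \<open>M U\<close>, and
  its class modulo boundaries is its class modulo what comes from proper subsets of
  \<open>U\<close>.\<close>

definition top_chain :: "nat set \<Rightarrow> (nat \<Rightarrow> 'k::field) \<Rightarrow> nat set \<Rightarrow> nat \<Rightarrow> 'k" where
  "top_chain U z = (\<lambda>T. if T = U then z else 0)"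

lemma top_chain_linear:
  "top_chain U (z + z') = top_chain U z + top_chain U z'"
  "top_chain U (z - z') = top_chain U z - top_chain U z'"
  "top_chain U (smul a z) = scal a (top_chain U z)"
  by (rule ext; simp add: top_chain_def)+

lemma top_chain_chains:
  assumes "finite U"
  shows "top_chain U z \<in> chains M U (int (card U)) \<longleftrightarrow> z \<in> M U"
proof
  assume "top_chain U z \<in> chains M U (int (card U))"
  then have "top_chain U z U \<in> M U" using chainsD(1) by blast
  then show "z \<in> M U" by (simp add: top_chain_def)
next
  assume z: "z \<in> M U"
  have "if T \<subseteq> U \<and> int (card T) = int (card U) then top_chain U z T \<in> M T else top_chain U z T = 0" for T
  proof (cases "T = U")
    case True
    then show ?thesis using z by (simp add: top_chain_def)
  next
    case False
    then have "\<not> (T \<subseteq> U \<and> int (card T) = int (card U))"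
      using card_subset_eq[OF assms, of T] by auto
    then show ?thesis using False by (simp only: top_chain_def if_False)
  qed
  then show "top_chain U z \<in> chains M U (int (card U))" unfolding chains_def by blast
qed

lemma chains_top:
  assumes "finite U" "f \<in> chains M U (int (card U))"
  shows "f = top_chain U (f U)"
proof
  fix T
  show "f T = top_chain U (f U) T"
  proof (cases "T = U")
    case True
    then show ?thesis by (simp add: top_chain_def)
  next
    case False
    then have "\<not> (T \<subseteq> U \<and> int (card T) = int (card U))"
      using card_subset_eq[OF assms(1), of T] by auto
    then have "f T = 0" using chainsD(2,3)[OF assms(2)] by blast
    then show ?thesis using False by (simp add: top_chain_def)
  qed
qed

lemma dif_top_chain: "dif U (top_chain U z) = 0"
proof
  fix T
  have "top_chain U z (T - {x}) = 0" if "T \<subseteq> U" "x \<in> T" for x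
  proof -
    have "T - {x} \<noteq> U" using that by blast
    then show ?thesis by (simp add: top_chain_def)
  qed
  then show "dif U (top_chain U z) T = 0 T" by (simp add: dif_def)
qed

lemma bounds_linear:
  assumes "sqf_module M" "f \<in> bounds M U q"
  shows "g \<in> bounds M U q \<Longrightarrow> f - g \<in> bounds M U q" "scal a f \<in> bounds M U q"
proof -
  obtain f' where f': "f' \<in> chains M U (q - 1)" "f = dif U f'"
    using assms(2) unfolding bounds_def by blast
  show "scal a f \<in> bounds M U q"
    using chains_linear(3)[OF assms(1) f'(1), of a] by (rule boundsI) (simp add: f'(2) dif_scal)
  assume "g \<in> bounds M U q"
  then obtain g' where g': "g' \<in> chains M U (q - 1)" "g = dif U g'"
    unfolding bounds_def by blast
  show "f - g \<in> bounds M U q"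
    using chains_linear(5)[OF assms(1) f'(1) g'(1)] by (rule boundsI) (simp add: f'(2) g'(2) dif_minus)
qed

context
  fixes V U :: "nat set" and Z :: "('k::field) sqf"
    and r :: nat and W :: "nat \<Rightarrow> nat set" and c :: "nat \<Rightarrow> nat \<Rightarrow> 'k"
  assumes cover: "min_cover V Z r W c" and fin: "finite U" and UV: "U \<subseteq> V" and Z: "sqf_module Z"
begin

text \<open>An element comes from smaller degrees exactly if it involves no generator of degree
  \<open>U\<close>: one direction is minimality, the other the acyclicity of the free part. So the
  values of these generators are independent in the top cohomology.\<close>

lemma top_bound_iff:
  assumes u: "u \<in> free_part r W U"
  shows "top_chain U (lin r c u) \<in> bounds Z U (int (card U)) \<longleftrightarrow> (\<forall>s. W s = U \<longrightarrow> u s = 0)"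
proof
  assume "top_chain U (lin r c u) \<in> bounds Z U (int (card U))"
  then obtain g where g: "g \<in> chains Z U (int (card U) - 1)" "top_chain U (lin r c u) = dif U g"
    unfolding bounds_def by blast
  obtain y where y: "y \<in> chains (free_part r W) U (int (card U) - 1)" "\<And>T. lin r c (y T) = g T"
    by (rule lift_chain[OF cover fin UV g(1)]) blast
  have dy: "dif U y U \<in> free_part r W U"
    using dif_chains[OF fin sqf_module_free_part y(1)] chainsD(1)[of "dif U y" "free_part r W" U "int (card U)" U] by simp
  have "lin r c u = dif U g U"
    using fun_cong[OF g(2), of U] by (simp add: top_chain_def)
  also have "\<dots> = lin r c (dif U y U)"
    using dif_lin[of U r c y U] unfolding y(2) .
  finally have "u - dif U y U \<in> ker_part r W c U"
    unfolding ker_part_def using subspaceD(5)[OF subspace_free_part u dy] by (simp add: lin_linear)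
  then have eq: "(u - dif U y U) s = 0" if "W s = U" for s
    using cover_min[OF cover fin UV] that by blast
  \<comment> \<open>The value at \<open>U\<close> is assembled from the sets \<open>U - {x}\<close>,
    where no generator of degree \<open>U\<close> is available.\<close>
  have "dif U y U s = 0" if "W s = U" for s
  proof -
    have "y (U - {x}) s = 0" if "x \<in> U" for x
    proof (cases "int (card (U - {x})) = int (card U) - 1")
      case True
      then have "y (U - {x}) \<in> free_part r W (U - {x})"
        using chainsD(1)[OF y(1), of "U - {x}"] by blast
      moreover have "\<not> W s \<subseteq> U - {x}" using \<open>W s = U\<close> \<open>x \<in> U\<close> by blast
      ultimately show ?thesis by (rule free_partD(2))
    next
      case False
      then show ?thesis using chainsD(3)[OF y(1)] by simp
    qed
    then show ?thesis by (simp add: dif_def sum_apply)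
  qed
  then show "\<forall>s. W s = U \<longrightarrow> u s = 0" using eq by simp
next
  assume top: "\<forall>s. W s = U \<longrightarrow> u s = 0"
  have "top_chain U u \<in> chains (free_part r W) U (int (card U))"
    using top_chain_chains[OF fin] u by blast
  moreover have "top_chain U u U s = 0" if "W s = U" for s
    using top that by (simp add: top_chain_def)
  ultimately obtain y where y: "y \<in> chains (free_part r W) U (int (card U) - 1)" "top_chain U u = dif U y"
    using free_part_acyclic[OF fin _ dif_top_chain] by blast
  show "top_chain U (lin r c u) \<in> bounds Z U (int (card U))"
  proof (rule boundsI[OF chains_lin[OF cover fin UV y(1)]])
    show "top_chain U (lin r c u) = dif U (\<lambda>T. lin r c (y T))"
    proof
      fix T
      have "dif U (\<lambda>T. lin r c (y T)) T = lin r c (top_chain U u T)"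
        unfolding y(2) by (rule dif_lin)
      then show "top_chain U (lin r c u) T = dif U (\<lambda>T. lin r c (y T)) T"
        by (cases "T = U") (simp_all add: top_chain_def lin_linear)
    qed
  qed
qed

text \<open>The values of the generators of degree \<open>U\<close> represent a basis of the top
  cohomology of \<open>Z\<close>, so their number is its dimension.\<close>

lemma cover_count:
  assumes "cohom Z U (int (card U)) b"
  shows "card {s. s < r \<and> W s = U} = (if b then 1 else 0)"
proof -
  have val: "top_chain U (c s) \<in> cycles Z U (int (card U))" if "s < r" "W s = U" for s
    using cover_value[OF cover that(1)] that(2) top_chain_chains[OF fin] dif_top_chain
    unfolding cycles_def by blast
  have nonzero: "top_chain U (c s) \<notin> bounds Z U (int (card U))" if s: "s < r" "W s = U" for s
  proof -
    have "unit_fun s \<in> free_part r W U" using s by (intro unit_fun_free_part) auto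
    then show ?thesis
      using top_bound_iff[of "unit_fun s"] s(2) unfolding lin_unit_fun[OF s(1)]
      by (metis unit_fun_apply(1) zero_neq_one)
  qed
  show ?thesis
  proof (cases b)
    case False
    then have "cycles Z U (int (card U)) \<subseteq> bounds Z U (int (card U))"
      using assms unfolding cohom_def by simp
    then have "{s. s < r \<and> W s = U} = {}" using val nonzero by blast
    then show ?thesis using False by simp
  next
    case True
    then obtain z where z: "z \<in> cycles Z U (int (card U))" "z \<notin> bounds Z U (int (card U))"
      "\<And>f. f \<in> cycles Z U (int (card U)) \<Longrightarrow> \<exists>a. f - scal a z \<in> bounds Z U (int (card U))"
      using assms unfolding cohom_def by auto
    have "z \<in> chains Z U (int (card U))" using z(1) unfolding cycles_def by blast
    then have z_top: "z = top_chain U (z U)" "z U \<in> Z U"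
      using chains_top[OF fin] chainsD(1) by blast+
    then obtain u where u: "u \<in> free_part r W U" "z U = lin r c u"
      using cover_image[OF cover fin UV, of U] by blast
    have "\<not> (\<forall>s. W s = U \<longrightarrow> u s = 0)"
      using top_bound_iff[OF u(1)] z(2) z_top(1) unfolding u(2) by simp
    then obtain s1 where s1: "W s1 = U" "u s1 \<noteq> 0" by blast
    then have "s1 < r" using free_partD(1)[OF u(1)] not_le by blast
    have "s2 = s1" if s2: "s2 < r" "W s2 = U" for s2
    proof (rule ccontr)
      assume ne: "s2 \<noteq> s1"
      obtain a1 where a1: "top_chain U (c s1) - scal a1 z \<in> bounds Z U (int (card U))"
        using z(3)[OF val[OF \<open>s1 < r\<close> s1(1)]] by blast
      obtain a2 where a2: "top_chain U (c s2) - scal a2 z \<in> bounds Z U (int (card U))"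
        using z(3)[OF val[OF s2]] by blast
      \<comment> \<open>Modulo boundaries both values are multiples of \<open>z\<close>. This
        combination eliminates \<open>z\<close>, so it represents a boundary and its coordinates
        \<open>a2\<close> and \<open>- a1\<close> must vanish.\<close>
      let ?u = "smul a2 (unit_fun s1) - smul a1 (unit_fun s2)"
      have u': "?u \<in> free_part r W U"
        using \<open>s1 < r\<close> s1(1) s2 by (intro subspaceD[OF subspace_free_part] unit_fun_free_part) auto
      have "scal a2 (top_chain U (c s1) - scal a1 z) - scal a1 (top_chain U (c s2) - scal a2 z)
          = top_chain U (lin r c ?u)"
        unfolding lin_linear lin_unit_fun[OF \<open>s1 < r\<close>] lin_unit_fun[OF s2(1)] top_chain_linear
        by (intro ext) (simp add: algebra_simps)
      then have "top_chain U (lin r c ?u) \<in> bounds Z U (int (card U))"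
        using bounds_linear(1)[OF Z bounds_linear(2)[OF Z a1] bounds_linear(2)[OF Z a2], of a2 a1] by simp
      then have zero: "\<forall>s. W s = U \<longrightarrow> ?u s = 0" using top_bound_iff[OF u'] by blast
      have "?u s1 = a2" "?u s2 = - a1" using ne by simp_all
      then have "a1 = 0" using zero s2(2) by (metis neg_equal_0_iff_equal)
      then have "top_chain U (c s1) - scal a1 z = top_chain U (c s1)"
        by (intro ext) simp
      then show False using a1 nonzero[OF \<open>s1 < r\<close> s1(1)] by simp
    qed
    then have "{s. s < r \<and> W s = U} = {s1}" using \<open>s1 < r\<close> s1(1) by blast
    then show ?thesis using True by simp
  qed
qed

end

section \<open>Existence of minimal covers and of squarefree resolutions\<close>

definition minimal_generators ::
  "(nat \<Rightarrow> 'k::field) set \<Rightarrow> (nat \<Rightarrow> 'k) set \<Rightarrow> (nat \<Rightarrow> 'k) set \<Rightarrow> bool" where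
  "minimal_generators A X G \<longleftrightarrow> finite G \<and> G \<subseteq> A \<and>
    (\<forall>z\<in>A. \<exists>a. z - (\<Sum>g\<in>G. smul (a g) g) \<in> X) \<and>
    (\<forall>a. (\<Sum>g\<in>G. smul (a g) g) \<in> X \<longrightarrow> (\<forall>g\<in>G. a g = 0))"

text \<open>Extend a basis of \<open>X\<close> to a basis of \<open>A\<close> and keep the added
  vectors. The bound \<open>r\<close> on the coordinates makes the spaces
  finite-dimensional.\<close>

lemma exists_minimal_generators:
  fixes A X :: "(nat \<Rightarrow> 'k::field) set"
  assumes A: "subspace A" "\<And>u s. u \<in> A \<Longrightarrow> r \<le> s \<Longrightarrow> u s = 0" and X: "subspace X" "X \<subseteq> A"
  shows "\<exists>G. minimal_generators A X G"
proof -
  interpret fv: vector_space "smul :: 'k \<Rightarrow> (nat \<Rightarrow> 'k) \<Rightarrow> nat \<Rightarrow> 'k"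
    by unfold_locales (simp_all add: smul_distribs)
  have sub: "fv.subspace Y" if "subspace Y" for Y
    unfolding fv.subspace_def using that by (simp add: subspace_def)
  obtain B0 where B0: "B0 \<subseteq> X" "fv.independent B0" "X \<subseteq> fv.span B0"
    by (rule fv.maximal_independent_subset)
  have "B0 \<subseteq> A" using B0(1) X(2) by blast
  obtain B where B: "B0 \<subseteq> B" "B \<subseteq> A" "fv.independent B" "A \<subseteq> fv.span B"
    by (rule fv.maximal_independent_subset_extend[OF \<open>B0 \<subseteq> A\<close> B0(2)])
  have span_B0: "fv.span B0 = X"
    using fv.span_minimal[OF B0(1) sub[OF X(1)]] B0(3) by blast
  have "A \<subseteq> fv.span (unit_fun ` {..<r})"
  proof
    fix u assume u: "u \<in> A"
    have "u = (\<Sum>s<r. smul (u s) (unit_fun s))"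
    proof
      fix x
      have "(\<Sum>s<r. smul (u s) (unit_fun s)) x = (\<Sum>s<r. if x = s then u s else 0)"
        unfolding sum_apply by (rule sum.cong) (auto simp: unit_fun_def)
      also have "\<dots> = (if x < r then u x else 0)" by simp
      also have "\<dots> = u x" using A(2)[OF u, of x] by auto
      finally show "u x = (\<Sum>s<r. smul (u s) (unit_fun s)) x" by simp
    qed
    moreover have "(\<Sum>s<r. smul (u s) (unit_fun s)) \<in> fv.span (unit_fun ` {..<r})"
      by (intro fv.span_sum fv.span_scale fv.span_base imageI)
    ultimately show "u \<in> fv.span (unit_fun ` {..<r})" by simp
  qed
  then have "B \<subseteq> fv.span (unit_fun ` {..<r})" using B(2) by blast
  then have finB: "finite B"
    using fv.independent_span_bound[OF _ B(3)] by blast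
  define G where "G = B - B0"
  have G: "finite G" "G \<subseteq> A" "B = B0 \<union> G" "B0 \<inter> G = {}"
    using finB B by (auto simp: G_def)
  have gen: "\<exists>a. z - (\<Sum>g\<in>G. smul (a g) g) \<in> X" if z: "z \<in> A" for z
  proof -
    have "z \<in> fv.span B" using B(4) z by blast
    then obtain a where a: "(\<Sum>g\<in>B. smul (a g) g) = z"
      unfolding fv.span_finite[OF finB] by blast
    have "z = (\<Sum>g\<in>B0. smul (a g) g) + (\<Sum>g\<in>G. smul (a g) g)"
      unfolding a[symmetric] G(3) using finB B(1) G finite_subset by (intro sum.union_disjoint) auto
    moreover have "(\<Sum>g\<in>B0. smul (a g) g) \<in> fv.span B0"
      by (intro fv.span_sum fv.span_scale fv.span_base)
    ultimately have "z - (\<Sum>g\<in>G. smul (a g) g) \<in> X" unfolding span_B0 by simp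
    then show ?thesis by blast
  qed
  have indep: "\<forall>g\<in>G. a g = 0" if a: "(\<Sum>g\<in>G. smul (a g) g) \<in> X" for a
  proof (rule ccontr)
    assume "\<not> (\<forall>g\<in>G. a g = 0)"
    then obtain h where h: "h \<in> G" "a h \<noteq> 0" by blast
    have split: "(\<Sum>g\<in>G. smul (a g) g) = smul (a h) h + (\<Sum>g\<in>G - {h}. smul (a g) g)"
      using G(1) h(1) by (rule sum.remove)
    have rest: "(\<Sum>g\<in>G - {h}. smul (a g) g) \<in> fv.span (B - {h})"
      using G(3) by (intro fv.span_sum fv.span_scale fv.span_base) auto
    have "X \<subseteq> fv.span (B - {h})"
      unfolding span_B0[symmetric] using G(3,4) h(1) by (intro fv.span_mono) auto
    then have "(\<Sum>g\<in>G. smul (a g) g) - (\<Sum>g\<in>G - {h}. smul (a g) g) \<in> fv.span (B - {h})"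
      using a rest by (intro fv.span_diff) auto
    then have "smul (a h) h \<in> fv.span (B - {h})" unfolding split by simp
    then have "smul (inverse (a h)) (smul (a h) h) \<in> fv.span (B - {h})" by (rule fv.span_scale)
    then have "h \<in> fv.span (B - {h})" using h(2) by simp
    then show False using B(3) h(1) G(3) unfolding fv.dependent_def by blast
  qed
  have "minimal_generators A X G"
    unfolding minimal_generators_def using G(1,2) gen indep by blast
  then show ?thesis by blast
qed

text \<open>In each degree \<open>U\<close>, choose a basis of \<open>Z U\<close> modulo the part
  generated in smaller degrees. Induction on \<open>U\<close> shows that these vectors generate; a
  relation of degree \<open>U\<close> puts the combination of generators of degree \<open>U\<close>
  into the smaller part, so their coefficients vanish.\<close>

lemma exists_min_cover:
  fixes Z :: "('k::field) sqf"
  assumes V: "finite V" and Z: "sqf_module Z" and bound: "\<And>U u s. u \<in> Z U \<Longrightarrow> m \<le> s \<Longrightarrow> u s = 0"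
  shows "\<exists>r W c. min_cover V Z r W c"
proof -
  \<comment> \<open>The sum of the subspaces \<open>Z (U - {x})\<close>, written as the least
    subspace containing them.\<close>
  define X where "X U = (\<Inter>Y\<in>{Y. subspace Y \<and> (\<forall>x\<in>U. Z (U - {x}) \<subseteq> Y)}. Y)" for U
  have X_sub: "subspace (X U)" for U
    unfolding X_def by (auto simp: subspace_def)
  have X_least: "X U \<subseteq> Y" if "subspace Y" "\<And>x. x \<in> U \<Longrightarrow> Z (U - {x}) \<subseteq> Y" for U Y
    unfolding X_def using that by blast
  have X_incl: "Z T \<subseteq> X U" if "T \<subset> U" for T U
  proof -
    obtain x where x: "x \<in> U" "T \<subseteq> U - {x}" using \<open>T \<subset> U\<close> by blast
    have "Z T \<subseteq> Z (U - {x})" using x(2) by (rule sqf_moduleD(2)[OF Z])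
    also have "\<dots> \<subseteq> X U" unfolding X_def using x(1) by blast
    finally show ?thesis .
  qed
  have XZ: "X U \<subseteq> Z U" for U
    using sqf_moduleD[OF Z] by (intro X_least) auto
  have "\<exists>G. minimal_generators (Z U) (X U) G" for U
  proof (rule exists_minimal_generators)
    show "subspace (Z U)" by (rule sqf_moduleD(1)[OF Z])
    show "u s = 0" if "u \<in> Z U" "m \<le> s" for u s using bound that .
  qed (rule X_sub, rule XZ)
  then obtain G where gens: "\<And>U. minimal_generators (Z U) (X U) (G U)"
    using choice[of "\<lambda>U. minimal_generators (Z U) (X U)"] by blast
  have G: "finite (G U)" "G U \<subseteq> Z U"
    "z \<in> Z U \<Longrightarrow> \<exists>a. z - (\<Sum>g\<in>G U. smul (a g) g) \<in> X U"
    "(\<Sum>g\<in>G U. smul (a g) g) \<in> X U \<Longrightarrow> g \<in> G U \<Longrightarrow> a g = 0" for U z a g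
    using gens[of U] unfolding minimal_generators_def by blast+
  \<comment> \<open>Pairing each generator with its degree keeps equal vectors in different degrees
    apart.\<close>
  define S where "S = (SIGMA U:Pow V. G U)"
  have "finite S" unfolding S_def using V G(1) by auto
  then obtain h where h: "bij_betw h {0..<card S} S" using ex_bij_betw_nat_finite by blast
  define r where "r = card S"
  define W where "W s = fst (h s)" for s
  define c where "c s = snd (h s)" for s
  have hS: "h s \<in> S" if "s < r" for s
    using h that unfolding r_def bij_betw_def by auto
  have W: "W s \<subseteq> V" "c s \<in> G (W s)" if "s < r" for s
    using hS[OF that] unfolding S_def W_def c_def by auto
  have bij: "bij_betw c {s. s < r \<and> W s = U} (G U)" if "U \<subseteq> V" for U
    unfolding bij_betw_def
  proof
    show "inj_on c {s. s < r \<and> W s = U}"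
    proof (rule inj_onI)
      fix s s' assume s: "s \<in> {s. s < r \<and> W s = U}" "s' \<in> {s. s < r \<and> W s = U}" "c s = c s'"
      then have "h s = h s'" unfolding W_def c_def by (auto intro: prod_eqI)
      then show "s = s'" using h s(1,2) unfolding bij_betw_def r_def by (auto dest: inj_onD)
    qed
    have "g \<in> c ` {s. s < r \<and> W s = U}" if g: "g \<in> G U" for g
    proof -
      have "(U, g) \<in> S" using g \<open>U \<subseteq> V\<close> by (simp add: S_def)
      then obtain s where "s < r" "h s = (U, g)"
        using h unfolding bij_betw_def r_def by (metis atLeastLessThan_iff imageE)
      then show ?thesis unfolding W_def c_def by (intro image_eqI[of _ _ s]) auto
    qed
    then show "c ` {s. s < r \<and> W s = U} = G U" using W(2) by blast
  qed
  have split: "lin r c u = (\<Sum>s\<in>{s. s < r \<and> W s = U}. smul (u s) (c s)) +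
      (\<Sum>s\<in>{s. s < r \<and> W s \<noteq> U}. smul (u s) (c s))" for u U
  proof -
    have "{..<r} = {s. s < r \<and> W s = U} \<union> {s. s < r \<and> W s \<noteq> U}" by auto
    then show ?thesis unfolding lin_def by (simp only:) (rule sum.union_disjoint; auto)
  qed
  have top: "(\<Sum>s\<in>{s. s < r \<and> W s = U}. smul (a (c s)) (c s)) = (\<Sum>g\<in>G U. smul (a g) g)"
    if "U \<subseteq> V" for U a
    using sum.reindex_bij_betw[OF bij[OF that], of "\<lambda>g. smul (a g) g"] .
  have rest: "(\<Sum>s\<in>{s. s < r \<and> W s \<noteq> U}. smul (u s) (c s)) \<in> X U" if u: "u \<in> free_part r W U" for u U
  proof (rule subspace_sum[OF X_sub])
    fix s assume s: "s \<in> {s. s < r \<and> W s \<noteq> U}"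
    show "smul (u s) (c s) \<in> X U"
    proof (cases "u s = 0")
      case True
      then show ?thesis using subspaceD(1)[OF X_sub] by simp
    next
      case False
      then have "W s \<subset> U" using u s by (auto simp: free_part_def)
      moreover have "c s \<in> Z (W s)" using W(2) G(2) s by blast
      ultimately have "c s \<in> X U" using X_incl by blast
      then show ?thesis by (rule subspaceD(3)[OF X_sub])
    qed
  qed
  have lin_in: "lin r c u \<in> Z U" if u: "u \<in> free_part r W U" for u U
    unfolding lin_def
  proof (rule subspace_sum[OF sqf_moduleD(1)[OF Z]])
    fix s assume s: "s \<in> {..<r}"
    show "smul (u s) (c s) \<in> Z U"
    proof (cases "u s = 0")
      case True
      then show ?thesis using subspaceD(1)[OF sqf_moduleD(1)[OF Z]] by simp
    next
      case False
      then have "W s \<subseteq> U" using u by (auto simp: free_part_def)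
      then have "c s \<in> Z U" using W(2)[of s] G(2)[of "W s"] s sqf_moduleD(2)[OF Z, of "W s" U] by auto
      then show ?thesis by (rule subspaceD(3)[OF sqf_moduleD(1)[OF Z]])
    qed
  qed
  have image_sub: "subspace (lin r c ` free_part r W U)" for U
    unfolding subspace_def
  proof (intro conjI ballI allI)
    show "0 \<in> lin r c ` free_part r W U"
      using lin_linear(4) subspaceD(1)[OF subspace_free_part] by (metis image_eqI)
  next
    fix x y assume "x \<in> lin r c ` free_part r W U" "y \<in> lin r c ` free_part r W U"
    then obtain u v where "u \<in> free_part r W U" "v \<in> free_part r W U" "x = lin r c u" "y = lin r c v" by blast
    then show "x + y \<in> lin r c ` free_part r W U"
      using lin_linear(1)[of r c u v] subspaceD(2)[OF subspace_free_part] by (metis image_eqI)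
  next
    fix a x assume "x \<in> lin r c ` free_part r W U"
    then obtain u where "u \<in> free_part r W U" "x = lin r c u" by blast
    then show "smul a x \<in> lin r c ` free_part r W U"
      using lin_linear(3)[of r c a u] subspaceD(3)[OF subspace_free_part] by (metis image_eqI)
  qed
  have gen: "Z U \<subseteq> lin r c ` free_part r W U" if "U \<subseteq> V" for U
  proof -
    have "finite U" using that V finite_subset by blast
    then show ?thesis using that
    proof (induction U rule: finite_psubset_induct)
      case (psubset U)
      have "X U \<subseteq> lin r c ` free_part r W U"
      proof (rule X_least[OF image_sub])
        fix x assume "x \<in> U"
        then have "Z (U - {x}) \<subseteq> lin r c ` free_part r W (U - {x})"
          using psubset.prems by (intro psubset.IH) auto
        then show "Z (U - {x}) \<subseteq> lin r c ` free_part r W U"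
          using free_part_mono[of "U - {x}" U r W] by blast
      qed
      show ?case
      proof
        fix z assume z: "z \<in> Z U"
        obtain a where a: "z - (\<Sum>g\<in>G U. smul (a g) g) \<in> X U" using G(3)[OF z] by blast
        define u where "u s = (if s < r \<and> W s = U then a (c s) else 0)" for s
        have "(\<Sum>s\<in>{s. s < r \<and> W s \<noteq> U}. smul (u s) (c s)) = 0"
          by (intro sum.neutral) (simp add: u_def)
        moreover have "(\<Sum>s\<in>{s. s < r \<and> W s = U}. smul (u s) (c s)) =
            (\<Sum>s\<in>{s. s < r \<and> W s = U}. smul (a (c s)) (c s))"
          by (intro sum.cong) (simp_all add: u_def)
        ultimately have "lin r c u = (\<Sum>g\<in>G U. smul (a g) g)"
          unfolding split[of u U] top[OF psubset.prems] by simp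
        moreover have "u \<in> free_part r W U" by (auto simp: free_part_def u_def)
        ultimately have "(\<Sum>g\<in>G U. smul (a g) g) \<in> lin r c ` free_part r W U" by (metis image_eqI)
        moreover have "z - (\<Sum>g\<in>G U. smul (a g) g) \<in> lin r c ` free_part r W U"
          using a \<open>X U \<subseteq> lin r c ` free_part r W U\<close> by blast
        ultimately have "(z - (\<Sum>g\<in>G U. smul (a g) g)) + (\<Sum>g\<in>G U. smul (a g) g) \<in> lin r c ` free_part r W U"
          by (intro subspaceD(2)[OF image_sub])
        then show "z \<in> lin r c ` free_part r W U" by simp
      qed
    qed
  qed
  have minimal: "u s = 0" if U: "U \<subseteq> V" and u: "u \<in> ker_part r W c U" and s: "W s = U" for u s U
  proof (cases "s < r")
    case False
    then show ?thesis using u unfolding ker_part_def free_part_def by auto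
  next
    case True
    have u': "u \<in> free_part r W U" "lin r c u = 0" using u unfolding ker_part_def by auto
    define I where "I = {s. s < r \<and> W s = U}"
    define a where "a g = u (the_inv_into I c g)" for g
    have inj: "inj_on c I" using bij[OF U] unfolding I_def bij_betw_def by blast
    have a: "a (c s) = u s" if "s \<in> I" for s
      unfolding a_def using the_inv_into_f_f[OF inj that] by simp
    have "(\<Sum>g\<in>G U. smul (a g) g) = (\<Sum>s\<in>I. smul (a (c s)) (c s))"
      using top[OF U, of a] unfolding I_def by simp
    also have "\<dots> = (\<Sum>s\<in>I. smul (u s) (c s))"
      by (intro sum.cong refl) (simp only: a)
    also have "\<dots> = - (\<Sum>s\<in>{s. s < r \<and> W s \<noteq> U}. smul (u s) (c s))"
      using u'(2) split[of u U] unfolding I_def by (simp add: eq_neg_iff_add_eq_0)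
    finally have "(\<Sum>g\<in>G U. smul (a g) g) \<in> X U"
      using subspaceD(4)[OF X_sub rest[OF u'(1)]] by simp
    moreover have "c s \<in> G U" using W(2)[OF True] s by simp
    ultimately have "a (c s) = 0" using G(4) by blast
    then show ?thesis using a[of s] True s by (simp add: I_def)
  qed
  have "min_cover V Z r W c"
    unfolding min_cover_def using W(1) lin_in gen minimal by blast
  then show ?thesis by blast
qed

definition sqf_resolution ::
  "nat set \<Rightarrow> nat set set \<Rightarrow> (nat \<Rightarrow> nat) \<Rightarrow> (nat \<Rightarrow> nat \<Rightarrow> nat set) \<Rightarrow> (nat \<Rightarrow> nat \<Rightarrow> nat \<Rightarrow> 'k::field) \<Rightarrow> bool"
  where "sqf_resolution V N r W c \<longleftrightarrow>
    min_cover V (nonfaces N) (r 0) (W 0) (c 0) \<and>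
    (\<forall>i. min_cover V (ker_part (r i) (W i) (c i)) (r (Suc i)) (W (Suc i)) (c (Suc i)))"

lemma exists_sqf_resolution:
  assumes "finite V" "up_closed N"
  shows "\<exists>r W (c :: nat \<Rightarrow> nat \<Rightarrow> nat \<Rightarrow> 'k::field). sqf_resolution V N r W c"
proof -
  define start :: "nat \<times> (nat \<Rightarrow> nat set) \<times> (nat \<Rightarrow> nat \<Rightarrow> 'k) \<Rightarrow> bool" where
    "start x \<longleftrightarrow> min_cover V (nonfaces N) (fst x) (fst (snd x)) (snd (snd x))" for x
  define step :: "nat \<times> (nat \<Rightarrow> nat set) \<times> (nat \<Rightarrow> nat \<Rightarrow> 'k) \<Rightarrow> nat \<times> (nat \<Rightarrow> nat set) \<times> (nat \<Rightarrow> nat \<Rightarrow> 'k) \<Rightarrow> bool"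
    where "step x y \<longleftrightarrow>
      min_cover V (ker_part (fst x) (fst (snd x)) (snd (snd x))) (fst y) (fst (snd y)) (snd (snd y))" for x y
  have ex_start: "\<exists>x. start x"
  proof -
    have "u s = 0" if "u \<in> nonfaces N U" "1 \<le> s" for u :: "nat \<Rightarrow> 'k" and U s
      using that by (auto simp: nonfaces_def)
    then obtain r W and c :: "nat \<Rightarrow> nat \<Rightarrow> 'k" where "min_cover V (nonfaces N) r W c"
      using exists_min_cover[OF assms(1) sqf_module_nonfaces[OF assms(2)]] by blast
    then have "start (r, W, c)" unfolding start_def by simp
    then show ?thesis ..
  qed
  have ex_step: "\<exists>y. step x y" for x
  proof -
    have bound: "u s = 0" if "u \<in> ker_part (fst x) (fst (snd x)) (snd (snd x)) U" "fst x \<le> s" for u U s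
    proof -
      have "u \<in> free_part (fst x) (fst (snd x)) U" using that(1) unfolding ker_part_def by simp
      then show ?thesis using that(2) by (rule free_partD(1))
    qed
    have "\<exists>r W c. min_cover V (ker_part (fst x) (fst (snd x)) (snd (snd x))) r W c"
    proof (rule exists_min_cover)
      show "finite V" by (rule assms(1))
      show "sqf_module (ker_part (fst x) (fst (snd x)) (snd (snd x)))" by (rule sqf_module_ker_part)
      show "u s = 0" if "u \<in> ker_part (fst x) (fst (snd x)) (snd (snd x)) U" "fst x \<le> s" for U u s
        using that by (rule bound)
    qed
    then obtain r W c where "min_cover V (ker_part (fst x) (fst (snd x)) (snd (snd x))) r W c" by blast
    then have "step x (r, W, c)" unfolding step_def by simp
    then show ?thesis ..
  qed
  have "\<exists>f. \<forall>n. (n = (0::nat) \<longrightarrow> start (f n)) \<and> step (f n) (f (Suc n))"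
    by (rule dependent_nat_choice) (use ex_start ex_step in auto)
  then obtain f where f: "start (f 0)" "\<And>n. step (f n) (f (Suc n))" by blast
  have "sqf_resolution V N (\<lambda>i. fst (f i)) (\<lambda>i. fst (snd (f i))) (\<lambda>i. snd (snd (f i)))"
    unfolding sqf_resolution_def using f(1)[unfolded start_def] f(2)[unfolded step_def] by simp
  then show ?thesis by blast
qed

text \<open>Hochster's formula for dimensions 0 and 1. Each passage to syzygies raises the
  cohomological degree by one, so after \<open>i\<close> of them degree \<open>card U - i\<close>
  has become the top degree \<open>card U\<close>, where \<open>cover_count\<close> reads off the
  generators.\<close>

lemma sqf_resolution_count:
  assumes res: "sqf_resolution V N r W (c :: nat \<Rightarrow> nat \<Rightarrow> nat \<Rightarrow> 'k::field)"
    and fin: "finite V" "U \<subseteq> V" and N: "up_closed N"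
    and coh: "cohom (nonfaces N :: 'k sqf) U (int (card U) - int i) b"
  shows "card {s. s < r i \<and> W i s = U} = (if b then 1 else 0)"
proof -
  have finU: "finite U" using fin finite_subset by blast
  define Z where "Z j = (case j of 0 \<Rightarrow> nonfaces N | Suc l \<Rightarrow> ker_part (r l) (W l) (c l))" for j
  have cover: "min_cover V (Z j) (r j) (W j) (c j)" for j
    using res unfolding sqf_resolution_def Z_def by (cases j) auto
  have "cohom (Z j) U (int (card U) - int i + int j) b" if "j \<le> i" for j
    using that
  proof (induction j)
    case 0
    then show ?case using coh by (simp add: Z_def)
  next
    case (Suc j)
    have "cohom (ker_part (r j) (W j) (c j)) U (int (card U) - int i + int (Suc j)) b"
    proof (rule cohom_kernel[OF cover finU fin(2)])
      show "int (card U) - int i + int (Suc j) \<le> int (card U)" using Suc.prems by simp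
      show "cohom (Z j) U (int (card U) - int i + int (Suc j) - 1) b"
      proof -
        have "int (card U) - int i + int (Suc j) - 1 = int (card U) - int i + int j" by simp
        moreover have "cohom (Z j) U (int (card U) - int i + int j) b"
          using Suc.prems by (intro Suc.IH) simp
        ultimately show ?thesis by (simp only:)
      qed
    qed
    then show ?case by (simp add: Z_def)
  qed
  then have "cohom (Z i) U (int (card U)) b" by force
  moreover have "sqf_module (Z i)"
    using sqf_module_nonfaces[OF N] sqf_module_ker_part by (cases i) (auto simp: Z_def)
  ultimately show ?thesis
    using cover_count[OF cover finU fin(2)] by blast
qed

section \<open>From squarefree modules to polynomial matrices\<close>

definition sqf_mon :: "nat set \<Rightarrow> nat \<Rightarrow>\<^sub>0 nat" where
  "sqf_mon W = (\<Sum>v\<in>W. Poly_Mapping.single v 1)"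

lemma lookup_mon:
  assumes "finite W"
  shows "lookup (sqf_mon W) v = (if v \<in> W then 1 else 0)"
proof -
  have "lookup (sqf_mon W) v = (\<Sum>w\<in>W. lookup (Poly_Mapping.single w (1::nat)) v)"
    unfolding sqf_mon_def by (rule Poly_Mapping.lookup_sum)
  also have "\<dots> = (\<Sum>w\<in>W. if v = w then 1 else 0)"
    by (rule sum.cong) (auto simp: lookup_single when_def)
  also have "\<dots> = (if v \<in> W then 1 else 0)"
    using assms by simp
  finally show ?thesis .
qed

lemma keys_mon: "finite W \<Longrightarrow> keys (sqf_mon W) = W"
  by (auto simp: in_keys_iff lookup_mon split: if_splits)

lemma mon_empty [simp]: "sqf_mon {} = 0"
  by (simp add: sqf_mon_def)

lemma mon_le:
  assumes "finite W" "W \<subseteq> keys m"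
  shows "sqf_mon W + (m - sqf_mon W) = m"
proof (rule poly_mapping_eqI)
  fix v
  show "lookup (sqf_mon W + (m - sqf_mon W)) v = lookup m v"
    using assms by (auto simp: lookup_add lookup_minus lookup_mon in_keys_iff)
qed

lemma mon_diff: "finite A \<Longrightarrow> B \<subseteq> A \<Longrightarrow> sqf_mon A - sqf_mon B = sqf_mon (A - B)"
  by (rule poly_mapping_eqI) (auto simp: lookup_minus lookup_mon finite_subset)

lemma homogeneous_zero [simp]: "homogeneous d 0"
  by (simp add: homogeneous_def)

lemma monom_deg_mon: "finite W \<Longrightarrow> monom_deg (sqf_mon W) = card W"
  by (simp add: monom_deg_def keys_mon lookup_mon)

lemma keys_add_nat: "keys (a + b) = keys a \<union> keys b" for a b :: "'a \<Rightarrow>\<^sub>0 nat"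
  by (auto simp: in_keys_iff lookup_add)

lemma keys_minus_nat: "keys (a - b) \<subseteq> keys a" for a b :: "'a \<Rightarrow>\<^sub>0 nat"
  by (auto simp: in_keys_iff lookup_minus)

lemma sum_monomials:
  fixes p :: "'a \<Rightarrow>\<^sub>0 'b::comm_monoid_add"
  shows "(\<Sum>l\<in>keys p. Poly_Mapping.single l (lookup p l)) = p"
proof (rule poly_mapping_eqI)
  fix k
  have "lookup (\<Sum>l\<in>keys p. Poly_Mapping.single l (lookup p l)) k =
      (\<Sum>l\<in>keys p. if k = l then lookup p l else 0)"
    unfolding Poly_Mapping.lookup_sum lookup_single by (rule sum.cong) (auto simp: when_def)
  also have "\<dots> = lookup p k" by (simp add: in_keys_iff)
  finally show "lookup (\<Sum>l\<in>keys p. Poly_Mapping.single l (lookup p l)) k =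
      lookup p k" .
qed

lemma single_mult_sum:
  "Poly_Mapping.single a c * p = (\<Sum>l\<in>keys p. Poly_Mapping.single (a + l) (c * lookup p l))"
  for p :: "('v, 'k::field) mpoly"
proof -
  have "Poly_Mapping.single a c * p = Poly_Mapping.single a c * (\<Sum>l\<in>keys p. Poly_Mapping.single l (lookup p l))"
    by (simp only: sum_monomials)
  also have "\<dots> = (\<Sum>l\<in>keys p. Poly_Mapping.single (a + l) (c * lookup p l))"
    by (simp add: sum_distrib_left mult_single)
  finally show ?thesis .
qed

lemma lookup_single_mult:
  fixes p :: "('v, 'k::field) mpoly"
  shows "lookup (Poly_Mapping.single a c * p) (a + b) = c * lookup p b"
    and "(\<And>b. m \<noteq> a + b) \<Longrightarrow> lookup (Poly_Mapping.single a c * p) m = 0"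
proof -
  have *: "lookup (Poly_Mapping.single a c * p) m = (\<Sum>l\<in>keys p. c * lookup p l when a + l = m)" for m
    unfolding single_mult_sum Poly_Mapping.lookup_sum lookup_single ..
  have "lookup (Poly_Mapping.single a c * p) (a + b) = (\<Sum>l\<in>keys p. if b = l then c * lookup p l else 0)"
    unfolding * by (rule sum.cong) (auto simp: when_def)
  also have "\<dots> = c * lookup p b"
    by (simp add: in_keys_iff)
  finally show "lookup (Poly_Mapping.single a c * p) (a + b) = c * lookup p b" .
  show "lookup (Poly_Mapping.single a c * p) m = 0" if "\<And>b. m \<noteq> a + b"
    unfolding * by (rule sum.neutral) (use that in \<open>auto simp: when_def\<close>)
qed

lemma polys_add: "p \<in> polys V \<Longrightarrow> q \<in> polys V \<Longrightarrow> p + q \<in> polys V"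
  unfolding polys_def using keys_add by fastforce

lemma polys_zero [simp]: "0 \<in> polys V" and polys_one [simp]: "1 \<in> polys V"
  by (auto simp: polys_def)

lemma polys_uminus: "p \<in> polys V \<Longrightarrow> - p \<in> polys V"
  by (simp add: polys_def)

lemma polys_minus: "p \<in> polys V \<Longrightarrow> q \<in> polys V \<Longrightarrow> p - q \<in> polys V"
  using polys_add[of p V "- q"] polys_uminus[of q V] by simp

lemma polys_mult:
  assumes "p \<in> polys V" "q \<in> polys V"
  shows "p * q \<in> polys V"
proof -
  have "keys m \<subseteq> V" if m: "m \<in> keys (p * q)" for m
  proof -
    obtain a b where "a \<in> keys p" "b \<in> keys q" "m = a + b"
      using m keys_mult[of p q] by blast
    moreover from this have "keys a \<subseteq> V" "keys b \<subseteq> V"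
      using assms unfolding polys_def by blast+
    ultimately show ?thesis using keys_add[of a b] by blast
  qed
  then show ?thesis unfolding polys_def by blast
qed

lemma polys_sum: "(\<And>x. x \<in> A \<Longrightarrow> f x \<in> polys V) \<Longrightarrow> sum f A \<in> polys V"
  by (induction A rule: infinite_finite_induct) (auto intro: polys_add)

lemma polys_single: "keys m \<subseteq> V \<Longrightarrow> Poly_Mapping.single m c \<in> polys V"
  by (auto simp: polys_def split: if_splits)

lemma mult_mat_vec_index:
  assumes "A \<in> carrier_mat n m" "u \<in> carrier_vec m" "q < n"
  shows "(A *\<^sub>v u) $ q = (\<Sum>s<m. A $$ (q, s) * u $ s)"
  using assms by (simp add: scalar_prod_def lessThan_atLeast0)

lemma free_module_mult:
  assumes "A \<in> carrier_mat n m" "\<And>q s. q < n \<Longrightarrow> s < m \<Longrightarrow> A $$ (q, s) \<in> polys V" "u \<in> free_module V m"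
  shows "A *\<^sub>v u \<in> free_module V n"
proof -
  have u: "u \<in> carrier_vec m" "\<And>s. s < m \<Longrightarrow> u $ s \<in> polys V"
    using assms(3) by (auto simp: free_module_def)
  have "(A *\<^sub>v u) $ q \<in> polys V" if "q < n" for q
    unfolding mult_mat_vec_index[OF assms(1) u(1) that]
    using assms(2) u(2) that by (intro polys_sum polys_mult) auto
  then show ?thesis
    using mult_mat_vec_carrier[OF assms(1) u(1)] by (simp add: free_module_def)
qed

text \<open>The component of \<open>u\<close> in the multidegree \<open>m\<close>, in coordinates with respect to the basis elements
  of the free module with squarefree degrees \<open>W\<close>.\<close>

definition component ::
  "nat \<Rightarrow> (nat \<Rightarrow> nat set) \<Rightarrow> (nat, 'k::field) mpoly vec \<Rightarrow> (nat \<Rightarrow>\<^sub>0 nat) \<Rightarrow> nat \<Rightarrow> 'k" where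
  "component r W u m = (\<lambda>s. if s < r \<and> W s \<subseteq> keys m then lookup (u $ s) (m - sqf_mon (W s)) else 0)"

text \<open>Subtraction of exponents is truncated. It is a true quotient of monomials whenever
  \<open>W q \<subseteq> W' s\<close>; in the other positions the coefficient vanishes once
  \<open>c s\<close> lies in \<open>free_part r W (W' s)\<close>.\<close>

definition pmat ::
  "nat \<Rightarrow> (nat \<Rightarrow> nat set) \<Rightarrow> nat \<Rightarrow> (nat \<Rightarrow> nat set) \<Rightarrow> (nat \<Rightarrow> nat \<Rightarrow> 'k::field) \<Rightarrow> (nat, 'k) mpoly mat" where
  "pmat r W r' W' c = mat r r' (\<lambda>(q, s). Poly_Mapping.single (sqf_mon (W' s) - sqf_mon (W q)) (c s q))"

lemma pmat_carrier: "pmat r W r' W' c \<in> carrier_mat r r'"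
  by (simp add: pmat_def)

lemma pmat_index: "q < r \<Longrightarrow> s < r' \<Longrightarrow>
    pmat r W r' W' c $$ (q, s) = Poly_Mapping.single (sqf_mon (W' s) - sqf_mon (W q)) (c s q)"
  by (simp add: pmat_def)

lemma component_free_part: "component r W u m \<in> free_part r W (keys m)"
  by (simp add: component_def free_part_def)

lemma component_outside:
  assumes "u \<in> free_module V r" "\<And>s. s < r \<Longrightarrow> finite (W s) \<and> W s \<subseteq> V" "\<not> keys m \<subseteq> V"
  shows "component r W u m = 0"
proof
  fix s
  have "lookup (u $ s) (m - sqf_mon (W s)) = 0" if s: "s < r" "W s \<subseteq> keys m"
  proof (rule ccontr)
    assume "lookup (u $ s) (m - sqf_mon (W s)) \<noteq> 0"
    then have "m - sqf_mon (W s) \<in> keys (u $ s)" by (simp add: in_keys_iff)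
    then have "keys (m - sqf_mon (W s)) \<subseteq> V"
      using assms(1) s(1) by (auto simp: free_module_def polys_def)
    moreover have "keys m = keys (sqf_mon (W s)) \<union> keys (m - sqf_mon (W s))"
      using mon_le[of "W s" m] s assms(2) keys_add_nat by metis
    ultimately show False using assms(2)[OF s(1)] assms(3) keys_mon[of "W s"] by auto
  qed
  then show "component r W u m s = 0 s" by (simp add: component_def)
qed

lemma component_inject:
  assumes "u \<in> carrier_vec r" "u' \<in> carrier_vec r" "\<And>s. s < r \<Longrightarrow> finite (W s)"
    and "\<And>m. component r W u m = component r W u' m"
  shows "u = u'"
proof (rule eq_vecI)
  show "dim_vec u = dim_vec u'" using assms(1,2) by simp
  fix s assume "s < dim_vec u'"
  then have s: "s < r" using assms(2) by simp
  show "u $ s = u' $ s"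
  proof (rule poly_mapping_eqI)
    fix l
    let ?m = "sqf_mon (W s) + l"
    have "W s \<subseteq> keys ?m" using keys_mon[OF assms(3)[OF s]] keys_add_nat[of "sqf_mon (W s)" l] by blast
    then show "lookup (u $ s) l = lookup (u' $ s) l"
      using fun_cong[OF assms(4)[of ?m], of s] s by (simp add: component_def)
  qed
qed

lemma component_finite:
  assumes "\<And>s. s < r \<Longrightarrow> finite (W s)"
  shows "finite {m. component r W u m \<noteq> 0}"
proof -
  have "{m. component r W u m \<noteq> 0} \<subseteq> (\<Union>s<r. (\<lambda>l. sqf_mon (W s) + l) ` keys (u $ s))"
  proof
    fix m assume "m \<in> {m. component r W u m \<noteq> 0}"
    then obtain s where "component r W u m s \<noteq> 0" by (auto simp: fun_eq_iff)
    then have s: "s < r" "W s \<subseteq> keys m" "lookup (u $ s) (m - sqf_mon (W s)) \<noteq> 0"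
      by (auto simp: component_def split: if_splits)
    then have "m = sqf_mon (W s) + (m - sqf_mon (W s))" "m - sqf_mon (W s) \<in> keys (u $ s)"
      using mon_le[of "W s" m] assms by (simp_all add: in_keys_iff)
    then show "m \<in> (\<Union>s<r. (\<lambda>l. sqf_mon (W s) + l) ` keys (u $ s))" using s(1) by blast
  qed
  moreover have "finite (\<Union>s<r. (\<lambda>l. sqf_mon (W s) + l) ` keys (u $ s))" by auto
  ultimately show ?thesis by (rule finite_subset)
qed

lemma component_surj:
  fixes w :: "(nat \<Rightarrow>\<^sub>0 nat) \<Rightarrow> nat \<Rightarrow> 'k::field"
  assumes "finite M" "\<And>m. m \<notin> M \<Longrightarrow> w m = 0" "\<And>m. w m \<in> free_part r W (keys m)"
    "\<And>m. m \<in> M \<Longrightarrow> keys m \<subseteq> V" "\<And>s. s < r \<Longrightarrow> finite (W s)"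
  obtains u where "u \<in> free_module V r" "\<And>m. component r W u m = w m"
proof -
  define u where "u = vec r (\<lambda>s. \<Sum>m\<in>{m \<in> M. W s \<subseteq> keys m}. Poly_Mapping.single (m - sqf_mon (W s)) (w m s))"
  have "keys (m - sqf_mon (W s)) \<subseteq> V" if "m \<in> M" for m s
  proof -
    have "keys (m - sqf_mon (W s)) \<subseteq> keys m"
      by (auto simp: in_keys_iff lookup_minus)
    then show ?thesis using assms(4)[OF that] by blast
  qed
  then have "u \<in> free_module V r"
    unfolding free_module_def u_def by (auto intro!: polys_sum polys_single)
  moreover have "component r W u m = w m" for m
  proof
    fix s
    show "component r W u m s = w m s"
    proof (cases "s < r \<and> W s \<subseteq> keys m")
      case False
      then have "w m s = 0" using assms(3)[of m] by (auto simp: free_part_def)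
      then show ?thesis using False by (auto simp: component_def)
    next
      case s: True
      have "component r W u m s = lookup (u $ s) (m - sqf_mon (W s))"
        using s by (simp add: component_def)
      also have "\<dots> = (\<Sum>m'\<in>{m' \<in> M. W s \<subseteq> keys m'}. w m' s when m' - sqf_mon (W s) = m - sqf_mon (W s))"
        using s by (simp add: u_def Poly_Mapping.lookup_sum lookup_single)
      also have "\<dots> = (\<Sum>m'\<in>{m' \<in> M. W s \<subseteq> keys m'}. if m = m' then w m' s else 0)"
      proof (rule sum.cong[OF refl])
        fix m' assume "m' \<in> {m' \<in> M. W s \<subseteq> keys m'}"
        then have "m' - sqf_mon (W s) = m - sqf_mon (W s) \<longleftrightarrow> m = m'"
          using mon_le[of "W s" m'] mon_le[of "W s" m] s assms(5) by (metis (no_types, lifting) mem_Collect_eq)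
        then show "(w m' s when m' - sqf_mon (W s) = m - sqf_mon (W s)) = (if m = m' then w m' s else 0)"
          by (simp add: when_def)
      qed
      also have "\<dots> = (if m \<in> M then w m s else 0)"
        using assms(1) s by simp
      also have "\<dots> = w m s" using assms(2)[of m] by auto
      finally show ?thesis .
    qed
  qed
  ultimately show ?thesis by (rule that)
qed

text \<open>The monomials in the matrix only move exponents, so in every multidegree the map is
  given by the same constants \<open>c\<close>. This reduces polynomial matrices to linear
  algebra.\<close>

lemma component_mult:
  assumes u: "u \<in> carrier_vec r'"
    and W: "\<And>s. s < r \<Longrightarrow> finite (W s)" "\<And>s. s < r' \<Longrightarrow> finite (W' s)"
    and c: "\<And>s. s < r' \<Longrightarrow> c s \<in> free_part r W (W' s)"
  shows "component r W (pmat r W r' W' c *\<^sub>v u) m = lin r' c (component r' W' u m)"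
proof
  fix q
  have rhs: "lin r' c (component r' W' u m) q = (\<Sum>s<r'. component r' W' u m s * c s q)"
    by (simp add: lin_def sum_apply)
  show "component r W (pmat r W r' W' c *\<^sub>v u) m q = lin r' c (component r' W' u m) q"
  proof (cases "q < r \<and> W q \<subseteq> keys m")
    case False
    have "component r' W' u m s * c s q = 0" if "s < r'" for s
    proof (rule ccontr)
      assume "component r' W' u m s * c s q \<noteq> 0"
      then have "W' s \<subseteq> keys m" "c s q \<noteq> 0" by (auto simp: component_def split: if_splits)
      moreover from this have "q < r" "W q \<subseteq> W' s" using c[OF that] by (auto simp: free_part_def)
      ultimately show False using False by blast
    qed
    then have "(\<Sum>s<r'. component r' W' u m s * c s q) = 0"
      by (intro sum.neutral) simp
    moreover have "component r W (pmat r W r' W' c *\<^sub>v u) m q = 0"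
      using False by (auto simp: component_def)
    ultimately show ?thesis unfolding rhs by simp
  next
    case q: True
    have "component r W (pmat r W r' W' c *\<^sub>v u) m q = lookup ((pmat r W r' W' c *\<^sub>v u) $ q) (m - sqf_mon (W q))"
      using q by (simp add: component_def)
    also have "\<dots> = (\<Sum>s<r'. lookup (Poly_Mapping.single (sqf_mon (W' s) - sqf_mon (W q)) (c s q) * u $ s) (m - sqf_mon (W q)))"
      using q by (simp add: mult_mat_vec_index[OF pmat_carrier u] Poly_Mapping.lookup_sum pmat_index)
    also have "\<dots> = (\<Sum>s<r'. component r' W' u m s * c s q)"
    proof (rule sum.cong[OF refl])
      fix s assume "s \<in> {..<r'}"
      then have s: "s < r'" by simp
      show "lookup (Poly_Mapping.single (sqf_mon (W' s) - sqf_mon (W q)) (c s q) * u $ s) (m - sqf_mon (W q)) =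
          component r' W' u m s * c s q"
      proof (cases "c s q = 0")
        case True
        then show ?thesis by simp
      next
        case nz: False
        then have sub: "W q \<subseteq> W' s" using c[OF s] by (auto simp: free_part_def)
        let ?a = "sqf_mon (W' s) - sqf_mon (W q)"
        have a: "sqf_mon (W q) + ?a = sqf_mon (W' s)"
          using mon_le[of "W q" "sqf_mon (W' s)"] W q s sub keys_mon by simp
        have m: "sqf_mon (W q) + (m - sqf_mon (W q)) = m" using mon_le W(1) q by blast
        show ?thesis
        proof (cases "W' s \<subseteq> keys m")
          case True
          have "sqf_mon (W q) + (?a + (m - sqf_mon (W' s))) = sqf_mon (W q) + (m - sqf_mon (W q))"
            unfolding m add.assoc[symmetric] a using mon_le[OF W(2)[OF s] True] .
          then have "m - sqf_mon (W q) = ?a + (m - sqf_mon (W' s))" by (metis add_left_cancel)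
          then show ?thesis
            using True s by (simp add: lookup_single_mult(1) component_def)
        next
          case False
          have "m - sqf_mon (W q) \<noteq> ?a + b" for b
          proof
            assume eq: "m - sqf_mon (W q) = ?a + b"
            have "m = sqf_mon (W q) + (?a + b)"
              unfolding eq[symmetric] by (rule m[symmetric])
            then have m_eq: "m = sqf_mon (W' s) + b"
              unfolding add.assoc[symmetric] a .
            have "keys m = keys (sqf_mon (W' s)) \<union> keys b"
              by (rule trans[OF arg_cong[OF m_eq, of keys] keys_add_nat])
            then have "keys (sqf_mon (W' s)) \<subseteq> keys m" by blast
            then show False using False keys_mon[OF W(2)[OF s]] by simp
          qed
          then show ?thesis using False by (simp add: lookup_single_mult(2) component_def)
        qed
      qed
    qed
    finally show ?thesis unfolding rhs .
  qed
qed

text \<open>Membership in the image is tested in each multidegree \<open>m\<close>, and there only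
  the support \<open>keys m\<close> matters. If the support leaves \<open>V\<close>, all components
  vanish.\<close>

lemma image_pmat:
  fixes Z :: "('k::field) sqf"
  assumes V: "finite V" and W: "\<And>s. s < r \<Longrightarrow> W s \<subseteq> V"
    and cover: "min_cover V Z r' W' c" and Z: "sqf_module Z" "\<And>T. Z T \<subseteq> free_part r W T"
  shows "(\<lambda>u. pmat r W r' W' c *\<^sub>v u) ` free_module V r' =
    {u \<in> free_module V r. \<forall>m. component r W u m \<in> Z (keys m)}"
proof -
  have W': "\<And>s. s < r' \<Longrightarrow> W' s \<subseteq> V" using min_coverD(1)[OF cover] .
  have fin: "\<And>s. s < r \<Longrightarrow> finite (W s)" "\<And>s. s < r' \<Longrightarrow> finite (W' s)"
    by (rule finite_subset[OF W V], assumption) (rule finite_subset[OF W' V], assumption)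
  have c: "c s \<in> free_part r W (W' s)" if "s < r'" for s
    using cover_value[OF cover that] Z(2) by blast
  have polys: "pmat r W r' W' c $$ (q, s) \<in> polys V" if "q < r" "s < r'" for q s
  proof -
    have "keys (sqf_mon (W' s) - sqf_mon (W q)) \<subseteq> V"
      using keys_minus_nat[of "sqf_mon (W' s)" "sqf_mon (W q)"] W'[OF that(2)]
      unfolding keys_mon[OF fin(2)[OF that(2)]] by (rule subset_trans)
    then show ?thesis unfolding pmat_index[OF that] by (rule polys_single)
  qed
  show ?thesis
  proof (intro Set.equalityI subsetI)
    fix x assume "x \<in> (\<lambda>u. pmat r W r' W' c *\<^sub>v u) ` free_module V r'"
    then obtain u where u: "u \<in> free_module V r'" and x: "x = pmat r W r' W' c *\<^sub>v u" by blast
    have uc: "u \<in> carrier_vec r'" using u by (simp add: free_module_def)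
    have "component r W x m \<in> Z (keys m)" for m
    proof -
      have eq: "component r W x m = lin r' c (component r' W' u m)"
        unfolding x using uc fin c by (intro component_mult)
      show ?thesis
      proof (cases "keys m \<subseteq> V")
        case True
        have "lin r' c (component r' W' u m) \<in> lin r' c ` free_part r' W' (keys m)"
          using component_free_part[of r' W' u m] by blast
        then have "lin r' c (component r' W' u m) \<in> Z (keys m)"
          using min_coverD(2)[OF cover True] by simp
        then show ?thesis using eq by simp
      next
        case False
        have "component r' W' u m = 0"
          using u fin(2) W' False by (intro component_outside) auto
        then have "component r W x m = 0" unfolding eq by (simp add: lin_linear)
        then show ?thesis using subspaceD(1)[OF sqf_moduleD(1)[OF Z(1)]] by simp
      qed
    qed
    moreover have "x \<in> free_module V r"
      unfolding x using pmat_carrier polys u by (rule free_module_mult)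
    ultimately show "x \<in> {u \<in> free_module V r. \<forall>m. component r W u m \<in> Z (keys m)}" by blast
  next
    fix x assume "x \<in> {u \<in> free_module V r. \<forall>m. component r W u m \<in> Z (keys m)}"
    then have x: "x \<in> free_module V r" "\<And>m. component r W x m \<in> Z (keys m)" by blast+
    \<comment> \<open>The chosen preimage of 0 is 0, so only finitely many components are nonzero
      and they assemble into a vector of polynomials.\<close>
    have "\<exists>w. lin r' c w = component r W x m \<and> w \<in> free_part r' W' (keys m) \<and>
        (component r W x m = 0 \<longrightarrow> w = 0)" for m
    proof (cases "component r W x m = 0")
      case True
      then show ?thesis
        using subspaceD(1)[OF subspace_free_part] by (intro exI[of _ 0]) (simp add: lin_linear)
    next
      case False
      then have "keys m \<subseteq> V" using component_outside[OF x(1), of W m] fin(1) W by blast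
      then have "component r W x m \<in> lin r' c ` free_part r' W' (keys m)"
        using x(2)[of m] min_coverD(2)[OF cover] by simp
      then show ?thesis using False by auto
    qed
    then have "\<exists>w. \<forall>m. lin r' c (w m) = component r W x m \<and> w m \<in> free_part r' W' (keys m) \<and>
        (component r W x m = 0 \<longrightarrow> w m = 0)"
      by (intro choice allI)
    then obtain w where w: "\<And>m. lin r' c (w m) = component r W x m"
      "\<And>m. w m \<in> free_part r' W' (keys m)" "\<And>m. component r W x m = 0 \<Longrightarrow> w m = 0"
      by blast
    let ?M = "{m. component r W x m \<noteq> 0}"
    have M: "finite ?M" using fin(1) by (rule component_finite)
    have M_keys: "keys m \<subseteq> V" if "m \<in> ?M" for m
      using component_outside[OF x(1), of W m] fin(1) W that by blast
    have w_out: "w m = 0" if "m \<notin> ?M" for m using w(3) that by blast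
    obtain u where u: "u \<in> free_module V r'" "\<And>m. component r' W' u m = w m"
      by (rule component_surj[OF M w_out w(2) M_keys fin(2)]) blast+
    have uc: "u \<in> carrier_vec r'" using u by (simp add: free_module_def)
    have "pmat r W r' W' c *\<^sub>v u = x"
    proof (rule component_inject[of _ r _ W])
      show "pmat r W r' W' c *\<^sub>v u \<in> carrier_vec r" by (rule mult_mat_vec_carrier[OF pmat_carrier uc])
      show "x \<in> carrier_vec r" using x(1) by (simp add: free_module_def)
      show "finite (W s)" if "s < r" for s using fin(1) that .
      show "component r W (pmat r W r' W' c *\<^sub>v u) m = component r W x m" for m
      proof -
        have "component r W (pmat r W r' W' c *\<^sub>v u) m = lin r' c (component r' W' u m)"
          using uc fin c by (intro component_mult)
        then show ?thesis unfolding u(2) w(1) .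
      qed
    qed
    then show "x \<in> (\<lambda>u. pmat r W r' W' c *\<^sub>v u) ` free_module V r'" using u(1) by blast
  qed
qed

lemma kernel_pmat:
  fixes c :: "nat \<Rightarrow> nat \<Rightarrow> 'k::field"
  assumes u: "u \<in> carrier_vec r'"
    and W: "\<And>s. s < r \<Longrightarrow> finite (W s)" "\<And>s. s < r' \<Longrightarrow> finite (W' s)"
    and c: "\<And>s. s < r' \<Longrightarrow> c s \<in> free_part r W (W' s)"
  shows "pmat r W r' W' c *\<^sub>v u = 0\<^sub>v r \<longleftrightarrow>
    (\<forall>m. component r' W' u m \<in> ker_part r' W' c (keys m))"
proof -
  have zero: "component r W (0\<^sub>v r :: (nat, 'k) mpoly vec) m = 0" for m
    by (simp add: component_def fun_eq_iff)
  have "pmat r W r' W' c *\<^sub>v u = 0\<^sub>v r \<longleftrightarrow> (\<forall>m. component r W (pmat r W r' W' c *\<^sub>v u) m = 0)"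
  proof
    assume "pmat r W r' W' c *\<^sub>v u = 0\<^sub>v r"
    then show "\<forall>m. component r W (pmat r W r' W' c *\<^sub>v u) m = 0" using zero by simp
  next
    assume all: "\<forall>m. component r W (pmat r W r' W' c *\<^sub>v u) m = 0"
    show "pmat r W r' W' c *\<^sub>v u = 0\<^sub>v r"
    proof (rule component_inject[of _ r _ W])
      show "pmat r W r' W' c *\<^sub>v u \<in> carrier_vec r" by (rule mult_mat_vec_carrier[OF pmat_carrier u])
      show "component r W (pmat r W r' W' c *\<^sub>v u) m = component r W (0\<^sub>v r) m" for m
        using all zero by simp
    qed (use W(1) in auto)
  qed
  also have "\<dots> \<longleftrightarrow> (\<forall>m. lin r' c (component r' W' u m) = 0)"
    using component_mult[OF u W c] by simp
  also have "\<dots> \<longleftrightarrow> (\<forall>m. component r' W' u m \<in> ker_part r' W' c (keys m))"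
    unfolding ker_part_def using component_free_part[of r' W' u] by simp
  finally show ?thesis .
qed

lemma homogeneous_single: "int (monom_deg m) = d \<Longrightarrow> homogeneous d (Poly_Mapping.single m c)"
  by (auto simp: homogeneous_def split: if_splits)

definition sqf_ideal :: "nat set \<Rightarrow> nat set set \<Rightarrow> (nat, 'k::field) mpoly set" where
  "sqf_ideal V N = {p \<in> polys V. \<forall>m\<in>keys p. keys m \<in> N}"

theorem sqf_resolution_minimal:
  fixes c :: "nat \<Rightarrow> nat \<Rightarrow> nat \<Rightarrow> 'k::field"
  assumes V: "finite V" and N: "up_closed N" and res: "sqf_resolution V N r W c"
  shows "minimal_graded_free_resolution V (sqf_ideal V N) r (\<lambda>i s. int (card (W i s)))
    (vec (r 0) (\<lambda>s. Poly_Mapping.single (sqf_mon (W 0 s)) (c 0 s 0)))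
    (\<lambda>i. pmat (r i) (W i) (r (Suc i)) (W (Suc i)) (c (Suc i)))"
proof -
  let ?D = "\<lambda>i. pmat (r i) (W i) (r (Suc i)) (W (Suc i)) (c (Suc i))"
  let ?g = "vec (r 0) (\<lambda>s. Poly_Mapping.single (sqf_mon (W 0 s)) (c 0 s 0))"
  \<comment> \<open>The augmentation as a one-row matrix whose target has a single basis element of
    empty degree, so that \<open>image_pmat\<close> and \<open>kernel_pmat\<close> apply to it as
    well.\<close>
  let ?G = "pmat 1 (\<lambda>_. {}) (r 0) (W 0) (c 0)"
  have cov0: "min_cover V (nonfaces N) (r 0) (W 0) (c 0)"
    and covS: "min_cover V (ker_part (r i) (W i) (c i)) (r (Suc i)) (W (Suc i)) (c (Suc i))" for i
    using res unfolding sqf_resolution_def by blast+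
  have WV: "W i s \<subseteq> V" if "s < r i" for i s
    using min_coverD(1)[OF cov0] min_coverD(1)[OF covS] that by (cases i) blast+
  have fin: "finite (W i s)" if "s < r i" for i s
    using WV[OF that] V finite_subset by blast
  have nonfaces_sub: "nonfaces N T \<subseteq> (free_part 1 (\<lambda>_. {}) T :: (nat \<Rightarrow> 'k) set)" for T
    by (auto simp: nonfaces_def free_part_def)
  have c0: "c 0 s \<in> free_part 1 (\<lambda>_. {}) (W 0 s)" if "s < r 0" for s
    using cover_value[OF cov0 that] nonfaces_sub by blast
  have cS_ker: "c (Suc i) s \<in> ker_part (r i) (W i) (c i) (W (Suc i) s)" if "s < r (Suc i)" for i s
    using cover_value[OF covS that] .
  have cS: "c (Suc i) s \<in> free_part (r i) (W i) (W (Suc i) s)" if "s < r (Suc i)" for i s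
    using cS_ker[OF that] unfolding ker_part_def by blast
  have ker_sub: "ker_part (r i) (W i) (c i) T \<subseteq> free_part (r i) (W i) T" for i T
    unfolding ker_part_def by blast
  have G_mult: "(?G *\<^sub>v u) $ 0 = ?g \<bullet> u" "?G *\<^sub>v u \<in> carrier_vec 1" if u: "u \<in> carrier_vec (r 0)" for u
  proof -
    have "(?G *\<^sub>v u) $ 0 = (\<Sum>s<r 0. ?G $$ (0, s) * u $ s)"
      by (rule mult_mat_vec_index[OF pmat_carrier u]) simp
    also have "\<dots> = ?g \<bullet> u"
      using u by (simp add: pmat_index scalar_prod_def lessThan_atLeast0)
    finally show "(?G *\<^sub>v u) $ 0 = ?g \<bullet> u" .
    show "?G *\<^sub>v u \<in> carrier_vec 1" by (rule mult_mat_vec_carrier[OF pmat_carrier u])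
  qed
  have carrier: "u \<in> carrier_vec j" if "u \<in> free_module V j" for u :: "(nat, 'k) mpoly vec" and j
    using that by (simp add: free_module_def)

  have g_free: "?g \<in> free_module V (r 0)"
  proof -
    have "keys (sqf_mon (W 0 s)) \<subseteq> V" if "s < r 0" for s
      using WV[OF that] unfolding keys_mon[OF fin[OF that]] .
    then show ?thesis by (simp add: free_module_def polys_single)
  qed
  have g_hom: "\<forall>s<r 0. homogeneous (int (card (W 0 s))) (?g $ s)"
    using fin by (auto simp: monom_deg_mon intro!: homogeneous_single)
  have D_carrier: "\<forall>i. ?D i \<in> carrier_mat (r i) (r (Suc i))"
    using pmat_carrier by blast
  have D_entry: "?D i $$ (q, s) \<in> polys V \<and>
      homogeneous (int (card (W (Suc i) s)) - int (card (W i q))) (?D i $$ (q, s)) \<and>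
      lookup (?D i $$ (q, s)) 0 = 0" if qs: "q < r i" "s < r (Suc i)" for i q s
  proof (cases "c (Suc i) s q = 0")
    case True
    then show ?thesis unfolding pmat_index[OF qs] by simp
  next
    case False
    then have sub: "W i q \<subseteq> W (Suc i) s"
      using cS[OF qs(2)] by (auto simp: free_part_def)
    have eq: "sqf_mon (W (Suc i) s) - sqf_mon (W i q) = sqf_mon (W (Suc i) s - W i q)"
      by (rule mon_diff[OF fin[OF qs(2)] sub])
    have fin': "finite (W (Suc i) s - W i q)" using fin[OF qs(2)] by blast
    have "card (W (Suc i) s - W i q) = card (W (Suc i) s) - card (W i q)"
      using fin[OF qs(1)] sub by (rule card_Diff_subset)
    moreover have "card (W i q) \<le> card (W (Suc i) s)"
      using fin[OF qs(2)] sub by (rule card_mono)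
    \<comment> \<open>Otherwise column \<open>s\<close> would be a relation in degree
      \<open>W i q\<close> that involves the generator \<open>q\<close> of that same degree. Hence
      every nonzero entry has positive degree and no constant term.\<close>
    moreover have "W i q \<noteq> W (Suc i) s"
    proof
      assume "W i q = W (Suc i) s"
      then have "c (Suc i) s \<in> ker_part (r i) (W i) (c i) (W i q)" using cS_ker[OF qs(2)] by simp
      moreover have "min_cover V (case i of 0 \<Rightarrow> nonfaces N | Suc j \<Rightarrow> ker_part (r j) (W j) (c j)) (r i) (W i) (c i)"
        using cov0 covS by (cases i) auto
      ultimately have "c (Suc i) s q = 0"
        using min_coverD(3) WV[OF qs(1)] by blast
      then show False using False by blast
    qed
    then have "W (Suc i) s - W i q \<noteq> {}" using sub by blast
    then have "sqf_mon (W (Suc i) s - W i q) \<noteq> 0" using keys_mon[OF fin'] by auto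
    moreover have "W (Suc i) s - W i q \<subseteq> V" using WV[OF qs(2)] by blast
    ultimately show ?thesis
      unfolding pmat_index[OF qs] eq
      using keys_mon[OF fin'] monom_deg_mon[OF fin']
      by (auto intro!: polys_single homogeneous_single simp: lookup_single when_def)
  qed
  have image_G: "(\<lambda>u. ?G *\<^sub>v u) ` free_module V (r 0) =
      {x \<in> free_module V 1. \<forall>m. component 1 (\<lambda>_. {}) x m \<in> nonfaces N (keys m)}"
    using sqf_module_nonfaces[OF N] nonfaces_sub by (intro image_pmat[OF V _ cov0]) auto
  have comp1: "component 1 (\<lambda>_. {}) x m \<in> nonfaces N (keys m) \<longleftrightarrow>
      (lookup (x $ 0) m \<noteq> 0 \<longrightarrow> keys m \<in> N)" for x :: "(nat, 'k) mpoly vec" and m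
    by (auto simp: component_def nonfaces_def)
  have g_image: "(\<lambda>u. ?g \<bullet> u) ` free_module V (r 0) = sqf_ideal V N"
  proof (intro Set.equalityI subsetI)
    fix p assume "p \<in> (\<lambda>u. ?g \<bullet> u) ` free_module V (r 0)"
    then obtain u where u: "u \<in> free_module V (r 0)" "p = ?g \<bullet> u" by blast
    have "?G *\<^sub>v u \<in> {x \<in> free_module V 1. \<forall>m. component 1 (\<lambda>_. {}) x m \<in> nonfaces N (keys m)}"
      using u(1) unfolding image_G[symmetric] by blast
    then have "(?G *\<^sub>v u) $ 0 \<in> polys V"
      "\<forall>m. lookup ((?G *\<^sub>v u) $ 0) m \<noteq> 0 \<longrightarrow> keys m \<in> N"
      unfolding comp1 by (auto simp: free_module_def)
    then show "p \<in> sqf_ideal V N"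
      unfolding sqf_ideal_def u(2) G_mult(1)[OF carrier[OF u(1)]] by (auto simp: in_keys_iff)
  next
    fix p :: "(nat, 'k) mpoly" assume p: "p \<in> sqf_ideal V N"
    have "vec 1 (\<lambda>_. p) \<in> {x \<in> free_module V 1. \<forall>m. component 1 (\<lambda>_. {}) x m \<in> nonfaces N (keys m)}"
    proof -
      have "p \<in> polys V" "lookup p m \<noteq> 0 \<longrightarrow> keys m \<in> N" for m
        using p unfolding sqf_ideal_def by (simp_all add: in_keys_iff)
      then show ?thesis unfolding mem_Collect_eq comp1 by (simp add: free_module_def)
    qed
    then obtain u where u: "u \<in> free_module V (r 0)" "vec 1 (\<lambda>_. p) = ?G *\<^sub>v u"
      unfolding image_G[symmetric] by blast
    have "p = vec 1 (\<lambda>_. p) $ 0" by simp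
    also have "\<dots> = ?g \<bullet> u" unfolding u(2) by (rule G_mult(1)[OF carrier[OF u(1)]])
    finally show "p \<in> (\<lambda>u. ?g \<bullet> u) ` free_module V (r 0)" using u(1) by blast
  qed
  have image_D: "(\<lambda>w. ?D i *\<^sub>v w) ` free_module V (r (Suc i)) =
      {u \<in> free_module V (r i). \<forall>m. component (r i) (W i) u m \<in> ker_part (r i) (W i) (c i) (keys m)}" for i
    using WV ker_sub sqf_module_ker_part by (intro image_pmat[OF V _ covS]) auto
  have exact0: "{u \<in> free_module V (r 0). ?g \<bullet> u = 0} = (\<lambda>w. ?D 0 *\<^sub>v w) ` free_module V (r (Suc 0))"
  proof -
    have "?g \<bullet> u = 0 \<longleftrightarrow> (\<forall>m. component (r 0) (W 0) u m \<in> ker_part (r 0) (W 0) (c 0) (keys m))"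
      if u: "u \<in> free_module V (r 0)" for u
    proof -
      note uc = carrier[OF u]
      have "?g \<bullet> u = 0 \<longleftrightarrow> ?G *\<^sub>v u = 0\<^sub>v 1"
      proof
        assume "?g \<bullet> u = 0"
        then show "?G *\<^sub>v u = 0\<^sub>v 1"
          using G_mult(1)[OF uc] carrier_vecD[OF G_mult(2)[OF uc]] by (intro eq_vecI) auto
      next
        assume "?G *\<^sub>v u = 0\<^sub>v 1"
        then show "?g \<bullet> u = 0" using G_mult(1)[OF uc] by simp
      qed
      also have "\<dots> \<longleftrightarrow> (\<forall>m. component (r 0) (W 0) u m \<in> ker_part (r 0) (W 0) (c 0) (keys m))"
        using fin c0 by (intro kernel_pmat[OF uc]) auto
      finally show ?thesis .
    qed
    then show ?thesis unfolding image_D by blast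
  qed
  have exactS: "{u \<in> free_module V (r (Suc i)). ?D i *\<^sub>v u = 0\<^sub>v (r i)} =
      (\<lambda>w. ?D (Suc i) *\<^sub>v w) ` free_module V (r (Suc (Suc i)))" for i
  proof -
    have "?D i *\<^sub>v u = 0\<^sub>v (r i) \<longleftrightarrow> (\<forall>m. component (r (Suc i)) (W (Suc i)) u m \<in>
        ker_part (r (Suc i)) (W (Suc i)) (c (Suc i)) (keys m))"
      if u: "u \<in> free_module V (r (Suc i))" for u
      using fin cS by (intro kernel_pmat[OF carrier[OF u]]) auto
    then show ?thesis unfolding image_D by blast
  qed
  show ?thesis
    unfolding minimal_graded_free_resolution_def
    using g_free g_hom D_carrier D_entry g_image exact0 exactS by (simp add: One_nat_def)
qed

section \<open>The edge ideal as a squarefree monomial ideal\<close>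

lemma var_mult_var:
  assumes "a \<noteq> b"
  shows "var a * var b = Poly_Mapping.single (sqf_mon {a, b}) (1 :: 'k::field)"
  using assms by (simp add: var_def mult_single sqf_mon_def)

lemma ideal_gen_add:
  assumes "p \<in> ideal_gen V S" "q \<in> ideal_gen V S"
  shows "p + q \<in> ideal_gen V S"
proof -
  obtain A c where p: "p = (\<Sum>f\<in>A. c f * f)" "finite A" "A \<subseteq> S" "\<forall>f\<in>A. c f \<in> polys V"
    using assms(1) unfolding ideal_gen_def by blast
  obtain B d where q: "q = (\<Sum>f\<in>B. d f * f)" "finite B" "B \<subseteq> S" "\<forall>f\<in>B. d f \<in> polys V"
    using assms(2) unfolding ideal_gen_def by blast
  define e where "e f = (if f \<in> A then c f else 0) + (if f \<in> B then d f else 0)" for f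
  have "(\<Sum>f\<in>A \<union> B. e f * f) = (\<Sum>f\<in>A \<union> B. (if f \<in> A then c f else 0) * f) + (\<Sum>f\<in>A \<union> B. (if f \<in> B then d f else 0) * f)"
    by (simp add: e_def distrib_right sum.distrib)
  also have "(\<Sum>f\<in>A \<union> B. (if f \<in> A then c f else 0) * f) = (\<Sum>f\<in>A. (if f \<in> A then c f else 0) * f)"
    using p(2) q(2) by (intro sum.mono_neutral_right) auto
  also have "\<dots> = p" unfolding p(1) by (intro sum.cong) auto
  also have "(\<Sum>f\<in>A \<union> B. (if f \<in> B then d f else 0) * f) = (\<Sum>f\<in>B. (if f \<in> B then d f else 0) * f)"
    using p(2) q(2) by (intro sum.mono_neutral_right) auto
  also have "\<dots> = q" unfolding q(1) by (intro sum.cong) auto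
  finally have "p + q = (\<Sum>f\<in>A \<union> B. e f * f)" by simp
  moreover have "\<forall>f\<in>A \<union> B. e f \<in> polys V"
    using p(4) q(4) by (auto simp: e_def intro!: polys_add)
  ultimately show ?thesis
    unfolding ideal_gen_def using p(2,3) q(2,3) by blast
qed

lemma ideal_gen_zero: "0 \<in> ideal_gen V S"
  unfolding ideal_gen_def by (rule CollectI, rule exI[of _ "{}"]) simp

lemma ideal_gen_sum: "(\<And>x. x \<in> X \<Longrightarrow> f x \<in> ideal_gen V S) \<Longrightarrow> sum f X \<in> ideal_gen V S"
  by (induction X rule: infinite_finite_induct) (auto intro: ideal_gen_add ideal_gen_zero)

text \<open>Membership in a monomial ideal is decided monomial by monomial, and divisibility by a
  product of two distinct variables depends only on the support.\<close>

lemma edge_ideal_eq: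
  assumes E: "\<And>a b. {a, b} \<in> E \<Longrightarrow> a \<in> V \<and> b \<in> V \<and> a \<noteq> b"
    and N: "\<And>T. T \<subseteq> V \<Longrightarrow> T \<in> N \<longleftrightarrow> (\<exists>a\<in>T. \<exists>b\<in>T. {a, b} \<in> E)"
  shows "(edge_ideal V E :: (nat, 'k::field) mpoly set) = sqf_ideal V N"
proof (intro Set.equalityI subsetI)
  fix p :: "(nat, 'k) mpoly" assume "p \<in> edge_ideal V E"
  then obtain A c where p: "p = (\<Sum>f\<in>A. c f * f)" "A \<subseteq> {var a * var b | a b. {a, b} \<in> E}"
    "\<forall>f\<in>A. c f \<in> polys V"
    unfolding edge_ideal_def ideal_gen_def by blast
  have A: "\<exists>a b. {a, b} \<in> E \<and> f = Poly_Mapping.single (sqf_mon {a, b}) 1" if f: "f \<in> A" for f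
  proof -
    obtain a b where "{a, b} \<in> E" "f = var a * var b" using p(2) f by blast
    moreover from this have "a \<noteq> b" using E[of a b] by blast
    ultimately show ?thesis using var_mult_var[where 'k = 'k, of a b] by auto
  qed
  have "f \<in> polys V" if f: "f \<in> A" for f
  proof -
    obtain a b where ab: "{a, b} \<in> E" "f = Poly_Mapping.single (sqf_mon {a, b}) 1" using A[OF f] by blast
    have "keys (sqf_mon {a, b}) \<subseteq> V"
      using E[OF ab(1)] by (simp add: keys_mon)
    then show ?thesis unfolding ab(2) by (rule polys_single)
  qed
  then have polys: "p \<in> polys V"
    unfolding p(1) using p(3) by (auto intro!: polys_sum polys_mult)
  have "keys m \<in> N" if m: "m \<in> keys p" for m
  proof -
    have "(\<Sum>f\<in>A. lookup (c f * f) m) \<noteq> 0"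
      using m unfolding p(1) in_keys_iff Poly_Mapping.lookup_sum .
    then obtain f where f: "f \<in> A" "lookup (c f * f) m \<noteq> 0"
      by (rule sum.not_neutral_contains_not_neutral)
    obtain a b where ab: "{a, b} \<in> E" "f = Poly_Mapping.single (sqf_mon {a, b}) 1" using A[OF f(1)] by blast
    have "m \<in> keys (c f * f)" using f(2) by (simp add: in_keys_iff)
    then obtain l l' where l: "l' \<in> keys f" "m = l + l'"
      using keys_mult[of "c f" f] by blast
    then have "m = l + sqf_mon {a, b}" using ab(2) by (simp split: if_splits)
    then have keys_m: "keys m = keys l \<union> {a, b}"
      by (simp add: keys_add_nat keys_mon)
    have "keys m \<subseteq> V" using polys m unfolding polys_def by blast
    moreover have "\<exists>a\<in>keys m. \<exists>b\<in>keys m. {a, b} \<in> E"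
      using ab(1) unfolding keys_m by (intro bexI[of _ a] bexI[of _ b]) auto
    ultimately show ?thesis using N by simp
  qed
  then show "p \<in> sqf_ideal V N" using polys unfolding sqf_ideal_def by blast
next
  fix p :: "(nat, 'k) mpoly" assume p: "p \<in> sqf_ideal V N"
  have "Poly_Mapping.single m (lookup p m) \<in> edge_ideal V E" if m: "m \<in> keys p" for m
  proof -
    have mV: "keys m \<subseteq> V" "keys m \<in> N"
      using p m unfolding sqf_ideal_def polys_def by blast+
    then obtain a b where ab: "a \<in> keys m" "b \<in> keys m" "{a, b} \<in> E"
      using N[OF mV(1)] by auto
    let ?l = "m - sqf_mon {a, b}"
    let ?f = "var a * var b :: (nat, 'k) mpoly"
    have m_eq: "sqf_mon {a, b} + ?l = m" using ab by (intro mon_le) auto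
    then have "keys ?l \<subseteq> V" using mV(1) keys_add_nat[of "sqf_mon {a, b}" ?l] by auto
    then have poly: "Poly_Mapping.single ?l (lookup p m) \<in> polys V" by (rule polys_single)
    have "Poly_Mapping.single m (lookup p m) = Poly_Mapping.single ?l (lookup p m) * ?f"
      using m_eq var_mult_var[where 'k = 'k, of a b] E[OF ab(3)] by (simp add: mult_single add.commute)
    also have "\<dots> = (\<Sum>f\<in>{?f}. Poly_Mapping.single ?l (lookup p m) * f)" by simp
    finally have eq: "Poly_Mapping.single m (lookup p m) =
        (\<Sum>f\<in>{?f}. Poly_Mapping.single ?l (lookup p m) * f)" .
    show ?thesis
    proof -
      have "{?f} \<subseteq> {var a * var b | a b. {a, b} \<in> E}" using ab(3) by auto
      then show ?thesis
        unfolding edge_ideal_def ideal_gen_def using eq poly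
        by (intro CollectI exI[of _ "{?f}"] exI[of _ "\<lambda>_. Poly_Mapping.single ?l (lookup p m)"]) simp
    qed
  qed
  then have "(\<Sum>m\<in>keys p. Poly_Mapping.single m (lookup p m)) \<in> edge_ideal V E"
    unfolding edge_ideal_def by (rule ideal_gen_sum)
  then show "p \<in> edge_ideal V E" unfolding sum_monomials .
qed

section \<open>Uniqueness of graded Betti numbers\<close>

lemma monom_deg_superset:
  assumes "finite A" "keys m \<subseteq> A"
  shows "monom_deg m = (\<Sum>v\<in>A. lookup m v)"
  unfolding monom_deg_def using assms by (intro sum.mono_neutral_left) (auto simp: in_keys_iff)

lemma monom_deg_add: "monom_deg (a + b) = monom_deg a + monom_deg b"
proof -
  let ?A = "keys a \<union> keys b"
  have "monom_deg (a + b) = (\<Sum>v\<in>?A. lookup (a + b) v)"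
    using keys_add[of a b] by (intro monom_deg_superset) auto
  also have "\<dots> = (\<Sum>v\<in>?A. lookup a v) + (\<Sum>v\<in>?A. lookup b v)"
    by (simp add: lookup_add sum.distrib)
  also have "\<dots> = monom_deg a + monom_deg b"
    using monom_deg_superset[of ?A a] monom_deg_superset[of ?A b] by simp
  finally show ?thesis .
qed

lemma monom_deg_zero [simp]: "monom_deg 0 = 0"
  by (simp add: monom_deg_def)

lemma monom_deg_eq_0: "monom_deg m = 0 \<Longrightarrow> m = 0"
  unfolding monom_deg_def by (rule poly_mapping_eqI) (metis finite_keys in_keys_iff lookup_zero sum_eq_0_iff)

lemma homogeneous_mult:
  assumes "homogeneous d p" "homogeneous e q"
  shows "homogeneous (d + e) (p * q)"
  unfolding homogeneous_def
proof
  fix m assume "m \<in> keys (p * q)"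
  then obtain a b where "a \<in> keys p" "b \<in> keys q" "m = a + b"
    using keys_mult[of p q] by blast
  then show "int (monom_deg m) = d + e"
    using assms by (simp add: homogeneous_def monom_deg_add)
qed

lemma homogeneous_add: "homogeneous d p \<Longrightarrow> homogeneous d q \<Longrightarrow> homogeneous d (p + q)"
  unfolding homogeneous_def using keys_add[of p q] by blast

lemma homogeneous_sum: "(\<And>x. x \<in> A \<Longrightarrow> homogeneous d (f x)) \<Longrightarrow> homogeneous d (sum f A)"
  by (induction A rule: infinite_finite_induct) (auto intro: homogeneous_add)

lemma homogeneous_const:
  fixes p :: "('v, 'k::field) mpoly"
  assumes "homogeneous d p" "d \<noteq> 0"
  shows "lookup p 0 = 0"
proof (rule ccontr)
  assume "lookup p 0 \<noteq> 0"
  then have "0 \<in> keys p" by (simp add: in_keys_iff)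
  then have "int (monom_deg (0 :: 'v \<Rightarrow>\<^sub>0 nat)) = d" using assms(1) unfolding homogeneous_def by blast
  then show False using assms(2) by simp
qed

lemma homogeneous_nonpos:
  assumes "homogeneous d p" "d \<le> 0" "lookup p 0 = 0"
  shows "p = 0"
proof (rule poly_mapping_eqI)
  fix m
  have "m = 0" if "m \<in> keys p"
  proof -
    have "int (monom_deg m) = d" using assms(1) that unfolding homogeneous_def by blast
    then have "monom_deg m = 0" using assms(2) by linarith
    then show ?thesis by (rule monom_deg_eq_0)
  qed
  then have "lookup p m = 0"
    using assms(3) by (cases "m \<in> keys p") (auto simp: in_keys_iff)
  then show "lookup p m = lookup 0 m" by simp
qed

definition hcomp :: "int \<Rightarrow> ('v, 'k::field) mpoly \<Rightarrow> ('v, 'k) mpoly" where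
  "hcomp d p = (\<Sum>m\<in>{m \<in> keys p. int (monom_deg m) = d}. Poly_Mapping.single m (lookup p m))"

lemma lookup_hcomp:
  "lookup (hcomp d p) m = (if int (monom_deg m) = d then lookup p m else 0)"
proof -
  let ?A = "{m \<in> keys p. int (monom_deg m) = d}"
  have "lookup (hcomp d p) m = (\<Sum>l\<in>?A. if m = l then lookup p l else 0)"
    unfolding hcomp_def Poly_Mapping.lookup_sum lookup_single by (rule sum.cong) (auto simp: when_def)
  also have "\<dots> = (if m \<in> ?A then lookup p m else 0)" by simp
  finally show ?thesis by (simp add: in_keys_iff)
qed

lemma hcomp_add: "hcomp d (p + q) = hcomp d p + hcomp d q"
  by (rule poly_mapping_eqI) (simp add: lookup_hcomp lookup_add)

lemma hcomp_zero: "hcomp d 0 = 0"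
  by (rule poly_mapping_eqI) (simp add: lookup_hcomp)

lemma hcomp_sum: "hcomp d (sum f A) = (\<Sum>x\<in>A. hcomp d (f x))"
  by (induction A rule: infinite_finite_induct) (simp_all add: hcomp_add hcomp_zero)

lemma keys_hcomp: "keys (hcomp d p) = {m \<in> keys p. int (monom_deg m) = d}"
  by (auto simp: in_keys_iff lookup_hcomp split: if_splits)

lemma homogeneous_hcomp: "homogeneous d (hcomp d p)"
  by (simp add: homogeneous_def keys_hcomp)

lemma hcomp_homogeneous:
  assumes "homogeneous d p"
  shows "hcomp d p = p"
proof (rule poly_mapping_eqI)
  fix m
  show "lookup (hcomp d p) m = lookup p m"
    using assms unfolding lookup_hcomp homogeneous_def by (auto simp: in_keys_iff)
qed

lemma hcomp_polys: "p \<in> polys V \<Longrightarrow> hcomp d p \<in> polys V"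
  by (auto simp: polys_def keys_hcomp)

lemma hcomp_mult:
  assumes "homogeneous e a"
  shows "hcomp (e + d) (a * p) = a * hcomp d p"
proof -
  define q where "q = p - hcomp d p"
  have p: "p = hcomp d p + q" by (simp add: q_def)
  have q: "int (monom_deg m) \<noteq> d" if "m \<in> keys q" for m
    using that unfolding q_def in_keys_iff lookup_minus lookup_hcomp by auto
  have "hcomp (e + d) (a * q) = 0"
  proof (rule poly_mapping_eqI)
    fix m
    have "int (monom_deg m) \<noteq> e + d" if "m \<in> keys (a * q)"
    proof -
      obtain x y where xy: "x \<in> keys a" "y \<in> keys q" "m = x + y"
        using \<open>m \<in> keys (a * q)\<close> keys_mult[of a q] by blast
      have "int (monom_deg x) = e" using assms xy(1) unfolding homogeneous_def by blast
      then show ?thesis using q[OF xy(2)] xy(3) by (simp add: monom_deg_add)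
    qed
    then show "lookup (hcomp (e + d) (a * q)) m = lookup 0 m"
      unfolding lookup_hcomp by (auto simp: in_keys_iff)
  qed
  moreover have "hcomp (e + d) (a * hcomp d p) = a * hcomp d p"
    by (intro hcomp_homogeneous homogeneous_mult assms homogeneous_hcomp)
  ultimately have "hcomp (e + d) (a * (hcomp d p + q)) = a * hcomp d p"
    by (simp add: distrib_left hcomp_add)
  then show ?thesis using p by simp
qed

lemma lookup_mult_0: "lookup (p * q) 0 = lookup p 0 * lookup q 0"
  for p q :: "('v, 'k::field) mpoly"
proof -
  have zero: "l = 0" if "l + l' = 0" for l l' :: "'v \<Rightarrow>\<^sub>0 nat"
  proof -
    have "monom_deg l + monom_deg l' = 0" using that by (metis monom_deg_add monom_deg_zero)
    then show ?thesis by (intro monom_deg_eq_0) simp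
  qed
  have "p * q = (\<Sum>l\<in>keys p. Poly_Mapping.single l (lookup p l) * q)"
    by (simp only: sum_distrib_right[symmetric] sum_monomials)
  then have "lookup (p * q) 0 =
      (\<Sum>l\<in>keys p. lookup (Poly_Mapping.single l (lookup p l) * q) 0)"
    by (simp only: Poly_Mapping.lookup_sum)
  also have "\<dots> = (\<Sum>l\<in>keys p. if 0 = l then lookup p l * lookup q 0 else 0)"
  proof (rule sum.cong[OF refl])
    fix l
    show "lookup (Poly_Mapping.single l (lookup p l) * q) 0 =
        (if 0 = l then lookup p l * lookup q 0 else 0)"
    proof (cases "l = 0")
      case True
      then show ?thesis
        using lookup_single_mult(1)[of l "lookup p l" q 0] by simp
    next
      case False
      have "lookup (Poly_Mapping.single l (lookup p l) * q) 0 = 0"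
      proof (rule lookup_single_mult(2))
        show "0 \<noteq> l + b" for b using zero[of l b] False by metis
      qed
      then show ?thesis using False by simp
    qed
  qed
  also have "\<dots> = lookup p 0 * lookup q 0"
    by (simp add: in_keys_iff)
  finally show ?thesis .
qed

section \<open>Graded maps of free modules\<close>

lemma free_module_carrier: "u \<in> free_module V n \<Longrightarrow> u \<in> carrier_vec n"
  by (simp add: free_module_def)

lemma free_module_diff:
  fixes u v :: "('v, 'k::field) mpoly vec"
  assumes "u \<in> free_module V n" "v \<in> free_module V n"
  shows "u - v \<in> free_module V n"
proof -
  have uv: "u \<in> carrier_vec n" "v \<in> carrier_vec n" "\<And>s. s < n \<Longrightarrow> u $ s \<in> polys V" "\<And>s. s < n \<Longrightarrow> v $ s \<in> polys V"
    using assms by (auto simp: free_module_def)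
  have "(u - v) $ s \<in> polys V" if "s < n" for s
    using polys_minus[OF uv(3)[OF that] uv(4)[OF that]] uv(2) that by simp
  then show ?thesis using uv(1,2) by (simp add: free_module_def)
qed

lemma free_module_add:
  fixes u v :: "('v, 'k::field) mpoly vec"
  assumes "u \<in> free_module V n" "v \<in> free_module V n"
  shows "u + v \<in> free_module V n"
proof -
  have uv: "u \<in> carrier_vec n" "v \<in> carrier_vec n" "\<And>s. s < n \<Longrightarrow> u $ s \<in> polys V" "\<And>s. s < n \<Longrightarrow> v $ s \<in> polys V"
    using assms by (auto simp: free_module_def)
  have "(u + v) $ s \<in> polys V" if "s < n" for s
    using polys_add[OF uv(3)[OF that] uv(4)[OF that]] uv(2) that by simp
  then show ?thesis using uv(1,2) by (simp add: free_module_def)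
qed

lemma free_module_zero: "0\<^sub>v n \<in> free_module V n"
  by (simp add: free_module_def)

lemma free_module_unit: "unit_vec n s \<in> free_module V n"
  by (auto simp: free_module_def unit_vec_def)

text \<open>A degree-preserving map from the free module with basis degrees \<open>e\<close> to the
  one with basis degrees \<open>d\<close>.\<close>

definition graded_mat ::
  "'v set \<Rightarrow> nat \<Rightarrow> (nat \<Rightarrow> int) \<Rightarrow> nat \<Rightarrow> (nat \<Rightarrow> int) \<Rightarrow> ('v, 'k::field) mpoly mat \<Rightarrow> bool" where
  "graded_mat V n d m e A \<longleftrightarrow> A \<in> carrier_mat n m \<and>
    (\<forall>q<n. \<forall>s<m. A $$ (q, s) \<in> polys V \<and> homogeneous (e s - d q) (A $$ (q, s)))"

lemma graded_matD:
  assumes "graded_mat V n d m e A"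
  shows "A \<in> carrier_mat n m" "q < n \<Longrightarrow> s < m \<Longrightarrow> A $$ (q, s) \<in> polys V"
    "q < n \<Longrightarrow> s < m \<Longrightarrow> homogeneous (e s - d q) (A $$ (q, s))"
  using assms by (auto simp: graded_mat_def)

lemma graded_mat_free: "graded_mat V n d m e A \<Longrightarrow> u \<in> free_module V m \<Longrightarrow> A *\<^sub>v u \<in> free_module V n"
  using free_module_mult[of A n m V u] graded_matD[of V n d m e A] by blast

lemma mult_mat_index:
  assumes "A \<in> carrier_mat n m" "B \<in> carrier_mat m l" "q < n" "s < l"
  shows "(A * B) $$ (q, s) = (\<Sum>j<m. A $$ (q, j) * B $$ (j, s))"
  using assms by (simp add: scalar_prod_def lessThan_atLeast0)

lemma graded_mat_mult:
  assumes A: "graded_mat V n d m e A" and B: "graded_mat V m e l f B"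
  shows "graded_mat V n d l f (A * B)"
  unfolding graded_mat_def
proof (intro conjI allI impI)
  show "A * B \<in> carrier_mat n l" using graded_matD(1)[OF A] graded_matD(1)[OF B] by simp
  fix q s assume qs: "q < n" "s < l"
  note eq = mult_mat_index[OF graded_matD(1)[OF A] graded_matD(1)[OF B] qs]
  show "(A * B) $$ (q, s) \<in> polys V"
    unfolding eq using graded_matD(2)[OF A qs(1)] graded_matD(2)[OF B _ qs(2)]
    by (intro polys_sum polys_mult) auto
  show "homogeneous (f s - d q) ((A * B) $$ (q, s))"
    unfolding eq
  proof (rule homogeneous_sum)
    fix j assume "j \<in> {..<m}"
    then have "homogeneous ((e j - d q) + (f s - e j)) (A $$ (q, j) * B $$ (j, s))"
      using graded_matD(3)[OF A qs(1)] graded_matD(3)[OF B _ qs(2)] by (intro homogeneous_mult) auto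
    then show "homogeneous (f s - d q) (A $$ (q, j) * B $$ (j, s))" by simp
  qed
qed

text \<open>Replace each coordinate of \<open>w\<close> by its homogeneous component of the expected
  degree. A graded matrix commutes with this, so a homogeneous image is not changed.\<close>

lemma lift_homogeneous:
  assumes B: "graded_mat V n d m e B" and w: "w \<in> free_module V m"
    and y: "\<And>q. q < n \<Longrightarrow> homogeneous (a - d q) ((B *\<^sub>v w) $ q)"
  shows "\<exists>w'\<in>free_module V m. B *\<^sub>v w' = B *\<^sub>v w \<and> (\<forall>s<m. homogeneous (a - e s) (w' $ s))"
proof
  let ?w = "vec m (\<lambda>s. hcomp (a - e s) (w $ s))"
  show free: "?w \<in> free_module V m"
    using w by (auto simp: free_module_def intro: hcomp_polys)
  have "(B *\<^sub>v ?w) $ q = (B *\<^sub>v w) $ q" if q: "q < n" for q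
  proof -
    have "(B *\<^sub>v ?w) $ q = (\<Sum>s<m. B $$ (q, s) * hcomp (a - e s) (w $ s))"
      by (subst mult_mat_vec_index[OF graded_matD(1)[OF B] free_module_carrier[OF free] q]) simp
    also have "\<dots> = (\<Sum>s<m. hcomp (a - d q) (B $$ (q, s) * w $ s))"
    proof (rule sum.cong[OF refl])
      fix s assume "s \<in> {..<m}"
      then have "hcomp ((e s - d q) + (a - e s)) (B $$ (q, s) * w $ s) = B $$ (q, s) * hcomp (a - e s) (w $ s)"
        using graded_matD(3)[OF B q] by (intro hcomp_mult) auto
      then show "B $$ (q, s) * hcomp (a - e s) (w $ s) = hcomp (a - d q) (B $$ (q, s) * w $ s)"
        by simp
    qed
    also have "\<dots> = hcomp (a - d q) ((B *\<^sub>v w) $ q)"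
      by (simp only: hcomp_sum mult_mat_vec_index[OF graded_matD(1)[OF B] free_module_carrier[OF w] q])
    also have "\<dots> = (B *\<^sub>v w) $ q" by (rule hcomp_homogeneous[OF y[OF q]])
    finally show ?thesis .
  qed
  then have "B *\<^sub>v ?w = B *\<^sub>v w"
    using graded_matD(1)[OF B] by (intro eq_vecI) auto
  then show "B *\<^sub>v ?w = B *\<^sub>v w \<and> (\<forall>s<m. homogeneous (a - e s) (?w $ s))"
    by (simp add: homogeneous_hcomp)
qed

lemma mult_unit_vec:
  assumes "A \<in> carrier_mat n m" "s < m"
  shows "A *\<^sub>v unit_vec m s = (col A s :: ('v, 'k::field) mpoly vec)"
proof (rule eq_vecI)
  show "dim_vec (A *\<^sub>v unit_vec m s) = dim_vec (col A s)" by simp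
  fix q assume "q < dim_vec (col A s)"
  then have q: "q < n" using assms(1) by simp
  have "(A *\<^sub>v unit_vec m s) $ q = (\<Sum>j<m. A $$ (q, j) * unit_vec m s $ j)"
    by (rule mult_mat_vec_index[OF assms(1) _ q]) simp
  also have "\<dots> = (\<Sum>j<m. if s = j then A $$ (q, j) else 0)"
    using assms(2) by (intro sum.cong) (auto simp: unit_vec_def)
  also have "\<dots> = col A s $ q" using assms q by simp
  finally show "(A *\<^sub>v unit_vec m s) $ q = col A s $ q" .
qed

text \<open>Graded projectivity of free modules: the columns of \<open>A\<close> are lifted through
  \<open>B\<close> one by one, homogeneously.\<close>

lemma lift_graded_mat:
  assumes A: "graded_mat V n d m e A" and B: "graded_mat V n d m' e' B"
    and sub: "(\<lambda>u. A *\<^sub>v u) ` free_module V m \<subseteq> (\<lambda>u. B *\<^sub>v u) ` free_module V m'"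
  shows "\<exists>P. graded_mat V m' e' m e P \<and> B * P = A"
proof -
  have "\<exists>w. w \<in> free_module V m' \<and> B *\<^sub>v w = col A s \<and> (\<forall>j<m'. homogeneous (e s - e' j) (w $ j))"
    if s: "s < m" for s
  proof -
    have col: "A *\<^sub>v unit_vec m s = col A s"
      by (rule mult_unit_vec[OF graded_matD(1)[OF A] s])
    then have "col A s \<in> (\<lambda>u. B *\<^sub>v u) ` free_module V m'"
      using sub free_module_unit[of m s V] by (metis image_eqI subsetD)
    then obtain w where w: "w \<in> free_module V m'" "col A s = B *\<^sub>v w" by blast
    have "homogeneous (e s - d q) ((B *\<^sub>v w) $ q)" if "q < n" for q
      using graded_matD(1,3)[OF A] that s unfolding w(2)[symmetric] by simp
    then show ?thesis using lift_homogeneous[OF B w(1), of "e s"] unfolding w(2) by blast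
  qed
  then obtain w where w: "\<And>s. s < m \<Longrightarrow> w s \<in> free_module V m'" "\<And>s. s < m \<Longrightarrow> B *\<^sub>v w s = col A s"
    "\<And>s j. s < m \<Longrightarrow> j < m' \<Longrightarrow> homogeneous (e s - e' j) (w s $ j)"
    by metis
  let ?P = "mat m' m (\<lambda>(j, s). w s $ j)"
  have "graded_mat V m' e' m e ?P"
    unfolding graded_mat_def using w(1,3) by (auto simp: free_module_def)
  moreover have "B * ?P = A"
  proof (rule eq_matI)
    show dims: "dim_row (B * ?P) = dim_row A" "dim_col (B * ?P) = dim_col A"
      using graded_matD(1)[OF A] graded_matD(1)[OF B] by auto
    fix q s assume "q < dim_row A" "s < dim_col A"
    then have qs: "q < n" "s < m" using graded_matD(1)[OF A] by auto
    have "(B * ?P) $$ (q, s) = (\<Sum>j<m'. B $$ (q, j) * w s $ j)"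
      using mult_mat_index[OF graded_matD(1)[OF B], of ?P m q s] qs by simp
    also have "\<dots> = (B *\<^sub>v w s) $ q"
      using mult_mat_vec_index[OF graded_matD(1)[OF B] free_module_carrier[OF w(1)[OF qs(2)]] qs(1)] by simp
    also have "\<dots> = A $$ (q, s)"
      using w(2)[OF qs(2)] graded_matD(1)[OF A] qs by simp
    finally show "(B * ?P) $$ (q, s) = A $$ (q, s)" .
  qed
  ultimately show ?thesis by blast
qed

text \<open>A graded endomorphism that is the identity modulo the maximal ideal is unitriangular when the
  basis is ordered by degree.\<close>

context
  fixes V :: "'v set" and m :: nat and e :: "nat \<Rightarrow> int" and E :: "('v, 'k::field) mpoly mat"
  assumes E: "graded_mat V m e m e E"
    and const: "\<And>q s. q < m \<Longrightarrow> s < m \<Longrightarrow> lookup (E $$ (q, s)) 0 = (if q = s then 1 else 0)"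
begin

lemma unitri_entry:
  assumes "q < m" "s < m" "e s \<le> e q"
  shows "E $$ (q, s) = (if q = s then 1 else 0)"
proof (cases "q = s")
  case True
  have "E $$ (q, s) - 1 = 0"
  proof (rule homogeneous_nonpos[of 0])
    have "homogeneous 0 (E $$ (q, s))" using graded_matD(3)[OF E assms(1,2)] True by simp
    moreover have "homogeneous 0 (- 1 :: ('v, 'k) mpoly)" by (simp add: homogeneous_def)
    ultimately have "homogeneous 0 (E $$ (q, s) + - 1)" by (rule homogeneous_add)
    then show "homogeneous 0 (E $$ (q, s) - 1)" by simp
    show "lookup (E $$ (q, s) - 1) 0 = 0"
      using const[OF assms(1,2)] True by (simp add: lookup_minus)
  qed simp
  then show ?thesis using True by simp
next
  case False
  then show ?thesis
    using homogeneous_nonpos[OF graded_matD(3)[OF E assms(1,2)]] assms(3) const[OF assms(1,2)] by simp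
qed

lemma unitri_top:
  assumes u: "u \<in> carrier_vec m" and q: "q < m" and top: "\<And>s. s < m \<Longrightarrow> e q < e s \<Longrightarrow> u $ s = 0"
  shows "(E *\<^sub>v u) $ q = u $ q"
proof -
  have "(E *\<^sub>v u) $ q = (\<Sum>s<m. E $$ (q, s) * u $ s)"
    by (rule mult_mat_vec_index[OF graded_matD(1)[OF E] u q])
  also have "\<dots> = (\<Sum>s<m. if q = s then u $ s else 0)"
  proof (rule sum.cong[OF refl])
    fix s assume "s \<in> {..<m}"
    then have s: "s < m" by simp
    show "E $$ (q, s) * u $ s = (if q = s then u $ s else 0)"
    proof (cases "e s \<le> e q")
      case True
      then show ?thesis using unitri_entry[OF q s] by simp
    next
      case False
      then show ?thesis using top[OF s] by auto
    qed
  qed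
  also have "\<dots> = u $ q" using q by simp
  finally show ?thesis .
qed

lemma exists_top:
  assumes "u \<in> carrier_vec m" "u \<noteq> 0\<^sub>v m"
  obtains q where "q < m" "u $ q \<noteq> 0" "\<And>s. s < m \<Longrightarrow> e q < e s \<Longrightarrow> u $ s = 0"
proof -
  define S where "S = {q. q < m \<and> u $ q \<noteq> 0}"
  have "finite S" by (simp add: S_def)
  have "S \<noteq> {}"
  proof
    assume "S = {}"
    then have "u = 0\<^sub>v m" using assms(1) by (intro eq_vecI) (auto simp: S_def)
    then show False using assms(2) by blast
  qed
  have "Max (e ` S) \<in> e ` S" using \<open>finite S\<close> \<open>S \<noteq> {}\<close> by (intro Max_in) auto
  then obtain q where q: "q \<in> S" "Max (e ` S) = e q" by blast
  have "u $ s = 0" if "s < m" "e q < e s" for s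
  proof (rule ccontr)
    assume "u $ s \<noteq> 0"
    then have "e s \<le> Max (e ` S)" using that(1) \<open>finite S\<close> by (intro Max_ge) (auto simp: S_def)
    then show False using that(2) q(2) by simp
  qed
  then show ?thesis using that q(1) unfolding S_def by blast
qed

lemma unitri_inj:
  assumes u: "u \<in> carrier_vec m" "E *\<^sub>v u = 0\<^sub>v m"
  shows "u = 0\<^sub>v m"
proof (rule ccontr)
  assume "u \<noteq> 0\<^sub>v m"
  then obtain q where q: "q < m" "u $ q \<noteq> 0" "\<And>s. s < m \<Longrightarrow> e q < e s \<Longrightarrow> u $ s = 0"
    by (rule exists_top[OF u(1)]) blast
  have "(E *\<^sub>v u) $ q = u $ q" by (rule unitri_top[OF u(1) q(1,3)])
  then show False using u(2) q(1,2) by simp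
qed

text \<open>Successive approximation: \<open>u - E u\<close> has no coordinates in the top degree of
  \<open>u\<close>. The induction measure counts the basis elements of degree at most this top
  degree, so it is a natural number although degrees are integers.\<close>

lemma unitri_surj:
  assumes "u \<in> free_module V m"
  shows "\<exists>w\<in>free_module V m. E *\<^sub>v w = u"
  using assms
proof (induction "card {q. q < m \<and> (\<exists>s<m. u $ s \<noteq> 0 \<and> e q \<le> e s)}" arbitrary: u rule: less_induct)
  case less
  note uc = free_module_carrier[OF less.prems]
  show ?case
  proof (cases "u = 0\<^sub>v m")
    case True
    have "E *\<^sub>v 0\<^sub>v m = 0\<^sub>v m" using graded_matD(1)[OF E] by (intro eq_vecI) (auto simp: scalar_prod_def)
    then show ?thesis using True free_module_zero by blast
  next
    case False
    obtain q where q: "q < m" "u $ q \<noteq> 0" "\<And>s. s < m \<Longrightarrow> e q < e s \<Longrightarrow> u $ s = 0"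
      using False by (rule exists_top[OF uc]) blast
    define y where "y = E *\<^sub>v u"
    have Eu: "y \<in> free_module V m" unfolding y_def by (rule graded_mat_free[OF E less.prems])
    note yc = free_module_carrier[OF Eu]
    let ?u = "u - y"
    have u': "?u \<in> free_module V m" by (rule free_module_diff[OF less.prems Eu])
    have low: "e s < e q" if s: "s < m" "?u $ s \<noteq> 0" for s
    proof (rule ccontr)
      assume "\<not> e s < e q"
      then have "y $ s = u $ s" unfolding y_def using q(3) by (intro unitri_top[OF uc s(1)]) simp
      then show False using s yc by simp
    qed
    have "{j. j < m \<and> (\<exists>s<m. ?u $ s \<noteq> 0 \<and> e j \<le> e s)} \<subset> {j. j < m \<and> (\<exists>s<m. u $ s \<noteq> 0 \<and> e j \<le> e s)}"
    proof
      show "{j. j < m \<and> (\<exists>s<m. ?u $ s \<noteq> 0 \<and> e j \<le> e s)} \<subseteq> {j. j < m \<and> (\<exists>s<m. u $ s \<noteq> 0 \<and> e j \<le> e s)}"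
        using low q(1,2) by (smt (verit, best) mem_Collect_eq subsetI)
      have "q \<notin> {j. j < m \<and> (\<exists>s<m. ?u $ s \<noteq> 0 \<and> e j \<le> e s)}" using low by (auto simp: not_le)
      moreover have "q \<in> {j. j < m \<and> (\<exists>s<m. u $ s \<noteq> 0 \<and> e j \<le> e s)}" using q(1,2) by blast
      ultimately show "{j. j < m \<and> (\<exists>s<m. ?u $ s \<noteq> 0 \<and> e j \<le> e s)} \<noteq> {j. j < m \<and> (\<exists>s<m. u $ s \<noteq> 0 \<and> e j \<le> e s)}"
        by blast
    qed
    then have "card {j. j < m \<and> (\<exists>s<m. ?u $ s \<noteq> 0 \<and> e j \<le> e s)} < card {j. j < m \<and> (\<exists>s<m. u $ s \<noteq> 0 \<and> e j \<le> e s)}"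
      by (intro psubset_card_mono) auto
    then obtain w where w: "w \<in> free_module V m" "E *\<^sub>v w = ?u"
      using less.hyps[OF _ u'] by blast
    have "E *\<^sub>v (w + u) = E *\<^sub>v w + y"
      unfolding y_def using mult_add_distrib_mat_vec[OF graded_matD(1)[OF E] free_module_carrier[OF w(1)] uc] .
    also have "\<dots> = u" unfolding w(2) using uc yc by (intro eq_vecI) auto
    finally show ?thesis using free_module_add[OF w(1) less.prems] by blast
  qed
qed

end

text \<open>An identity matrix indexed by \<open>S\<close> factors through a space of dimension
  \<open>card S'\<close>: the columns of \<open>x\<close> are independent because the functionals
  \<open>L\<close> are dual to them.\<close>

lemma card_le_if_right_inverse:
  fixes x y :: "nat \<Rightarrow> nat \<Rightarrow> 'k::field"
  assumes "finite S" "finite S'"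
    and inv: "\<And>s s2. s \<in> S \<Longrightarrow> s2 \<in> S \<Longrightarrow> (\<Sum>q\<in>S'. y s2 q * x q s) = (if s2 = s then 1 else 0)"
  shows "card S \<le> card S'"
proof -
  interpret fv: vector_space "smul :: 'k \<Rightarrow> (nat \<Rightarrow> 'k) \<Rightarrow> nat \<Rightarrow> 'k"
    by unfold_locales (simp_all add: smul_distribs)
  define f where "f s = (\<lambda>q. if q \<in> S' then x q s else 0)" for s
  define L where "L s2 g = (\<Sum>q\<in>S'. y s2 q * g q)" for s2 and g :: "nat \<Rightarrow> 'k"
  have Lf: "L s2 (f s) = (if s2 = s then 1 else 0)" if "s \<in> S" "s2 \<in> S" for s s2
    unfolding L_def f_def inv[OF that, symmetric] by (intro sum.cong) auto
  have L_sum: "L s2 (\<Sum>s\<in>S. smul (a s) (f s)) = (\<Sum>s\<in>S. a s * L s2 (f s))" for a s2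
    unfolding L_def sum_apply sum_distrib_left by (subst sum.swap) (simp add: mult.left_commute)
  have inj: "inj_on f S"
  proof (rule inj_onI)
    fix s s2 assume s: "s \<in> S" "s2 \<in> S" "f s = f s2"
    have "L s2 (f s) = 1" unfolding s(3) using Lf[OF s(2,2)] by simp
    then show "s = s2" using Lf[OF s(1,2)] by (auto split: if_splits)
  qed
  have "fv.independent (f ` S)"
  proof
    assume "fv.dependent (f ` S)"
    then obtain b where b: "\<exists>v\<in>f ` S. b v \<noteq> 0" "(\<Sum>v\<in>f ` S. smul (b v) v) = 0"
      unfolding fv.dependent_finite[OF finite_imageI[OF assms(1)]] by blast
    have sum0: "(\<Sum>s\<in>S. smul (b (f s)) (f s)) = 0"
      using b(2) unfolding sum.reindex[OF inj] by simp
    have "b (f s2) = 0" if s2: "s2 \<in> S" for s2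
    proof -
      have "0 = L s2 (\<Sum>s\<in>S. smul (b (f s)) (f s))" unfolding sum0 by (simp add: L_def)
      also have "\<dots> = (\<Sum>s\<in>S. b (f s) * L s2 (f s))" by (rule L_sum)
      also have "\<dots> = (\<Sum>s\<in>S. if s2 = s then b (f s) else 0)"
        using Lf s2 by (intro sum.cong) auto
      also have "\<dots> = b (f s2)" using s2 assms(1) by simp
      finally show ?thesis by simp
    qed
    then show False using b(1) by blast
  qed
  moreover have "f ` S \<subseteq> fv.span (unit_fun ` S')"
  proof
    fix v assume "v \<in> f ` S"
    then obtain s where v: "v = f s" by blast
    have "f s = (\<Sum>q\<in>S'. smul (x q s) (unit_fun q))"
    proof
      fix j
      have "(\<Sum>q\<in>S'. smul (x q s) (unit_fun q)) j = (\<Sum>q\<in>S'. if j = q then x q s else 0)"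
        unfolding sum_apply by (rule sum.cong) (auto simp: unit_fun_def)
      also have "\<dots> = f s j" using assms(2) by (simp add: f_def)
      finally show "f s j = (\<Sum>q\<in>S'. smul (x q s) (unit_fun q)) j" by simp
    qed
    moreover have "(\<Sum>q\<in>S'. smul (x q s) (unit_fun q)) \<in> fv.span (unit_fun ` S')"
      by (intro fv.span_sum fv.span_scale fv.span_base imageI)
    ultimately show "v \<in> fv.span (unit_fun ` S')" unfolding v by simp
  qed
  ultimately have "card (f ` S) \<le> card (unit_fun ` S' :: (nat \<Rightarrow> 'k) set)"
    using fv.independent_span_bound[of "unit_fun ` S'" "f ` S"] assms(2) by blast
  then show ?thesis
    using card_image[OF inj] card_image_le[OF assms(2), of "unit_fun :: nat \<Rightarrow> nat \<Rightarrow> 'k"] by linarith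
qed

lemma kernel_no_constants:
  fixes B :: "('v, 'k::field) mpoly mat"
  assumes B: "B \<in> carrier_mat m l"
    and const: "\<And>q s. q < m \<Longrightarrow> s < l \<Longrightarrow> lookup (B $$ (q, s)) 0 = 0"
    and w: "w \<in> carrier_vec l" and q: "q < m"
  shows "lookup ((B *\<^sub>v w) $ q) 0 = 0"
  unfolding mult_mat_vec_index[OF B w q] Poly_Mapping.lookup_sum
  using const[OF q] by (intro sum.neutral ballI) (simp add: lookup_mult_0)

text \<open>The difference between column \<open>s\<close> of \<open>E\<close> and the unit vector
  lies in the kernel of \<open>A\<close>, and by minimality elements of that kernel have no constant
  terms.\<close>

lemma lifts_unitriangular:
  fixes A :: "('v, 'k::field) mpoly mat"
  assumes A: "graded_mat V n d m e A" and E: "graded_mat V m e m e E" and AE: "A * E = A"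
    and ker: "\<And>u s. u \<in> free_module V m \<Longrightarrow> A *\<^sub>v u = 0\<^sub>v n \<Longrightarrow> s < m \<Longrightarrow> lookup (u $ s) 0 = 0"
    and qs: "q < m" "s < m"
  shows "lookup (E $$ (q, s)) 0 = (if q = s then 1 else 0)"
proof -
  note Ac = graded_matD(1)[OF A] and Ec = graded_matD(1)[OF E]
  define x where "x = E *\<^sub>v unit_vec m s"
  have x: "x \<in> free_module V m" unfolding x_def by (rule graded_mat_free[OF E free_module_unit])
  have "A *\<^sub>v x = (A * E) *\<^sub>v unit_vec m s"
    unfolding x_def by (rule assoc_mult_mat_vec[OF Ac Ec, symmetric]) simp
  then have Ax: "A *\<^sub>v x = A *\<^sub>v unit_vec m s" unfolding AE .
  have "A *\<^sub>v (x - unit_vec m s) = A *\<^sub>v x - A *\<^sub>v unit_vec m s"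
    by (rule mult_minus_distrib_mat_vec[OF Ac free_module_carrier[OF x]]) simp
  also have "\<dots> = 0\<^sub>v n"
    unfolding Ax using mult_mat_vec_carrier[OF Ac, of "unit_vec m s"] by (intro minus_cancel_vec) simp
  finally have "lookup ((x - unit_vec m s) $ q) 0 = 0"
    using ker[OF free_module_diff[OF x free_module_unit]] qs(1) by blast
  moreover have "(x - unit_vec m s) $ q = E $$ (q, s) - (if q = s then 1 else 0)"
  proof -
    have "x $ q = E $$ (q, s)"
      unfolding x_def mult_unit_vec[OF Ec qs(2)] using Ec qs by simp
    then show ?thesis using qs by (simp add: unit_vec_def)
  qed
  ultimately show ?thesis by (simp add: lookup_minus split: if_splits)
qed

text \<open>Pass to constant terms. A homogeneous entry can have one only between basis elements of
  equal degree, so the identity on the degree \<open>a\<close> block factors through the degree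
  \<open>a\<close> block of the other module.\<close>

lemma graded_card_le:
  fixes P Q :: "('v, 'k::field) mpoly mat"
  assumes P: "graded_mat V m' e' m e P" and Q: "graded_mat V m e m' e' Q"
    and const: "\<And>q s. q < m \<Longrightarrow> s < m \<Longrightarrow> lookup ((Q * P) $$ (q, s)) 0 = (if q = s then 1 else 0)"
  shows "card {s. s < m \<and> e s = a} \<le> card {s. s < m' \<and> e' s = a}"
proof (rule card_le_if_right_inverse)
  fix s s2 assume "s \<in> {s. s < m \<and> e s = a}" "s2 \<in> {s. s < m \<and> e s = a}"
  then have s: "s < m" "e s = a" "s2 < m" "e s2 = a" by auto
  have "(if s2 = s then 1 else 0) = lookup ((Q * P) $$ (s2, s)) 0"
    using const[OF s(3,1)] by simp
  also have "\<dots> = (\<Sum>q<m'. lookup (Q $$ (s2, q)) 0 * lookup (P $$ (q, s)) 0)"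
    by (simp add: mult_mat_index[OF graded_matD(1)[OF Q] graded_matD(1)[OF P] s(3,1)]
        Poly_Mapping.lookup_sum lookup_mult_0)
  also have "\<dots> = (\<Sum>q\<in>{q. q < m' \<and> e' q = a}. lookup (Q $$ (s2, q)) 0 * lookup (P $$ (q, s)) 0)"
  proof (rule sum.mono_neutral_right)
    show "\<forall>q\<in>{..<m'} - {q. q < m' \<and> e' q = a}.
        lookup (Q $$ (s2, q)) 0 * lookup (P $$ (q, s)) 0 = 0"
    proof
      fix q assume "q \<in> {..<m'} - {q. q < m' \<and> e' q = a}"
      then have q: "q < m'" "e s - e' q \<noteq> 0" using s(2) by auto
      have "lookup (P $$ (q, s)) 0 = 0"
        by (rule homogeneous_const[OF graded_matD(3)[OF P q(1) s(1)] q(2)])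
      then show "lookup (Q $$ (s2, q)) 0 * lookup (P $$ (q, s)) 0 = 0" by simp
    qed
  qed auto
  finally show "(\<Sum>q\<in>{q. q < m' \<and> e' q = a}. lookup (Q $$ (s2, q)) 0 * lookup (P $$ (q, s)) 0)
      = (if s2 = s then 1 else 0)" by simp
qed auto

text \<open>Lift each cover through the other. Both composites are unitriangular and therefore
  bijective, so the lifts themselves are injective and surjective, and they match basis
  degrees.\<close>

lemma minimal_covers_isomorphic:
  fixes A A' :: "('v, 'k::field) mpoly mat"
  assumes A: "graded_mat V n d m e A" and A': "graded_mat V n d m' e' A'"
    and im: "(\<lambda>u. A *\<^sub>v u) ` free_module V m = (\<lambda>u. A' *\<^sub>v u) ` free_module V m'"
    and ker: "\<And>u s. u \<in> free_module V m \<Longrightarrow> A *\<^sub>v u = 0\<^sub>v n \<Longrightarrow> s < m \<Longrightarrow> lookup (u $ s) 0 = 0"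
    and ker': "\<And>u s. u \<in> free_module V m' \<Longrightarrow> A' *\<^sub>v u = 0\<^sub>v n \<Longrightarrow> s < m' \<Longrightarrow> lookup (u $ s) 0 = 0"
  shows "\<exists>P. graded_mat V m' e' m e P \<and> A' * P = A \<and>
    (\<forall>u\<in>free_module V m. P *\<^sub>v u = 0\<^sub>v m' \<longrightarrow> u = 0\<^sub>v m) \<and>
    free_module V m' \<subseteq> (\<lambda>u. P *\<^sub>v u) ` free_module V m \<and>
    (\<forall>a. card {s. s < m \<and> e s = a} = card {s. s < m' \<and> e' s = a})"
proof -
  obtain P where P: "graded_mat V m' e' m e P" "A' * P = A"
    using lift_graded_mat[OF A A'] im by blast
  obtain Q where Q: "graded_mat V m e m' e' Q" "A * Q = A'"
    using lift_graded_mat[OF A' A] im by blast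
  note Pc = graded_matD(1)[OF P(1)] and Qc = graded_matD(1)[OF Q(1)]
    and Ac = graded_matD(1)[OF A] and Ac' = graded_matD(1)[OF A']
  have QP: "graded_mat V m e m e (Q * P)" by (rule graded_mat_mult[OF Q(1) P(1)])
  have PQ: "graded_mat V m' e' m' e' (P * Q)" by (rule graded_mat_mult[OF P(1) Q(1)])
  have "A * (Q * P) = A" using assoc_mult_mat[OF Ac Qc Pc] Q(2) P(2) by simp
  then have QP_const: "lookup ((Q * P) $$ (q, s)) 0 = (if q = s then 1 else 0)"
    if "q < m" "s < m" for q s
    using lifts_unitriangular[OF A QP _ ker that] by blast
  have "A' * (P * Q) = A'" using assoc_mult_mat[OF Ac' Pc Qc] Q(2) P(2) by simp
  then have PQ_const: "lookup ((P * Q) $$ (q, s)) 0 = (if q = s then 1 else 0)"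
    if "q < m'" "s < m'" for q s
    using lifts_unitriangular[OF A' PQ _ ker' that] by blast
  have "u = 0\<^sub>v m" if u: "u \<in> free_module V m" "P *\<^sub>v u = 0\<^sub>v m'" for u
  proof (rule unitri_inj[OF QP QP_const free_module_carrier[OF u(1)]])
    have "(Q * P) *\<^sub>v u = Q *\<^sub>v 0\<^sub>v m'"
      using assoc_mult_mat_vec[OF Qc Pc free_module_carrier[OF u(1)]] u(2) by simp
    also have "\<dots> = 0\<^sub>v m" using Qc by (intro eq_vecI) (auto simp: scalar_prod_def)
    finally show "(Q * P) *\<^sub>v u = 0\<^sub>v m" .
  qed
  moreover have "v \<in> (\<lambda>u. P *\<^sub>v u) ` free_module V m" if v: "v \<in> free_module V m'" for v
  proof -
    obtain w where w: "w \<in> free_module V m'" "(P * Q) *\<^sub>v w = v"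
      using unitri_surj[OF PQ PQ_const v] by blast
    have "v = P *\<^sub>v (Q *\<^sub>v w)"
      using assoc_mult_mat_vec[OF Pc Qc free_module_carrier[OF w(1)]] w(2) by simp
    then show ?thesis using graded_mat_free[OF Q(1) w(1)] by blast
  qed
  moreover have "card {s. s < m \<and> e s = a} = card {s. s < m' \<and> e' s = a}" for a
    using graded_card_le[OF P(1) Q(1) QP_const, of a] graded_card_le[OF Q(1) P(1) PQ_const, of a] by linarith
  ultimately show ?thesis using P by blast
qed

text \<open>The augmentation is treated as one more matrix, with a single row.\<close>

definition res_rank :: "(nat \<Rightarrow> nat) \<Rightarrow> nat \<Rightarrow> nat" where
  "res_rank r i = (case i of 0 \<Rightarrow> 1 | Suc j \<Rightarrow> r j)"

definition res_deg :: "(nat \<Rightarrow> nat \<Rightarrow> int) \<Rightarrow> nat \<Rightarrow> nat \<Rightarrow> int" where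
  "res_deg d i = (case i of 0 \<Rightarrow> (\<lambda>_. 0) | Suc j \<Rightarrow> d j)"

definition res_mat :: "('v, 'k::field) mpoly vec \<Rightarrow> (nat \<Rightarrow> ('v, 'k) mpoly mat) \<Rightarrow> nat \<Rightarrow> ('v, 'k) mpoly mat" where
  "res_mat g D i = (case i of 0 \<Rightarrow> mat_of_row g | Suc j \<Rightarrow> D j)"

lemma mat_of_row_mult:
  fixes g :: "('v, 'k::field) mpoly vec"
  assumes "g \<in> carrier_vec n"
  shows "mat_of_row g \<in> carrier_mat 1 n" "mat_of_row g *\<^sub>v u = vec 1 (\<lambda>_. g \<bullet> u)"
proof -
  show "mat_of_row g \<in> carrier_mat 1 n" using assms by simp
  show "mat_of_row g *\<^sub>v u = vec 1 (\<lambda>_. g \<bullet> u)"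
  proof (rule eq_vecI)
    fix i assume "i < dim_vec (vec 1 (\<lambda>_. g \<bullet> u))"
    then show "(mat_of_row g *\<^sub>v u) $ i = vec 1 (\<lambda>_. g \<bullet> u) $ i" by simp
  qed simp
qed

lemma resolution_matrices:
  fixes g :: "('v, 'k::field) mpoly vec"
  assumes "minimal_graded_free_resolution V I r d g D"
  shows "graded_mat V (res_rank r i) (res_deg d i) (res_rank r (Suc i)) (res_deg d (Suc i)) (res_mat g D i)"
    and "{u \<in> free_module V (res_rank r (Suc i)). res_mat g D i *\<^sub>v u = 0\<^sub>v (res_rank r i)} =
      (\<lambda>w. res_mat g D (Suc i) *\<^sub>v w) ` free_module V (res_rank r (Suc (Suc i)))"
    and "q < res_rank r (Suc i) \<Longrightarrow> s < res_rank r (Suc (Suc i)) \<Longrightarrow>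
      lookup (res_mat g D (Suc i) $$ (q, s)) 0 = 0"
    and "(\<lambda>u. res_mat g D 0 *\<^sub>v u) ` free_module V (res_rank r 1) = (\<lambda>p. vec 1 (\<lambda>_. p)) ` I"
proof -
  have g: "g \<in> free_module V (r 0)" "\<And>s. s < r 0 \<Longrightarrow> homogeneous (d 0 s) (g $ s)"
    and Dc: "\<And>i. D i \<in> carrier_mat (r i) (r (Suc i))"
    and De: "\<And>i q s. q < r i \<Longrightarrow> s < r (Suc i) \<Longrightarrow>
      D i $$ (q, s) \<in> polys V \<and> homogeneous (d (Suc i) s - d i q) (D i $$ (q, s))"
    and im: "(\<lambda>u. g \<bullet> u) ` free_module V (r 0) = I"
    and ex0: "{u \<in> free_module V (r 0). g \<bullet> u = 0} = (\<lambda>w. D 0 *\<^sub>v w) ` free_module V (r 1)"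
    and exS: "\<And>i. {u \<in> free_module V (r (Suc i)). D i *\<^sub>v u = 0\<^sub>v (r i)} =
      (\<lambda>w. D (Suc i) *\<^sub>v w) ` free_module V (r (Suc (Suc i)))"
    and min: "\<And>i q s. q < r i \<Longrightarrow> s < r (Suc i) \<Longrightarrow> lookup (D i $$ (q, s)) 0 = 0"
    using assms unfolding minimal_graded_free_resolution_def by simp_all
  note gc = mat_of_row_mult[OF free_module_carrier[OF g(1)]]
  show "graded_mat V (res_rank r i) (res_deg d i) (res_rank r (Suc i)) (res_deg d (Suc i)) (res_mat g D i)"
  proof (cases i)
    case 0
    have "mat_of_row g $$ (q, s) = g $ s" if "q < 1" "s < r 0" for q s
      using that free_module_carrier[OF g(1)] by (simp add: mat_of_row_def)
    then show ?thesis
      using 0 g gc(1) by (simp add: graded_mat_def res_rank_def res_deg_def res_mat_def free_module_def)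
  next
    case (Suc j)
    then show ?thesis
      using Dc De by (simp add: graded_mat_def res_rank_def res_deg_def res_mat_def)
  qed
  show "{u \<in> free_module V (res_rank r (Suc i)). res_mat g D i *\<^sub>v u = 0\<^sub>v (res_rank r i)} =
      (\<lambda>w. res_mat g D (Suc i) *\<^sub>v w) ` free_module V (res_rank r (Suc (Suc i)))"
  proof (cases i)
    case 0
    have "mat_of_row g *\<^sub>v u = 0\<^sub>v 1 \<longleftrightarrow> g \<bullet> u = 0" for u
    proof
      assume "mat_of_row g *\<^sub>v u = 0\<^sub>v 1"
      then have "vec 1 (\<lambda>_. g \<bullet> u) $ 0 = 0\<^sub>v 1 $ 0" unfolding gc(2) by (rule arg_cong)
      then show "g \<bullet> u = 0" by simp
    next
      assume "g \<bullet> u = 0"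
      then show "mat_of_row g *\<^sub>v u = 0\<^sub>v 1" unfolding gc(2) by (intro eq_vecI) auto
    qed
    then show ?thesis using 0 ex0 by (simp add: res_rank_def res_mat_def)
  next
    case (Suc j)
    then show ?thesis using exS[of j] by (simp add: res_rank_def res_mat_def)
  qed
  show "q < res_rank r (Suc i) \<Longrightarrow> s < res_rank r (Suc (Suc i)) \<Longrightarrow>
      lookup (res_mat g D (Suc i) $$ (q, s)) 0 = 0"
    using min by (simp add: res_rank_def res_mat_def)
  show "(\<lambda>u. res_mat g D 0 *\<^sub>v u) ` free_module V (res_rank r 1) = (\<lambda>p. vec 1 (\<lambda>_. p)) ` I"
    unfolding im[symmetric] image_image by (simp add: res_rank_def res_mat_def gc(2))
qed

lemma resolution_kernel_no_constants:
  fixes g :: "('v, 'k::field) mpoly vec"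
  assumes res: "minimal_graded_free_resolution V I r d g D"
    and u: "u \<in> free_module V (res_rank r (Suc i))" "res_mat g D i *\<^sub>v u = 0\<^sub>v (res_rank r i)"
    and s: "s < res_rank r (Suc i)"
  shows "lookup (u $ s) 0 = 0"
proof -
  obtain w where w: "w \<in> free_module V (res_rank r (Suc (Suc i)))" "u = res_mat g D (Suc i) *\<^sub>v w"
    using u resolution_matrices(2)[OF res, of i] by blast
  show ?thesis
    unfolding w(2)
    by (rule kernel_no_constants[OF graded_matD(1)[OF resolution_matrices(1)[OF res]] resolution_matrices(3)[OF res]
          free_module_carrier[OF w(1)] s])
qed

text \<open>Induction along the resolutions, starting from the identity of the ring below the
  augmentations. An isomorphism in step \<open>i\<close> that matches the images of the incoming
  differentials turns these into two minimal covers of one module, so it lifts to the next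
  step.\<close>

theorem betti_unique:
  fixes g g' :: "('v, 'k::field) mpoly vec"
  assumes res: "minimal_graded_free_resolution V I r d g D"
    and res': "minimal_graded_free_resolution V I r' d' g' D'"
  shows "card {s. s < r i \<and> d i s = j} = card {s. s < r' i \<and> d' i s = j}"
proof -
  let ?R = "res_rank r" and ?R' = "res_rank r'" and ?d = "res_deg d" and ?d' = "res_deg d'"
    and ?A = "res_mat g D" and ?A' = "res_mat g' D'"
  define iso where "iso i P \<longleftrightarrow> graded_mat V (?R' i) (?d' i) (?R i) (?d i) P \<and>
      (\<forall>u\<in>free_module V (?R i). P *\<^sub>v u = 0\<^sub>v (?R' i) \<longrightarrow> u = 0\<^sub>v (?R i)) \<and>
      (\<lambda>u. P *\<^sub>v u) ` ((\<lambda>u. ?A i *\<^sub>v u) ` free_module V (?R (Suc i))) = (\<lambda>u. ?A' i *\<^sub>v u) ` free_module V (?R' (Suc i))"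
    for i P
  note G = resolution_matrices(1)[OF res] and G' = resolution_matrices(1)[OF res']
  have step: "(\<exists>P'. iso (Suc i) P') \<and> (\<forall>a. card {s. s < ?R (Suc i) \<and> ?d (Suc i) s = a} = card {s. s < ?R' (Suc i) \<and> ?d' (Suc i) s = a})"
    if "iso i P" for i P
  proof -
    have P: "graded_mat V (?R' i) (?d' i) (?R i) (?d i) P"
      and P_inj: "\<And>u. u \<in> free_module V (?R i) \<Longrightarrow> P *\<^sub>v u = 0\<^sub>v (?R' i) \<Longrightarrow> u = 0\<^sub>v (?R i)"
      and P_im: "(\<lambda>u. P *\<^sub>v u) ` ((\<lambda>u. ?A i *\<^sub>v u) ` free_module V (?R (Suc i))) = (\<lambda>u. ?A' i *\<^sub>v u) ` free_module V (?R' (Suc i))"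
      using that unfolding iso_def by blast+
    have PA: "graded_mat V (?R' i) (?d' i) (?R (Suc i)) (?d (Suc i)) (P * ?A i)"
      by (rule graded_mat_mult[OF P G])
    have PA_mult: "(P * ?A i) *\<^sub>v u = P *\<^sub>v (?A i *\<^sub>v u)" if "u \<in> free_module V (?R (Suc i))" for u
      by (rule assoc_mult_mat_vec[OF graded_matD(1)[OF P] graded_matD(1)[OF G] free_module_carrier[OF that]])
    have PA_ker: "?A i *\<^sub>v u = 0\<^sub>v (?R i)"
      if "u \<in> free_module V (?R (Suc i))" "(P * ?A i) *\<^sub>v u = 0\<^sub>v (?R' i)" for u
      using P_inj[OF graded_mat_free[OF G that(1)]] that(2) unfolding PA_mult[OF that(1)] by blast
    have im: "(\<lambda>u. (P * ?A i) *\<^sub>v u) ` free_module V (?R (Suc i)) = (\<lambda>u. ?A' i *\<^sub>v u) ` free_module V (?R' (Suc i))"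
      unfolding P_im[symmetric] image_image using PA_mult by (intro image_cong) auto
    have ker: "lookup (u $ s) 0 = 0"
      if "u \<in> free_module V (?R (Suc i))" "(P * ?A i) *\<^sub>v u = 0\<^sub>v (?R' i)" "s < ?R (Suc i)" for u s
      using resolution_kernel_no_constants[OF res that(1) PA_ker[OF that(1,2)] that(3)] .
    have ker': "lookup (u $ s) 0 = 0"
      if "u \<in> free_module V (?R' (Suc i))" "?A' i *\<^sub>v u = 0\<^sub>v (?R' i)" "s < ?R' (Suc i)" for u s
      using resolution_kernel_no_constants[OF res' that] .
    obtain P' where P': "graded_mat V (?R' (Suc i)) (?d' (Suc i)) (?R (Suc i)) (?d (Suc i)) P'"
      "?A' i * P' = P * ?A i"
      "\<And>u. u \<in> free_module V (?R (Suc i)) \<Longrightarrow> P' *\<^sub>v u = 0\<^sub>v (?R' (Suc i)) \<Longrightarrow> u = 0\<^sub>v (?R (Suc i))"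
      "free_module V (?R' (Suc i)) \<subseteq> (\<lambda>u. P' *\<^sub>v u) ` free_module V (?R (Suc i))"
      "\<And>a. card {s. s < ?R (Suc i) \<and> ?d (Suc i) s = a} = card {s. s < ?R' (Suc i) \<and> ?d' (Suc i) s = a}"
      using minimal_covers_isomorphic[OF PA G' im ker ker'] by blast
    have comm: "?A' i *\<^sub>v (P' *\<^sub>v u) = (P * ?A i) *\<^sub>v u" if "u \<in> free_module V (?R (Suc i))" for u
      using assoc_mult_mat_vec[OF graded_matD(1)[OF G'] graded_matD(1)[OF P'(1)] free_module_carrier[OF that]]
      unfolding P'(2) by simp
    have P0: "P *\<^sub>v 0\<^sub>v (?R i) = 0\<^sub>v (?R' i)"
      using graded_matD(1)[OF P] by (intro eq_vecI) (auto simp: scalar_prod_def)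
    \<comment> \<open>By exactness these kernels are the images of the next differentials, so this
      equation is the matching condition of \<open>iso\<close> for \<open>Suc i\<close>.\<close>
    have "(\<lambda>u. P' *\<^sub>v u) ` {u \<in> free_module V (?R (Suc i)). ?A i *\<^sub>v u = 0\<^sub>v (?R i)} =
        {u \<in> free_module V (?R' (Suc i)). ?A' i *\<^sub>v u = 0\<^sub>v (?R' i)}"
    proof (intro Set.equalityI subsetI)
      fix x assume "x \<in> (\<lambda>u. P' *\<^sub>v u) ` {u \<in> free_module V (?R (Suc i)). ?A i *\<^sub>v u = 0\<^sub>v (?R i)}"
      then obtain u where u: "u \<in> free_module V (?R (Suc i))" "?A i *\<^sub>v u = 0\<^sub>v (?R i)" "x = P' *\<^sub>v u" by blast
      have "?A' i *\<^sub>v x = 0\<^sub>v (?R' i)"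
        unfolding u(3) comm[OF u(1)] PA_mult[OF u(1)] u(2) by (rule P0)
      then show "x \<in> {u \<in> free_module V (?R' (Suc i)). ?A' i *\<^sub>v u = 0\<^sub>v (?R' i)}"
        using graded_mat_free[OF P'(1) u(1)] unfolding u(3) by blast
    next
      fix x assume "x \<in> {u \<in> free_module V (?R' (Suc i)). ?A' i *\<^sub>v u = 0\<^sub>v (?R' i)}"
      then have x: "x \<in> free_module V (?R' (Suc i))" "?A' i *\<^sub>v x = 0\<^sub>v (?R' i)" by blast+
      obtain u where u: "u \<in> free_module V (?R (Suc i))" "x = P' *\<^sub>v u" using P'(4) x(1) by blast
      have "(P * ?A i) *\<^sub>v u = 0\<^sub>v (?R' i)" using comm[OF u(1)] x(2) unfolding u(2) by simp
      then have "?A i *\<^sub>v u = 0\<^sub>v (?R i)" by (rule PA_ker[OF u(1)])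
      then show "x \<in> (\<lambda>u. P' *\<^sub>v u) ` {u \<in> free_module V (?R (Suc i)). ?A i *\<^sub>v u = 0\<^sub>v (?R i)}"
        using u by blast
    qed
    then have "(\<lambda>u. P' *\<^sub>v u) ` ((\<lambda>u. ?A (Suc i) *\<^sub>v u) ` free_module V (?R (Suc (Suc i)))) =
        (\<lambda>u. ?A' (Suc i) *\<^sub>v u) ` free_module V (?R' (Suc (Suc i)))"
      unfolding resolution_matrices(2)[OF res] resolution_matrices(2)[OF res'] .
    then have "iso (Suc i) P'" unfolding iso_def using P'(1,3) by blast
    then show ?thesis using P'(5) by blast
  qed
  have "\<exists>P. iso i P" for i
  proof (induction i)
    case 0
    have rank0: "?R 0 = 1" "?R' 0 = 1" by (simp_all add: res_rank_def)
    have "graded_mat V 1 (?d' 0) 1 (?d 0) (1\<^sub>m 1 :: ('v, 'k) mpoly mat)"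
      by (auto simp: graded_mat_def res_deg_def homogeneous_def)
    moreover have id: "1\<^sub>m 1 *\<^sub>v u = u" if "u \<in> free_module V 1" for u :: "('v, 'k) mpoly vec"
      using free_module_carrier[OF that] by simp
    moreover have "(\<lambda>u. 1\<^sub>m 1 *\<^sub>v u) ` ((\<lambda>u. ?A 0 *\<^sub>v u) ` free_module V (?R (Suc 0))) = (\<lambda>u. ?A' 0 *\<^sub>v u) ` free_module V (?R' (Suc 0))"
    proof -
      have "(\<lambda>u. 1\<^sub>m 1 *\<^sub>v u) ` ((\<lambda>u. ?A 0 *\<^sub>v u) ` free_module V (?R (Suc 0))) = (\<lambda>u. ?A 0 *\<^sub>v u) ` free_module V (?R (Suc 0))"
        unfolding image_image using id graded_mat_free[OF G[of 0]] unfolding rank0 by (intro image_cong) auto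
      then show ?thesis
        using resolution_matrices(4)[OF res] resolution_matrices(4)[OF res'] by simp
    qed
    ultimately have "iso 0 (1\<^sub>m 1)"
      unfolding iso_def rank0 by simp
    then show ?case by blast
  next
    case (Suc i)
    then show ?case using step by blast
  qed
  then have "card {s. s < ?R (Suc i) \<and> ?d (Suc i) s = j} = card {s. s < ?R' (Suc i) \<and> ?d' (Suc i) s = j}"
    using step by blast
  then show ?thesis by (simp add: res_rank_def res_deg_def)
qed

lemma graded_betti_eq:
  assumes "minimal_graded_free_resolution V I r d g D"
  shows "graded_betti V I i j = card {s. s < r i \<and> d i s = j}"
  unfolding graded_betti_def
proof (rule the_equality)
  show "\<exists>r' d' g' D'. minimal_graded_free_resolution V I r' d' g' D' \<and>
      card {s. s < r i \<and> d i s = j} = card {s. s < r' i \<and> d' i s = j}"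
    using assms by blast
next
  fix b assume "\<exists>r' d' g' D'. minimal_graded_free_resolution V I r' d' g' D' \<and>
      b = card {s. s < r' i \<and> d' i s = j}"
  then show "b = card {s. s < r i \<and> d i s = j}"
    using betti_unique[OF _ assms] by blast
qed

section \<open>The graded Betti numbers of \<open>GA(t,k)'\<close>\<close>

text \<open>Represent the difference modulo \<open>n\<close> by a number below \<open>n\<close>. All
  values \<open>1 + j * t\<close> are below \<open>n\<close> too, so the congruence is an equality;
  a wrapped difference is turned back by \<open>adj_complement\<close>.\<close>

lemma GA'_edges_iff:
  assumes n: "n = t * (k - 1) + 2" and tk: "t \<ge> 1" "k \<ge> 3" and ab: "a < n" "b < n"
  shows "{a, b} \<in> GA'_edges t k \<longleftrightarrow> adj t k a b \<or> adj t k b a"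
proof -
  have order: "GA_order t k = n" using n by (simp add: GA_order_def)
  have cong_iff: "(\<exists>j\<in>{1..k - 2}. [int y - int x = 1 + int j * int t] (mod int n)) \<longleftrightarrow> adj t k x y \<or> adj t k y x"
    if xy: "x < n" "y < n" for x y
  proof -
    have bound: "1 + j * t < n" if "j \<in> {1..k - 2}" for j
    proof -
      have "j * t \<le> (k - 1) * t" using that by (intro mult_le_mono1) auto
      then show ?thesis using n mult.commute[of t "k - 1"] by linarith
    qed
    have eq: "[int y - int x = 1 + int j * int t] (mod int n) \<longleftrightarrow> (if x \<le> y then y - x else n - (x - y)) = 1 + j * t"
      if j: "j \<in> {1..k - 2}" for j
    proof -
      let ?z = "if x \<le> y then y - x else n - (x - y)"
      have z: "?z < n" using xy by auto
      have "[int y - int x = int ?z] (mod int n)"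
      proof (cases "x \<le> y")
        case True
        then show ?thesis by (simp add: of_nat_diff)
      next
        case False
        then have "int ?z = int y - int x + int n" using xy by (simp add: of_nat_diff)
        then show ?thesis by (simp add: cong_def)
      qed
      then have "[int y - int x = 1 + int j * int t] (mod int n) \<longleftrightarrow> [int ?z = int (1 + j * t)] (mod int n)"
        by (simp add: cong_def)
      also have "\<dots> \<longleftrightarrow> [?z = 1 + j * t] (mod n)" by (rule cong_int_iff)
      also have "\<dots> \<longleftrightarrow> ?z = 1 + j * t"
        unfolding cong_def using z bound[OF j] by (simp only: mod_less)
      finally show ?thesis .
    qed
    have "(\<exists>j\<in>{1..k - 2}. [int y - int x = 1 + int j * int t] (mod int n)) \<longleftrightarrow>
        adj t k 0 (if x \<le> y then y - x else n - (x - y))"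
      unfolding adj_def using eq by (intro bex_cong refl) simp
    also have "\<dots> \<longleftrightarrow> adj t k x y \<or> adj t k y x"
    proof (cases "x \<le> y")
      case True
      then show ?thesis using adj_shift[OF True, of t k] adj_less[of t k y x] by auto
    next
      case False
      then show ?thesis
        using adj_complement[OF n tk(2), of "x - y"] adj_shift[of y x t k] adj_less[of t k x y] xy by auto
    qed
    finally show ?thesis .
  qed
  show ?thesis
  proof
    assume "{a, b} \<in> GA'_edges t k"
    then obtain x y where xy: "{a, b} = {x, y}" "x < n" "y < n"
      "\<exists>j\<in>{1..k - 2}. [int y - int x = 1 + int j * int t] (mod int n)"
      unfolding GA'_edges_def GA'_verts_def order by auto
    have "adj t k x y \<or> adj t k y x" using cong_iff[OF xy(2,3)] xy(4) by blast
    moreover have "(a = x \<and> b = y) \<or> (a = y \<and> b = x)" using xy(1) by (simp add: doubleton_eq_iff)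
    ultimately show "adj t k a b \<or> adj t k b a" by blast
  next
    assume "adj t k a b \<or> adj t k b a"
    then have "\<exists>j\<in>{1..k - 2}. [int b - int a = 1 + int j * int t] (mod int n)"
      using cong_iff[OF ab] by blast
    then show "{a, b} \<in> GA'_edges t k"
      unfolding GA'_edges_def GA'_verts_def order using ab by auto
  qed
qed

lemma edge_ideal_GA':
  assumes n: "n = t * (k - 1) + 2" and tk: "t \<ge> 1" "k \<ge> 3"
  shows "(edge_ideal (GA'_verts t k) (GA'_edges t k) :: (nat, 'k::field) mpoly set) =
    sqf_ideal {0..<n} (dependent_sets t k)"
proof -
  have V: "GA'_verts t k = {0..<n}" using n by (simp add: GA'_verts_def GA_order_def)
  show ?thesis
    unfolding V
  proof (rule edge_ideal_eq)
    fix a b assume e: "{a, b} \<in> GA'_edges t k"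
    then obtain x y where xy: "{a, b} = {x, y}" "x \<in> {0..<n}" "y \<in> {0..<n}"
      unfolding GA'_edges_def V by auto
    then have ab: "a < n" "b < n" by (auto simp: doubleton_eq_iff)
    then show "a \<in> {0..<n} \<and> b \<in> {0..<n} \<and> a \<noteq> b"
      using e adj_less[of t k a b] adj_less[of t k b a] GA'_edges_iff[OF n tk ab] by auto
  next
    fix T assume T: "T \<subseteq> {0..<n}"
    show "T \<in> dependent_sets t k \<longleftrightarrow> (\<exists>a\<in>T. \<exists>b\<in>T. {a, b} \<in> GA'_edges t k)"
    proof
      assume "T \<in> dependent_sets t k"
      then obtain a b where ab: "a \<in> T" "b \<in> T" "adj t k a b" by (rule dependent_setsE)
      then have "a < n" "b < n" using T by auto
      then have "{a, b} \<in> GA'_edges t k" using GA'_edges_iff[OF n tk] ab(3) by blast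
      then show "\<exists>a\<in>T. \<exists>b\<in>T. {a, b} \<in> GA'_edges t k" using ab(1,2) by (intro bexI)
    next
      assume "\<exists>a\<in>T. \<exists>b\<in>T. {a, b} \<in> GA'_edges t k"
      then obtain a b where ab: "a \<in> T" "b \<in> T" "{a, b} \<in> GA'_edges t k" by auto
      then have "a < n" "b < n" using T by auto
      then have "adj t k a b \<or> adj t k b a" using GA'_edges_iff[OF n tk] ab(3) by blast
      then show "T \<in> dependent_sets t k" using ab(1,2) dependent_setsI by auto
    qed
  qed
qed

text \<open>The graded number is the sum over all \<open>U\<close> with
  \<open>card U = i + j\<close> of the numbers of generators of degree \<open>U\<close>. Each of
  these is governed by cohomology in degree \<open>card U - i = j\<close>, so only the full vertex
  set can contribute.\<close>

lemma graded_betti_GA':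
  fixes t k n i :: nat and j :: int
  assumes n: "n = t * (k - 1) + 2" and tk: "t \<ge> 1" "k \<ge> 3" and j: "j \<ge> int t + 2"
  shows "graded_betti (GA'_verts t k) (edge_ideal (GA'_verts t k) (GA'_edges t k) :: (nat, 'k::field) mpoly set) i (int i + j)
    = (if int i + j = int n \<and> j = int t + 2 then 1 else 0)"
proof -
  let ?V = "{0..<n}" and ?N = "dependent_sets t k"
  have V: "GA'_verts t k = ?V" using n by (simp add: GA'_verts_def GA_order_def)
  obtain r W and c :: "nat \<Rightarrow> nat \<Rightarrow> nat \<Rightarrow> 'k" where res: "sqf_resolution ?V ?N r W c"
    using exists_sqf_resolution[OF _ up_closed_dependent_sets, of ?V t k] by auto
  note min = sqf_resolution_minimal[OF _ up_closed_dependent_sets res]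
  have "graded_betti ?V (sqf_ideal ?V ?N :: (nat, 'k) mpoly set) i (int i + j) =
      card {s. s < r i \<and> int (card (W i s)) = int i + j}"
    by (rule graded_betti_eq[OF min]) simp
  also have "\<dots> = (if int i + j = int n \<and> j = int t + 2 then 1 else 0)"
  proof -
    have count: "card {s. s < r i \<and> W i s = U} = (if U = ?V \<and> j = int t + 2 then 1 else 0)"
      if U: "U \<subseteq> ?V" "int (card U) = int i + j" for U
    proof (rule sqf_resolution_count[OF res _ U(1) up_closed_dependent_sets])
      have "int (card U) - int i = j" using U(2) by simp
      then show "cohom (nonfaces ?N :: 'k sqf) U (int (card U) - int i) (U = ?V \<and> j = int t + 2)"
        using cohom_dependent_sets[OF n tk U(1) j] by simp
    qed simp
    have WV: "W i s \<subseteq> ?V" if "s < r i" for s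
      using res that unfolding sqf_resolution_def min_cover_def by (cases i) auto
    show ?thesis
    proof (cases "int i + j = int n \<and> j = int t + 2")
      case True
      have "{s. s < r i \<and> int (card (W i s)) = int i + j} = {s. s < r i \<and> W i s = ?V}"
      proof (intro Collect_cong conj_cong refl)
        fix s assume s: "s < r i"
        have "int (card (W i s)) = int i + j \<longleftrightarrow> card (W i s) = card ?V"
        proof -
          have "int i + j = int (card ?V)" using True by simp
          then show ?thesis by (simp only: of_nat_eq_iff)
        qed
        also have "\<dots> \<longleftrightarrow> W i s = ?V" using card_subset_eq[OF _ WV[OF s]] by auto
        finally show "int (card (W i s)) = int i + j \<longleftrightarrow> W i s = ?V" .
      qed
      then show ?thesis using count[of ?V] True by simp
    next
      case False
      have "\<not> (s < r i \<and> int (card (W i s)) = int i + j)" for s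
      proof
        assume s: "s < r i \<and> int (card (W i s)) = int i + j"
        have "\<not> (W i s = ?V \<and> j = int t + 2)" using False s by auto
        then have "card {s'. s' < r i \<and> W i s' = W i s} = 0"
          using count[of "W i s"] WV s by simp
        then show False using s by auto
      qed
      then have "{s. s < r i \<and> int (card (W i s)) = int i + j} = {}" by blast
      then show ?thesis unfolding if_not_P[OF False] by simp
    qed
  qed
  finally show ?thesis unfolding edge_ideal_GA'[OF n tk] unfolding V .
qed

theorem theorem5p1:
  fixes t k n :: nat
    and I :: "(nat, 'k::field) mpoly set"
  assumes "t \<ge> 1" and "k \<ge> 3" and "n = t * (k - 1) + 2"
    and "I = edge_ideal (GA'_verts t k) (GA'_edges t k)"
  shows "(\<forall>(i::nat) (j::int). j \<ge> int t + 2 \<longrightarrow>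
            graded_betti (GA'_verts t k) I i (int i + j) =
              (if int i + j = int n \<and> j = int t + 2 then 1 else 0)) \<and>
         regularity (GA'_verts t k) I = int t + 2"
proof
  have betti: "graded_betti (GA'_verts t k) I i (int i + j) =
      (if int i + j = int n \<and> j = int t + 2 then 1 else 0)" if "j \<ge> int t + 2" for i j
    unfolding assms(4) by (rule graded_betti_GA'[OF assms(3,1,2) that])
  then show "\<forall>(i::nat) (j::int). j \<ge> int t + 2 \<longrightarrow>
      graded_betti (GA'_verts t k) I i (int i + j) =
        (if int i + j = int n \<and> j = int t + 2 then 1 else 0)" by blast
  show "regularity (GA'_verts t k) I = int t + 2"
    unfolding regularity_def
  proof (rule Greatest_equality)
    \<comment> \<open>This makes the natural subtraction \<open>n - t - 2\<close> genuine; its value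
      \<open>t * (k - 2)\<close> is the homological step in which the regularity is
      attained.\<close>
    have "t * (k - 1) \<ge> t" using assms(1,2) by simp
    then have "int (n - t - 2) + (int t + 2) = int n" using assms(3) by simp
    then have "graded_betti (GA'_verts t k) I (n - t - 2) (int (n - t - 2) + (int t + 2)) \<noteq> 0"
      using betti[of "int t + 2" "n - t - 2"] by simp
    then show "\<exists>i. graded_betti (GA'_verts t k) I i (int i + (int t + 2)) \<noteq> 0" by blast
  next
    fix j assume "\<exists>i. graded_betti (GA'_verts t k) I i (int i + j) \<noteq> 0"
    then obtain i where "graded_betti (GA'_verts t k) I i (int i + j) \<noteq> 0" by blast
    then show "j \<le> int t + 2" using betti[of j i] by (cases "j \<le> int t + 2") auto
  qed
qed

end
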